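(* Let $k$ be a complete, non-trivially valued non-Archimedean field and $\Gamma\le\mathrm{PGL}(2,k)$ a finitely generated non-elementary subgroup. Then the following three subsets of $\mathbb{P}^{1,an}_k$ coincide: (i) the closure of the set of fixed points of all hyperbolic elements of $\Gamma$; (ii) the smallest non-empty closed $\Gamma$-invariant subset of $\mathbb{P}^{1,an}_k$; (iii) for any given $x\in\mathbb{P}^{1,an}_k$, the set of $y$ for which there is a sequence $(g_n)$ in $\Gamma$ with $\|g_n\|\to\infty$ and $g_n\cdot x\to y$. This set (the limit set of $\Gamma$) is compact, metrizable and contained in $\mathbb{H}_k\cup\mathbb{P}^1(k)$.
   Context: $\mathbb{P}^{1,an}_k$ is the Berkovich projective line over $k$ (one-point compactification of the space of multiplicative seminorms on $k[Z]$ extending $|\cdot|$, pointwise convergence topology), containing $\mathbb{P}^1(k)$ via $z\mapsto(P\mapsto|P(z)|)$; it is an $\mathbb{R}$-tree (uniquely path connected), and $\mathrm{PGL}(2,k)$ acts on it. $\mathbb{H}_k=\overline{\mathrm{Conv}(\mathbb{P}^1(k))}\setminus\mathbb{P}^1(k)$, where $\mathrm{Conv}$ is the union of all segments between points of $\mathbb{P}^1(k)$. For $\gamma\in\mathrm{PGL}(2,k)$, choose a lift $A\in\mathrm{SL}(2,K)$ with $K/k$ at most quadratic; $\|\gamma\|$ is the maximum absolute value of the entries of $A$, and $|\mathrm{tr}\gamma|=|\mathrm{tr}A|$. $\gamma$ is hyperbolic if $|\mathrm{tr}\gamma|>1$. $\Gamma$ is non-elementary if it contains a hyperbolic element and has no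 finite orbit in $\mathbb{P}^1(k)$. *)

theory Defs
  imports "HOL-Analysis.Analysis" "HOL-Computational_Algebra.Polynomial"
begin

definition nonarch_abs :: "('a::field \<Rightarrow> real) \<Rightarrow> bool" where
  "nonarch_abs v \<longleftrightarrow>
     (\<forall>x. 0 \<le> v x) \<and> (\<forall>x. v x = 0 \<longleftrightarrow> x = 0) \<and>
     (\<forall>x y. v (x * y) = v x * v y) \<and> (\<forall>x y. v (x + y) \<le> max (v x) (v y))"

definition nontrivial_abs :: "('a::field \<Rightarrow> real) \<Rightarrow> bool" where
  "nontrivial_abs v \<longleftrightarrow> (\<exists>x. v x \<noteq> 0 \<and> v x \<noteq> 1)"

definition complete_abs :: "('a::field \<Rightarrow> real) \<Rightarrow> bool" where
  "complete_abs v \<longleftrightarrow>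
     (\<forall>f::nat \<Rightarrow> 'a. (\<forall>e>0. \<exists>N. \<forall>m\<ge>N. \<forall>n\<ge>N. v (f m - f n) < e) \<longrightarrow>
        (\<exists>l. (\<lambda>n. v (f n - l)) \<longlonglongrightarrow> 0))"

definition onept_open :: "'b topology \<Rightarrow> 'b option set \<Rightarrow> bool" where
  "onept_open X U \<longleftrightarrow> openin X (Some -` U) \<and>
     (None \<in> U \<longrightarrow> compactin X (topspace X - Some -` U))"

lemma istopology_onept_open: "istopology (onept_open X)"
  unfolding istopology_def
proof (intro conjI allI impI)
  fix S T assume S: "onept_open X S" and T: "onept_open X T"
  have "topspace X - Some -` (S \<inter> T) = (topspace X - Some -` S) \<union> (topspace X - Some -` T)"
    by auto
  then show "onept_open X (S \<inter> T)"
    using S T unfolding onept_open_def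
    by (auto simp: openin_Int compactin_Un)
next
  fix K assume K: "\<forall>U\<in>K. onept_open X U"
  have pre: "Some -` \<Union>K = \<Union>((\<lambda>U. Some -` U) ` K)" by auto
  have op: "openin X (Some -` \<Union>K)"
    using K unfolding pre onept_open_def by (auto intro: openin_Union)
  moreover have "compactin X (topspace X - Some -` \<Union>K)" if N: "None \<in> \<Union>K"
  proof -
    obtain U where U: "U \<in> K" "None \<in> U" using N by blast
    have c: "compactin X (topspace X - Some -` U)" using K U unfolding onept_open_def by auto
    show ?thesis
      by (rule closed_compactin[OF c]) (use U op in \<open>auto intro: openin_closedin_eq[THEN iffD1]\<close>)
  qed
  ultimately show "onept_open X (\<Union>K)" unfolding onept_open_def by auto
qed

definition onept_compactification :: "'b topology \<Rightarrow> 'b option topology" where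
  "onept_compactification X = topology (onept_open X)"

definition berk_seminorm :: "('a::field \<Rightarrow> real) \<Rightarrow> ('a poly \<Rightarrow> real) \<Rightarrow> bool" where
  "berk_seminorm v s \<longleftrightarrow>
     (\<forall>P. 0 \<le> s P) \<and> (\<forall>c. s [:c:] = v c) \<and>
     (\<forall>P Q. s (P * Q) = s P * s Q) \<and> (\<forall>P Q. s (P + Q) \<le> s P + s Q)"

definition berk_aff :: "('a::field \<Rightarrow> real) \<Rightarrow> ('a poly \<Rightarrow> real) set" where
  "berk_aff v = {s. berk_seminorm v s}"

definition berk_aff_top :: "('a::field \<Rightarrow> real) \<Rightarrow> ('a poly \<Rightarrow> real) topology" where
  "berk_aff_top v = subtopology (product_topology (\<lambda>_. euclideanreal) UNIV) (berk_aff v)"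

text \<open>Berkovich projective line: None is the point at infinity.\<close>
definition berk_top :: "('a::field \<Rightarrow> real) \<Rightarrow> ('a poly \<Rightarrow> real) option topology" where
  "berk_top v = onept_compactification (berk_aff_top v)"

definition berk_space :: "('a::field \<Rightarrow> real) \<Rightarrow> ('a poly \<Rightarrow> real) option set" where
  "berk_space v = insert None (Some ` berk_aff v)"

definition berk_pt :: "('a::field \<Rightarrow> real) \<Rightarrow> 'a \<Rightarrow> ('a poly \<Rightarrow> real) option" where
  "berk_pt v z = Some (\<lambda>P. v (poly P z))"

definition P1k :: "('a::field \<Rightarrow> real) \<Rightarrow> ('a poly \<Rightarrow> real) option set" where
  "P1k v = insert None (range (berk_pt v))"

text \<open>Segment between two points: union of all arcs joining them (the unique arc, the space being an R-tree).\<close>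
definition berk_segment :: "('a::field \<Rightarrow> real) \<Rightarrow> ('a poly \<Rightarrow> real) option
     \<Rightarrow> ('a poly \<Rightarrow> real) option \<Rightarrow> ('a poly \<Rightarrow> real) option set" where
  "berk_segment v a b = \<Union>{g ` {0..1} | g. pathin (berk_top v) g \<and> inj_on g {0..1} \<and> g 0 = a \<and> g 1 = b}"

definition berk_conv_P1k :: "('a::field \<Rightarrow> real) \<Rightarrow> ('a poly \<Rightarrow> real) option set" where
  "berk_conv_P1k v = \<Union>{berk_segment v a b | a b. a \<in> P1k v \<and> b \<in> P1k v}"

definition berk_H :: "('a::field \<Rightarrow> real) \<Rightarrow> ('a poly \<Rightarrow> real) option set" where
  "berk_H v = (berk_top v closure_of berk_conv_P1k v) - P1k v"

text \<open>A matrix [[a,b],[c,d]] is encoded as (a,b,c,d); it acts by z \<mapsto> (a z + b)/(c z + d).\<close>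
type_synonym 'a mat2 = "'a \<times> 'a \<times> 'a \<times> 'a"

definition mdet :: "'a::field mat2 \<Rightarrow> 'a" where
  "mdet g = (case g of (a,b,c,d) \<Rightarrow> a*d - b*c)"

definition mmult :: "'a::field mat2 \<Rightarrow> 'a mat2 \<Rightarrow> 'a mat2" where
  "mmult g h = (case g of (a,b,c,d) \<Rightarrow> case h of (a',b',c',d') \<Rightarrow>
      (a*a' + b*c', a*b' + b*d', c*a' + d*c', c*b' + d*d'))"

definition minv :: "'a::field mat2 \<Rightarrow> 'a mat2" where
  "minv g = (case g of (a,b,c,d) \<Rightarrow> let e = a*d - b*c in (d/e, -b/e, -c/e, a/e))"

definition mscal :: "'a::field \<Rightarrow> 'a mat2" where
  "mscal t = (t, 0, 0, t)"

text \<open>Preimage in GL(2,k) of the subgroup of PGL(2,k) generated by S.\<close>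
inductive_set pgl_gen :: "'a::field mat2 set \<Rightarrow> 'a mat2 set" for S where
  gen: "g \<in> S \<Longrightarrow> mdet g \<noteq> 0 \<Longrightarrow> g \<in> pgl_gen S"
| scal: "t \<noteq> 0 \<Longrightarrow> mscal t \<in> pgl_gen S"
| mult: "g \<in> pgl_gen S \<Longrightarrow> h \<in> pgl_gen S \<Longrightarrow> mmult g h \<in> pgl_gen S"
| inv: "g \<in> pgl_gen S \<Longrightarrow> minv g \<in> pgl_gen S"

text \<open>G is the full preimage in GL(2,k) of a subgroup of PGL(2,k).\<close>
definition pgl_subgroup :: "'a::field mat2 set \<Rightarrow> bool" where
  "pgl_subgroup G \<longleftrightarrow> (\<forall>g\<in>G. mdet g \<noteq> 0) \<and> (\<forall>t. t \<noteq> 0 \<longrightarrow> mscal t \<in> G) \<and>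
     (\<forall>g\<in>G. \<forall>h\<in>G. mmult g h \<in> G) \<and> (\<forall>g\<in>G. minv g \<in> G)"

definition pgl_fin_gen :: "'a::field mat2 set \<Rightarrow> bool" where
  "pgl_fin_gen G \<longleftrightarrow> (\<exists>S. finite S \<and> G = pgl_gen S)"

text \<open>Numerator of P((aZ+b)/(cZ+d)) times (cZ+d)^deg P.\<close>
definition mob_num :: "'a::field mat2 \<Rightarrow> 'a poly \<Rightarrow> 'a poly" where
  "mob_num g P = (case g of (a,b,c,d) \<Rightarrow>
      (\<Sum>i\<le>degree P. smult (coeff P i) ([:b, a:] ^ i * [:d, c:] ^ (degree P - i))))"

definition berk_act :: "('a::field \<Rightarrow> real) \<Rightarrow> 'a mat2 \<Rightarrow> ('a poly \<Rightarrow> real) option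
     \<Rightarrow> ('a poly \<Rightarrow> real) option" where
  "berk_act v g x = (case g of (a,b,c,d) \<Rightarrow>
     (case x of
        None \<Rightarrow> (if c = 0 then None else berk_pt v (a / c))
      | Some s \<Rightarrow> (if s [:d, c:] = 0 then None
                   else Some (\<lambda>P. s (mob_num g P) / s [:d, c:] ^ degree P))))"

text \<open>Norm of gamma: max abs of the entries of a lift to SL(2,K), i.e. divided by sqrt |det|.\<close>
definition pgl_norm :: "('a::field \<Rightarrow> real) \<Rightarrow> 'a mat2 \<Rightarrow> real" where
  "pgl_norm v g = (case g of (a,b,c,d) \<Rightarrow>
      max (max (v a) (v b)) (max (v c) (v d)) / sqrt (v (a*d - b*c)))"

text \<open>|tr gamma| of a lift to SL(2,K).\<close>
definition pgl_abs_tr :: "('a::field \<Rightarrow> real) \<Rightarrow> 'a mat2 \<Rightarrow> real" where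
  "pgl_abs_tr v g = (case g of (a,b,c,d) \<Rightarrow> v (a + d) / sqrt (v (a*d - b*c)))"

definition hyperbolic :: "('a::field \<Rightarrow> real) \<Rightarrow> 'a mat2 \<Rightarrow> bool" where
  "hyperbolic v g \<longleftrightarrow> pgl_abs_tr v g > 1"

definition non_elementary :: "('a::field \<Rightarrow> real) \<Rightarrow> 'a mat2 set \<Rightarrow> bool" where
  "non_elementary v G \<longleftrightarrow> (\<exists>g\<in>G. hyperbolic v g) \<and>
     (\<forall>z\<in>P1k v. infinite {berk_act v g z | g. g \<in> G})"

definition hyp_fixed_points :: "('a::field \<Rightarrow> real) \<Rightarrow> 'a mat2 set \<Rightarrow> ('a poly \<Rightarrow> real) option set" where
  "hyp_fixed_points v G = {x \<in> berk_space v. \<exists>g\<in>G. hyperbolic v g \<and> berk_act v g x = x}"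

definition invariant_set :: "('a::field \<Rightarrow> real) \<Rightarrow> 'a mat2 set \<Rightarrow> ('a poly \<Rightarrow> real) option set \<Rightarrow> bool" where
  "invariant_set v G L \<longleftrightarrow> (\<forall>g\<in>G. \<forall>x\<in>L. berk_act v g x \<in> L)"

end

theory Submission
  imports Defs
begin

text \<open>A point of the Berkovich line is a multiplicative seminorm on binary forms, normalised on linear
  forms.  Two facts drive the proof.  If a normalised linear form is small at two points, these
  points are uniformly close.  For every \<open>g\<close> there are normalised linear forms \<open>l1\<close>, \<open>l2\<close>, cutting out
  an attracting and a repelling point, such that \<open>\<bar>l1 (g x)\<bar> \<cdot> \<bar>l2 (x)\<bar> \<le> \<parallel>g\<parallel>^-2\<close>, and
  symmetrically for the inverse of \<open>g\<close>.  Hence along a sequence with norms tending to infinity all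
  points that stay away from the repelling forms have the same limit; this compares the orbit of an
  arbitrary point with orbits inside the limit set, without any local compactness of the field.
  For a hyperbolic element the two forms are left eigenvectors, which exist in \<open>k\<close> by completeness.

  Finite generation makes the set of hyperbolic fixed points countable, and the closure of a
  countable set of classical points is metrizable: its points are determined by the
  values of countably many linear forms, because values of a polynomial of degree \<open>d\<close> at \<open>d + 1\<close>
  well-separated points control its values nearby.\<close>

section \<open>Seminorms on binary forms\<close>

text \<open>The Berkovich line need not be first countable, so a point of a closure need not be the
  limit of a sequence, while (iii) speaks of sequences. Metrizability is therefore an ingredient and
  not only a conclusion: it provides hyperbolic fixed points converging to a given limit point, and
  from these come the invariance of the closure, its inclusion in (iii) and its minimality. For this
  reason it is proved for closures of countable classical sets before any dynamics. Homogeneous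
  forms are used because the affine definitions split into cases at infinity and at poles, where the
  estimates would have to be repeated. After homogenization the action is a substitution followed by
  a renormalisation. The forms \<open>l1\<close>, \<open>l2\<close> come from the column and the row
  through an entry of largest absolute value. Arcs are needed only to place classical points in the
  convex hull; the tree structure and the classification of points by discs do not enter.\<close>

lemma coeff_mult_add:
  fixes P Q :: "'b::comm_semiring_0 poly"
  assumes "degree P \<le> n" "degree Q \<le> m"
  shows "coeff (P * Q) (n + m) = coeff P n * coeff Q m"
proof -
  have "coeff (P * Q) (n + m) = (\<Sum>i\<le>n+m. if i = n then coeff P n * coeff Q m else 0)"
    unfolding coeff_mult
  proof (rule sum.cong[OF refl])
    fix i assume "i \<in> {..n+m}"
    consider "i = n" | "i < n" | "n < i" by linarith
    then show "coeff P i * coeff Q (n + m - i) = (if i = n then coeff P n * coeff Q m else 0)"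
    proof cases
      case 2
      then show ?thesis using assms(2) by (simp add: coeff_eq_0)
    next
      case 3
      then show ?thesis using assms(1) by (simp add: coeff_eq_0)
    qed auto
  qed
  then show ?thesis by simp
qed

lemma poly_eq_sum_powers:
  fixes P :: "'b::comm_ring_1 poly"
  assumes "degree P \<le> n"
  shows "P = (\<Sum>i\<le>n. smult (coeff P i) ([:0,1:] ^ i))"
  using poly_as_sum_of_monoms'[OF assms] by (simp add: monom_altdef)

locale nonarch_valued =
  fixes v :: "'a::field \<Rightarrow> real"
  assumes nonarch: "nonarch_abs v"
begin

declare One_nat_def [simp del]

lemma v_nonneg [simp]: "0 \<le> v x"
  and v_eq_0_iff [simp]: "v x = 0 \<longleftrightarrow> x = 0"
  and v_mult: "v (x * y) = v x * v y"
  and v_add_le: "v (x + y) \<le> max (v x) (v y)"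
  using nonarch unfolding nonarch_abs_def by auto

lemma v_0 [simp]: "v 0 = 0"
  by simp

lemma v_pos_iff [simp]: "0 < v x \<longleftrightarrow> x \<noteq> 0"
  by (metis v_eq_0_iff v_nonneg less_le)

lemma v_1 [simp]: "v 1 = 1"
  using v_mult[of 1 1] by simp

lemma v_minus [simp]: "v (- x) = v x"
proof -
  have "v (-1) * v (-1) = 1"
    using v_mult[of "-1" "-1"] by simp
  then have "v (-1) = 1"
    by (metis abs_of_nonneg power2_eq_square real_sqrt_abs real_sqrt_one v_nonneg)
  then show ?thesis
    using v_mult[of "-1" x] by simp
qed

lemma v_diff_le: "v (x - y) \<le> max (v x) (v y)"
  using v_add_le[of x "- y"] by simp

lemma v_diff_commute: "v (x - y) = v (y - x)"
  using v_minus[of "x - y"] by simp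

lemma v_power: "v (x ^ n) = v x ^ n"
  by (induction n) (auto simp: v_mult)

lemma v_inverse: "v (inverse x) = inverse (v x)"
proof (cases "x = 0")
  case False
  then have "v x * v (inverse x) = 1"
    using v_mult[of x "inverse x"] by simp
  then show ?thesis
    by (metis inverse_unique)
qed simp

lemma v_divide: "v (x / y) = v x / v y"
  by (simp add: divide_inverse v_mult v_inverse)

lemma v_of_nat_le: "v (of_nat n) \<le> 1"
proof (induction n)
  case (Suc n)
  have "v (of_nat (Suc n)) \<le> max (v 1) (v (of_nat n))"
    unfolding of_nat_Suc by (rule v_add_le)
  with Suc show ?case by simp
qed simp

section \<open>Multiplicative seminorms on polynomials\<close>

context
  fixes s assumes s: "berk_seminorm v s"
begin

lemma sem_nonneg: "0 \<le> s P"
  and sem_const: "s [:c:] = v c"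
  and sem_mult: "s (P * Q) = s P * s Q"
  and sem_triangle: "s (P + Q) \<le> s P + s Q"
  using s unfolding berk_seminorm_def by auto

lemma sem_0: "s 0 = 0"
  using sem_const[of 0] by simp

lemma sem_1: "s 1 = 1"
  using sem_const[of 1] by (simp add: one_pCons)

lemma sem_power: "s (P ^ n) = s P ^ n"
  by (induction n) (auto simp: sem_mult sem_1)

lemma sem_smult: "s (smult c P) = v c * s P"
  using sem_mult[of "[:c:]" P] by (simp add: sem_const)

lemma sem_minus: "s (- P) = s P"
  using sem_smult[of "-1" P] by simp

lemma sem_sum_le: "s (sum f A) \<le> (\<Sum>i\<in>A. s (f i))"
proof (induction A rule: infinite_finite_induct)
  case (insert x F)
  then show ?case
    using sem_triangle[of "f x" "sum f F"] by simp
qed (auto simp: sem_0)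

text \<open>Expand \<open>(P + Q)^n\<close>: the binomial coefficients have seminorm at most 1, and \<open>n\<close>-th roots kill
  the factor \<open>n + 1\<close>.\<close>

lemma sem_ultra: "s (P + Q) \<le> max (s P) (s Q)"
proof (rule ccontr)
  define M where "M = max (s P) (s Q)"
  define S where "S = s (P + Q)"
  assume "\<not> s (P + Q) \<le> max (s P) (s Q)"
  then have MS: "M < S" unfolding M_def S_def by linarith
  have M0: "0 \<le> M" using sem_nonneg by (simp add: M_def max_def)
  have b: "S ^ n \<le> real (Suc n) * M ^ n" for n
  proof -
    have "S ^ n = s (\<Sum>k\<le>n. of_nat (n choose k) * P ^ k * Q ^ (n - k))"
      by (simp add: S_def sem_power flip: binomial_ring)
    also have "\<dots> \<le> (\<Sum>k\<le>n. s (of_nat (n choose k) * P ^ k * Q ^ (n - k)))"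
      by (rule sem_sum_le)
    also have "\<dots> \<le> (\<Sum>k\<le>n. M ^ n)"
    proof (rule sum_mono)
      fix k assume "k \<in> {..n}"
      then have k: "k \<le> n" by simp
      have "s (of_nat (n choose k) * P ^ k * Q ^ (n - k))
          = v (of_nat (n choose k)) * s P ^ k * s Q ^ (n - k)"
        by (simp add: sem_mult sem_power of_nat_poly sem_smult)
      also have "\<dots> \<le> 1 * M ^ k * M ^ (n - k)"
        by (intro mult_mono power_mono v_of_nat_le mult_nonneg_nonneg zero_le_power sem_nonneg M0)
           (auto simp: M_def)
      also have "\<dots> = M ^ n" using k by (simp flip: power_add)
      finally show "s (of_nat (n choose k) * P ^ k * Q ^ (n - k)) \<le> M ^ n" .
    qed
    also have "\<dots> = real (Suc n) * M ^ n" by simp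
    finally show ?thesis .
  qed
  have S0: "0 < S" using MS M0 by linarith
  define q where "q = M / S"
  have q: "0 \<le> q" "q < 1" using MS M0 S0 by (auto simp: q_def)
  have "(\<lambda>n. real n * q ^ n + q ^ n) \<longlonglongrightarrow> 0 + 0"
    by (intro tendsto_add powser_times_n_limit_0 LIMSEQ_power_zero) (use q in auto)
  moreover have "1 \<le> real n * q ^ n + q ^ n" for n
  proof -
    have "(real n * q ^ n + q ^ n) * S ^ n = real (Suc n) * M ^ n"
      using S0 by (simp add: q_def power_divide algebra_simps)
    then have "S ^ n \<le> (real n * q ^ n + q ^ n) * S ^ n"
      using b[of n] by simp
    then show ?thesis using S0 by (simp add: mult_le_cancel_right1)
  qed
  ultimately have "1 \<le> (0::real)"
    by (intro LIMSEQ_le_const[where X = "\<lambda>n. real n * q ^ n + q ^ n"]) auto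
  then show False by simp
qed

lemma sem_le_coeffs: "s P \<le> (\<Sum>i\<le>degree P. v (coeff P i) * s [:0,1:] ^ i)"
proof -
  have "s P = s (\<Sum>i\<le>degree P. monom (coeff P i) i)"
    by (simp add: poly_as_sum_of_monoms)
  also have "\<dots> \<le> (\<Sum>i\<le>degree P. s (monom (coeff P i) i))"
    by (rule sem_sum_le)
  also have "\<dots> = (\<Sum>i\<le>degree P. v (coeff P i) * s [:0,1:] ^ i)"
    by (simp add: monom_altdef sem_smult sem_power)
  finally show ?thesis .
qed

end

lemma Some_in_berk_space [simp]: "Some s \<in> berk_space v \<longleftrightarrow> berk_seminorm v s"
  and None_in_berk_space [simp]: "None \<in> berk_space v"
  by (auto simp: berk_space_def berk_aff_def)

lemma berk_pt_in_space [simp]: "berk_pt v z \<in> berk_space v"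
  unfolding berk_pt_def Some_in_berk_space berk_seminorm_def
  by (auto simp: v_mult intro: order_trans[OF v_add_le])

lemma P1k_subset_space: "P1k v \<subseteq> berk_space v"
  by (auto simp: P1k_def)

text \<open>A point is regarded as a multiplicative seminorm on binary forms, normalised so that \<open>X\<close> and
  \<open>Y\<close> have maximum 1; a polynomial \<open>P\<close> with \<open>degree P \<le> n\<close> stands for its homogenization of
  degree \<open>n\<close>.  In these terms the point at infinity plays no special role.\<close>

definition hev :: "('a poly \<Rightarrow> real) option \<Rightarrow> nat \<Rightarrow> 'a poly \<Rightarrow> real" where
  "hev x n P = (case x of None \<Rightarrow> v (coeff P n) | Some s \<Rightarrow> s P / max 1 (s [:0,1:]) ^ n)"

lemma hev_None [simp]: "hev None n P = v (coeff P n)"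
  and hev_Some: "hev (Some s) n P = s P / max 1 (s [:0,1:]) ^ n"
  by (simp_all add: hev_def)

context
  fixes x assumes x: "x \<in> berk_space v"
begin

lemma hev_nonneg: "0 \<le> hev x n P"
  using x by (cases x) (auto simp: hev_Some sem_nonneg)

lemma hev_0 [simp]: "hev x n 0 = 0"
  using x by (cases x) (auto simp: hev_Some sem_0)

lemma hev_0_1 [simp]: "hev x 0 1 = 1"
  using x by (cases x) (auto simp: hev_Some sem_1)

lemma hev_smult: "hev x n (smult c P) = v c * hev x n P"
  using x by (cases x) (auto simp: hev_Some sem_smult v_mult)

lemma hev_minus: "hev x n (- P) = hev x n P"
  using hev_smult[of n "-1" P] by simp

lemma hev_add_le: "hev x n (P + Q) \<le> max (hev x n P) (hev x n Q)"
proof (cases x)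
  case None
  then show ?thesis by (simp add: v_add_le)
next
  case (Some s)
  then have s: "berk_seminorm v s" using x by simp
  have m: "0 < max 1 (s [:0,1:]) ^ n" by (simp add: zero_less_power less_max_iff_disj)
  show ?thesis
    using sem_ultra[OF s, of P Q] m unfolding Some hev_Some
    by (metis divide_right_mono le_max_iff_disj less_imp_le)
qed

lemma hev_diff_le: "hev x n (P - Q) \<le> max (hev x n P) (hev x n Q)"
  using hev_add_le[of n P "- Q"] by (simp add: hev_minus)

lemma hev_sum_le: "hev x n (sum f A) \<le> (\<Sum>i\<in>A. hev x n (f i))"
proof (induction A rule: infinite_finite_induct)
  case (insert i A)
  have "hev x n (sum f (insert i A)) \<le> max (hev x n (f i)) (hev x n (sum f A))"
    using insert by (simp add: hev_add_le)
  also have "\<dots> \<le> hev x n (f i) + (\<Sum>i\<in>A. hev x n (f i))"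
    using insert.IH hev_nonneg[of n "f i"] sum_nonneg[of A "\<lambda>i. hev x n (f i)"] hev_nonneg by fastforce
  finally show ?case using insert by simp
qed auto

lemma hev_abs_diff_le: "\<bar>hev x n P - hev x n Q\<bar> \<le> hev x n (P - Q)"
proof -
  have "hev x n P \<le> hev x n Q + hev x n (P - Q)"
    using hev_add_le[of n Q "P - Q"] hev_nonneg[of n Q] hev_nonneg[of n "P - Q"] by auto
  moreover have "hev x n Q \<le> hev x n P + hev x n (P - Q)"
    using hev_diff_le[of n P "P - Q"] hev_nonneg[of n P] hev_nonneg[of n "P - Q"] by auto
  ultimately show ?thesis by linarith
qed

lemma hev_mult:
  assumes "degree P \<le> n" "degree Q \<le> m"
  shows "hev x (n + m) (P * Q) = hev x n P * hev x m Q"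
  using x assms by (cases x) (auto simp: hev_Some sem_mult power_add coeff_mult_add v_mult)

lemma hev_mult_Suc:
  assumes "degree P \<le> n" "degree Q \<le> 1"
  shows "hev x (Suc n) (P * Q) = hev x n P * hev x 1 Q"
  using hev_mult[OF assms] by (simp only: Suc_eq_plus1)

lemma hev_power:
  assumes "degree P \<le> 1"
  shows "hev x n (P ^ n) = hev x 1 P ^ n"
proof (induction n)
  case (Suc n)
  have "degree (P ^ n) \<le> n"
    using order_trans[OF degree_power_le mult_le_mono1[OF assms]] by simp
  then show ?case
    using hev_mult_Suc[of "P ^ n" n P] assms Suc by (simp add: mult.commute)
qed simp

lemma hev_X_1: "max (hev x 1 [:0,1:]) (hev x 1 1) = 1"
proof (cases x)
  case (Some s)
  then have s: "berk_seminorm v s" using x by simp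
  show ?thesis unfolding Some hev_Some using sem_1[OF s] by (auto simp: max_def field_simps)
qed (simp add: One_nat_def)

lemma hev_X_le: "hev x 1 [:0,1:] \<le> 1" and hev_1_le: "hev x 1 1 \<le> 1"
  using hev_X_1 by auto

lemma hev_lin_le: "hev x 1 [:b, a:] \<le> max (v a) (v b)"
proof -
  have "[:b, a:] = smult a [:0,1:] + smult b 1" by (simp add: one_pCons)
  then have "hev x 1 [:b, a:] \<le> max (v a * hev x 1 [:0,1:]) (v b * hev x 1 1)"
    by (metis hev_add_le hev_smult)
  moreover have "v a * hev x 1 [:0,1:] \<le> v a * 1" "v b * hev x 1 1 \<le> v b * 1"
    by (intro mult_left_mono hev_X_le hev_1_le; simp)+
  ultimately show ?thesis by auto
qed

lemma hev_X_power_le: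
  assumes "i \<le> n"
  shows "hev x n ([:0,1:] ^ i) \<le> 1"
proof -
  have "hev x (i + (n - i)) ([:0,1:] ^ i * 1 ^ (n - i)) = hev x i ([:0,1:] ^ i) * hev x (n - i) (1 ^ (n - i))"
    by (rule hev_mult) (auto simp: degree_power_eq)
  also have "\<dots> = hev x 1 [:0,1:] ^ i * hev x 1 1 ^ (n - i)"
    by (simp only: hev_power degree_pCons_eq_if degree_1) (simp add: hev_power)
  also have "\<dots> \<le> 1 * 1"
    by (intro mult_mono power_le_one hev_nonneg hev_X_le hev_1_le zero_le_power) auto
  finally show ?thesis using assms by simp
qed

end

lemma hev_le_coeffs:
  assumes "x \<in> berk_space v" "degree P \<le> n"
  shows "hev x n P \<le> (\<Sum>i\<le>n. v (coeff P i))"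
proof -
  have "hev x n P \<le> (\<Sum>i\<le>n. hev x n (smult (coeff P i) ([:0,1:] ^ i)))"
    by (subst poly_eq_sum_powers[OF assms(2)]) (rule hev_sum_le[OF assms(1)])
  also have "\<dots> \<le> (\<Sum>i\<le>n. v (coeff P i))"
    using hev_X_power_le[OF assms(1)] by (intro sum_mono) (auto simp: hev_smult[OF assms(1)] mult_left_le)
  finally show ?thesis .
qed

text \<open>The form \<open>Y\<close>, which is the polynomial \<open>1\<close> in degree 1,
  vanishes only at infinity and has value \<open>1 / max 1 (s [:0,1:])\<close> elsewhere. It
  restores the normalising denominator, and with it \<open>s\<close>.\<close>

lemma berk_space_eqI:
  assumes x: "x \<in> berk_space v" and y: "y \<in> berk_space v"
    and eq: "\<And>n P. degree P \<le> n \<Longrightarrow> hev x n P = hev y n P"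
  shows "x = y"
proof -
  have 1: "hev x 1 1 = hev y 1 1" by (rule eq) simp
  have inf: "hev z 1 1 = 0 \<longleftrightarrow> z = None" if "z \<in> berk_space v" for z
    using that by (cases z) (auto simp: hev_Some sem_1)
  show ?thesis
  proof (cases "x = None")
    case True
    then show ?thesis using 1 inf[OF x] inf[OF y] by simp
  next
    case False
    then obtain s t where st: "x = Some s" "y = Some t"
      using 1 inf[OF x] inf[OF y] by (cases x; cases y) auto
    then have s: "berk_seminorm v s" and t: "berk_seminorm v t" using x y by auto
    have m: "max 1 (s [:0,1:]) = max 1 (t [:0,1:])"
      using 1 unfolding st hev_Some by (simp add: sem_1[OF s] sem_1[OF t])
    have "s P = t P" for P
      using eq[of P "degree P"] m unfolding st hev_Some by (auto simp: max_def split: if_splits)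
    then show ?thesis using st by auto
  qed
qed

text \<open>Modulo the form \<open>l = a X + b Y\<close> both coordinates are multiples of a single
  one, \<open>e\<close>, with coefficients of absolute value at most 1, so \<open>P\<close> becomes
  \<open>c e^n\<close>. Where \<open>l\<close> has value below 1, \<open>e\<close> has value 1,
  hence both values of \<open>P\<close> are near \<open>v c\<close>. The constant depends only on
  \<open>P\<close> and \<open>n\<close>, so the form may vary with the points.\<close>

lemma hev_close:
  assumes deg: "degree P \<le> n"
  shows "\<exists>B>0. \<forall>a b. max (v a) (v b) = 1 \<longrightarrow> (\<forall>x\<in>berk_space v. \<forall>y\<in>berk_space v.
       \<bar>hev x n P - hev y n P\<bar> \<le> B * max (hev x 1 [:b,a:]) (hev y 1 [:b,a:]))"
proof -
  define B0 where "B0 = (\<Sum>i\<le>n. v (coeff P i))"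
  have B0: "0 \<le> B0" by (simp add: B0_def sum_nonneg)
  have main: "\<bar>hev x n P - hev y n P\<bar> \<le> (2 * B0 + 1) * max (hev x 1 [:b,a:]) (hev y 1 [:b,a:])"
    if ab: "max (v a) (v b) = 1" and xy: "x \<in> berk_space v" "y \<in> berk_space v" for a b x y
  proof -
    \<comment> \<open>If \<open>v a = 1\<close>, the form is solved for \<open>X\<close> and
      \<open>e\<close> is \<open>Y\<close>; otherwise \<open>v b = 1\<close>, it is solved for
      \<open>Y\<close> and \<open>e\<close> is \<open>X\<close>.\<close>
    have "\<exists>e cX cY. degree e \<le> 1 \<and> (\<forall>z\<in>berk_space v. hev z 1 e \<le> 1) \<and> v cX \<le> 1 \<and> v cY \<le> 1 \<and>
        (\<forall>z\<in>berk_space v. hev z 1 ([:0,1:] - smult cX e) \<le> hev z 1 [:b,a:] \<and>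
                          hev z 1 (1 - smult cY e) \<le> hev z 1 [:b,a:])"
    proof (cases "v a = 1")
      case True
      then have a0: "a \<noteq> 0" by force
      have eq: "[:0,1:] - smult (- b / a) 1 = smult (1/a) [:b,a:]"
        using a0 by (simp add: one_pCons)
      show ?thesis
        by (rule exI[of _ 1], rule exI[of _ "- b / a"], rule exI[of _ 1])
           (use True ab in \<open>unfold eq, auto simp: hev_smult v_divide hev_1_le hev_nonneg simp del: smult_pCons simp flip: one_pCons\<close>)
    next
      case False
      then have b: "v b = 1" using ab by (auto simp: max_def split: if_splits)
      then have b0: "b \<noteq> 0" by force
      have eq: "1 - smult (- a / b) [:0,1:] = smult (1/b) [:b,a:]"
        using b0 by (simp add: one_pCons)
      show ?thesis
        by (rule exI[of _ "[:0,1:]"], rule exI[of _ 1], rule exI[of _ "- a / b"])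
           (use b ab in \<open>unfold eq, auto simp: hev_smult v_divide hev_X_le hev_nonneg simp del: smult_pCons\<close>)
    qed
    then obtain e cX cY where dege: "degree e \<le> 1" and e1: "\<And>z. z \<in> berk_space v \<Longrightarrow> hev z 1 e \<le> 1"
      and c1: "v cX \<le> 1" "v cY \<le> 1"
      and eX: "\<And>z. z \<in> berk_space v \<Longrightarrow> hev z 1 ([:0,1:] - smult cX e) \<le> hev z 1 [:b,a:]"
      and eY: "\<And>z. z \<in> berk_space v \<Longrightarrow> hev z 1 (1 - smult cY e) \<le> hev z 1 [:b,a:]"
      by blast
    have degen: "degree (e ^ m) \<le> m" for m
      using order_trans[OF degree_power_le mult_le_mono1[OF dege]] by simp
    \<comment> \<open>One more coordinate \<open>L\<close> is exchanged for its multiple of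
      \<open>e\<close>. The error does not accumulate, since the inequality is ultrametric and the
      remaining factors have value at most 1.\<close>
    have step: "hev z (Suc m) (A * L - smult (c * c') (e ^ Suc m)) \<le> hev z 1 [:b,a:]"
      if z: "z \<in> berk_space v" and A: "degree A \<le> m" "hev z m A \<le> 1"
        and L: "degree L \<le> 1" "hev z 1 (L - smult c' e) \<le> hev z 1 [:b,a:]" and c': "v c' \<le> 1"
        and IH: "hev z m (A - smult c (e ^ m)) \<le> hev z 1 [:b,a:]" for z m A L c c'
    proof -
      have eq: "A * L - smult (c * c') (e ^ Suc m) = A * (L - smult c' e) + (A - smult c (e ^ m)) * smult c' e"
        by (simp add: algebra_simps)
      have d: "degree (L - smult c' e) \<le> 1" "degree (smult c' e) \<le> 1"
        using L dege degree_diff_le degree_smult_le le_trans by blast+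
      have d2: "degree (A - smult c (e ^ m)) \<le> m"
        using A degen degree_diff_le degree_smult_le le_trans by blast
      have "hev z (Suc m) (A * (L - smult c' e)) \<le> 1 * hev z 1 [:b,a:]"
        unfolding hev_mult_Suc[OF z A(1) d(1)]
        by (intro mult_mono A L hev_nonneg z) auto
      moreover have "hev z (Suc m) ((A - smult c (e ^ m)) * smult c' e) \<le> hev z 1 [:b,a:] * (1 * 1)"
        unfolding hev_mult_Suc[OF z d2 d(2)] hev_smult[OF z]
        by (intro mult_mono IH c' e1 z hev_nonneg mult_nonneg_nonneg) auto
      ultimately show ?thesis
        unfolding eq using hev_add_le[OF z, of "Suc m" "A * (L - smult c' e)" "(A - smult c (e ^ m)) * smult c' e"] by simp
    qed
    have mono: "hev z m ([:0,1:] ^ i - smult (cX ^ i * cY ^ (m - i)) (e ^ m)) \<le> hev z 1 [:b,a:]"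
      if z: "z \<in> berk_space v" and "i \<le> m" for z m i
      using \<open>i \<le> m\<close>
    proof (induction m arbitrary: i)
      case 0
      then show ?case using z hev_nonneg[OF z] by (simp flip: one_pCons)
    next
      case (Suc m)
      have dX: "degree ([:0,1:] ^ j :: 'a poly) \<le> m" if "j \<le> m" for j
        using that by (simp add: degree_power_eq)
      show ?case
      proof (cases "i \<le> m")
        case True
        have "hev z (Suc m) ([:0,1:] ^ i * 1 - smult ((cX ^ i * cY ^ (m - i)) * cY) (e ^ Suc m)) \<le> hev z 1 [:b,a:]"
          by (rule step[OF z dX[OF True] hev_X_power_le[OF z True] _ eY[OF z] c1(2) Suc.IH[OF True]]) simp
        then show ?thesis using True by (simp add: Suc_diff_le mult_ac)
      next
        case False
        then have i: "i = Suc m" using Suc.prems by simp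
        have "hev z (Suc m) ([:0,1:] ^ m * [:0,1:] - smult ((cX ^ m * cY ^ (m - m)) * cX) (e ^ Suc m)) \<le> hev z 1 [:b,a:]"
          by (rule step[OF z dX hev_X_power_le[OF z] _ eX[OF z] c1(1) Suc.IH]) simp_all
        then show ?thesis using i by (simp add: mult_ac)
      qed
    qed
    define c where "c = (\<Sum>i\<le>n. coeff P i * (cX ^ i * cY ^ (n - i)))"
    have approx: "\<bar>hev z n P - v c * hev z 1 e ^ n\<bar> \<le> B0 * hev z 1 [:b,a:]" if z: "z \<in> berk_space v" for z
    proof -
      have "P - smult c (e ^ n)
        = (\<Sum>i\<le>n. smult (coeff P i) ([:0,1:] ^ i - smult (cX ^ i * cY ^ (n - i)) (e ^ n)))"
        by (subst poly_eq_sum_powers[OF deg])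
           (simp add: c_def smult_diff_right sum_subtractf smult_sum)
      then have "hev z n (P - smult c (e ^ n))
        \<le> (\<Sum>i\<le>n. hev z n (smult (coeff P i) ([:0,1:] ^ i - smult (cX ^ i * cY ^ (n - i)) (e ^ n))))"
        using hev_sum_le[OF z] by simp
      also have "\<dots> \<le> (\<Sum>i\<le>n. v (coeff P i) * hev z 1 [:b,a:])"
        unfolding hev_smult[OF z] by (intro sum_mono mult_left_mono mono z) auto
      finally have "hev z n (P - smult c (e ^ n)) \<le> B0 * hev z 1 [:b,a:]"
        by (simp add: B0_def sum_distrib_right)
      then show ?thesis
        using hev_abs_diff_le[OF z, of n P "smult c (e ^ n)"]
        by (simp add: hev_smult[OF z] hev_power[OF z dege])
    qed
    define M where "M = max (hev x 1 [:b,a:]) (hev y 1 [:b,a:])"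
    have M0: "0 \<le> M" using hev_nonneg xy by (simp add: M_def max_def)
    \<comment> \<open>For \<open>M \<ge> 1\<close> the bound by the coefficients is enough. The
      summand 1 in the final constant keeps it positive when \<open>P = 0\<close>.\<close>
    have "\<bar>hev x n P - hev y n P\<bar> \<le> 2 * B0 * M"
    proof (cases "M < 1")
      case True
      have "hev z 1 e = 1" if z: "z \<in> berk_space v" and "hev z 1 [:b,a:] < 1" for z
      proof -
        have "hev z 1 [:0,1:] \<le> max (hev z 1 ([:0,1:] - smult cX e)) (v cX * hev z 1 e)"
          using hev_add_le[OF z, of 1 "[:0,1:] - smult cX e" "smult cX e"] by (simp add: hev_smult[OF z])
        moreover have "hev z 1 1 \<le> max (hev z 1 (1 - smult cY e)) (v cY * hev z 1 e)"
          using hev_add_le[OF z, of 1 "1 - smult cY e" "smult cY e"] by (simp add: hev_smult[OF z])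
        moreover have "v cX * hev z 1 e \<le> hev z 1 e" "v cY * hev z 1 e \<le> hev z 1 e"
          using c1 hev_nonneg[OF z] by (simp_all add: mult_left_le_one_le)
        ultimately show ?thesis
          using hev_X_1[OF z] eX[OF z] eY[OF z] that(2) e1[OF z] by (auto simp: max_def split: if_splits)
      qed
      then have "hev x 1 e = 1" "hev y 1 e = 1" using True xy by (auto simp: M_def)
      then have "\<bar>hev x n P - v c\<bar> \<le> B0 * hev x 1 [:b,a:]" "\<bar>hev y n P - v c\<bar> \<le> B0 * hev y 1 [:b,a:]"
        using approx[OF xy(1)] approx[OF xy(2)] by auto
      moreover have "B0 * hev x 1 [:b,a:] \<le> B0 * M" "B0 * hev y 1 [:b,a:] \<le> B0 * M"
        using B0 by (auto simp: M_def intro!: mult_left_mono)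
      ultimately show ?thesis by linarith
    next
      case False
      have "hev x n P \<le> B0" "hev y n P \<le> B0"
        unfolding B0_def using hev_le_coeffs deg xy by auto
      moreover have "B0 * 1 \<le> B0 * M" using False B0 by (intro mult_left_mono) auto
      ultimately show ?thesis
        using hev_nonneg[OF xy(1), of n P] hev_nonneg[OF xy(2), of n P] by linarith
    qed
    also have "\<dots> \<le> (2 * B0 + 1) * M" using M0 by (simp add: algebra_simps)
    finally show ?thesis unfolding M_def .
  qed
  show ?thesis
    by (rule exI[of _ "2 * B0 + 1"]) (use B0 main in auto)
qed

section \<open>The Berkovich topology\<close>

lemma berk_aff_top_eq: "berk_aff_top v = top_of_set (berk_aff v)"
  by (simp add: berk_aff_top_def euclidean_product_topology)

lemma openin_berk_top:
  "openin (berk_top v) U \<longleftrightarrow> openin (top_of_set (berk_aff v)) (Some -` U) \<and>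
     (None \<in> U \<longrightarrow> compact (berk_aff v - Some -` U))"
proof -
  have "openin (berk_top v) U \<longleftrightarrow> onept_open (top_of_set (berk_aff v)) U"
    unfolding berk_top_def onept_compactification_def berk_aff_top_eq
    by (simp add: topology_inverse'[OF istopology_onept_open])
  then show ?thesis
    by (auto simp: onept_open_def compactin_subtopology)
qed

lemma closed_berk_aff: "closed (berk_aff v)"
proof -
  have c: "continuous_on UNIV (\<lambda>s :: 'a poly \<Rightarrow> real. s P)" for P
    by (rule continuous_on_product_coordinates)
  show ?thesis
    unfolding berk_aff_def berk_seminorm_def
    by (intro closed_Collect_conj closed_Collect_all closed_Collect_le closed_Collect_eq
        continuous_on_mult continuous_on_add continuous_on_const c)
qed

text \<open>A bound on the value of \<open>X\<close> bounds all values through the coefficients, so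
  the disc is a closed subset of a product of compact intervals.\<close>

lemma compact_berk_disc: "compact {s \<in> berk_aff v. s [:0,1:] \<le> R}"
proof -
  define B where "B P = (\<Sum>i\<le>degree P. v (coeff P i) * max 0 R ^ i)" for P
  have "compactin (product_topology (\<lambda>_. euclideanreal) UNIV) (PiE UNIV (\<lambda>P::'a poly. {0..B P}))"
    by (simp add: compactin_PiE)
  then have "compact (PiE UNIV (\<lambda>P::'a poly. {0..B P}))"
    by (simp add: euclidean_product_topology)
  moreover have "closed (berk_aff v \<inter> {s. s [:0,1:] \<le> R})"
    by (intro closed_Int closed_berk_aff closed_Collect_le continuous_on_const continuous_on_product_coordinates)
  moreover have "s \<in> PiE UNIV (\<lambda>P. {0..B P})" if "s \<in> berk_aff v" "s [:0,1:] \<le> R" for s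
  proof -
    have s: "berk_seminorm v s" using that by (simp add: berk_aff_def)
    have "s P \<le> B P" for P
      unfolding B_def using that sem_nonneg[OF s]
      by (intro order_trans[OF sem_le_coeffs[OF s]] sum_mono mult_left_mono power_mono) auto
    then show ?thesis using sem_nonneg[OF s] by auto
  qed
  moreover have "{s \<in> berk_aff v. s [:0,1:] \<le> R}
      = (berk_aff v \<inter> {s. s [:0,1:] \<le> R}) \<inter> PiE UNIV (\<lambda>P. {0..B P})"
    using calculation(3) by blast
  ultimately show ?thesis
    by (simp only: closed_Int_compact)
qed

lemma topspace_berk_top [simp]: "topspace (berk_top v) = berk_space v"
proof
  show "topspace (berk_top v) \<subseteq> berk_space v"
  proof
    fix x assume "x \<in> topspace (berk_top v)"
    then obtain U where "openin (berk_top v) U" "x \<in> U"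
      using openin_topspace by blast
    moreover have "Some -` U \<subseteq> berk_aff v"
      using \<open>openin (berk_top v) U\<close> openin_imp_subset[of euclidean "berk_aff v" "Some -` U"]
      by (simp add: openin_berk_top)
    ultimately show "x \<in> berk_space v"
      by (cases x) (auto simp: berk_aff_def)
  qed
  have "Some -` berk_space v = berk_aff v"
    by (auto simp: berk_space_def)
  then have "openin (berk_top v) (berk_space v)"
    by (simp add: openin_berk_top)
  then show "berk_space v \<subseteq> topspace (berk_top v)"
    by (rule openin_subset)
qed

lemma compact_space_berk_top: "compact_space (berk_top v)"
  unfolding compact_space_def compactin_def
proof (intro conjI allI impI)
  fix \<U> assume U: "Ball \<U> (openin (berk_top v)) \<and> topspace (berk_top v) \<subseteq> \<Union>\<U>"
  then obtain U where U0: "U \<in> \<U>" "None \<in> U"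
    by (metis None_in_berk_space UnionE subsetD topspace_berk_top)
  define K where "K = berk_aff v - Some -` U"
  have "compactin (top_of_set (berk_aff v)) K"
    using U U0 by (auto simp: K_def openin_berk_top compactin_subtopology)
  moreover have "Ball ((\<lambda>U. Some -` U) ` \<U>) (openin (top_of_set (berk_aff v)))"
    using U by (auto simp: openin_berk_top)
  moreover have "K \<subseteq> \<Union>((\<lambda>U. Some -` U) ` \<U>)"
  proof
    fix s assume "s \<in> K"
    then have "Some s \<in> \<Union>\<U>" using U by (auto simp: K_def berk_space_def)
    then show "s \<in> \<Union>((\<lambda>U. Some -` U) ` \<U>)" by blast
  qed
  ultimately obtain F where F: "finite F" "F \<subseteq> (\<lambda>U. Some -` U) ` \<U>" "K \<subseteq> \<Union>F"
    using compactinD[of _ K "(\<lambda>U. Some -` U) ` \<U>"] by (metis (no_types, lifting))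
  then obtain \<F> where \<F>: "finite \<F>" "\<F> \<subseteq> \<U>" "F = (\<lambda>U. Some -` U) ` \<F>"
    by (meson finite_subset_image)
  have "topspace (berk_top v) \<subseteq> \<Union>(insert U \<F>)"
    using F(3) \<F>(3) U0 by (auto simp: K_def berk_space_def)
  then show "\<exists>\<F>. finite \<F> \<and> \<F> \<subseteq> \<U> \<and> topspace (berk_top v) \<subseteq> \<Union>\<F>"
    using \<F> U0 by (meson finite_insert insert_subset)
qed simp

lemma hev_1_1_Some:
  assumes "berk_seminorm v s"
  shows "hev (Some s) 1 1 = 1 / max 1 (s [:0,1:])"
  by (simp add: hev_Some sem_1[OF assms])

lemma sem_eq_hev:
  assumes "berk_seminorm v s"
  shows "s P = hev (Some s) n P / hev (Some s) 1 1 ^ n"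
proof -
  have "0 < max 1 (s [:0,1:]) ^ n" by (simp add: zero_less_power less_max_iff_disj)
  then show ?thesis
    unfolding hev_1_1_Some[OF assms] by (simp add: hev_Some power_divide)
qed

text \<open>Stated for all filters, since sequences need not describe this topology. At infinity it
  is \<open>hev_close\<close> for the form \<open>Y\<close>, which vanishes there.\<close>

lemma limitin_berk_top_imp:
  assumes lim: "limitin (berk_top v) f y F" and deg: "degree P \<le> n"
  shows "((\<lambda>i. hev (f i) n P) \<longlongrightarrow> hev y n P) F"
proof -
  have y: "y \<in> berk_space v" using limitin_topspace[OF lim] by simp
  have ev: "eventually (\<lambda>i. f i \<in> U) F" if "openin (berk_top v) U" "y \<in> U" for U
    using lim that by (simp add: limitin_def)
  have evs: "eventually (\<lambda>i. f i \<in> berk_space v) F"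
    by (rule ev) (use y in \<open>auto simp flip: topspace_berk_top\<close>)
  show ?thesis
  proof (cases y)
    case None
    obtain B where B: "0 < B" "\<And>x. x \<in> berk_space v \<Longrightarrow>
        \<bar>hev x n P - hev None n P\<bar> \<le> B * max (hev x 1 [:1,0:]) (hev None 1 [:1,0:])"
    proof -
      have "max (v 0) (v 1) = 1" by simp
      then show ?thesis using hev_close[OF deg] that None_in_berk_space by meson
    qed
    have B': "\<bar>hev x n P - hev None n P\<bar> \<le> B * hev x 1 1" if x: "x \<in> berk_space v" for x
      using B(2)[OF x] hev_nonneg[OF x, of 1 1] by (simp add: one_pCons[symmetric])
    show ?thesis
    proof (rule tendstoI)
      fix e :: real assume e: "0 < e"
      \<comment> \<open>Outside the disc of radius \<open>R\<close> the form \<open>Y\<close> has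
        value below \<open>e / B\<close>.\<close>
      define R where "R = B / e"
      define U where "U = insert None (Some ` {s \<in> berk_aff v. R < s [:0,1:]})"
      have "Some -` U = {s \<in> berk_aff v. R < s [:0,1:]}" by (auto simp: U_def)
      moreover have "berk_aff v - {s \<in> berk_aff v. R < s [:0,1:]} = {s \<in> berk_aff v. s [:0,1:] \<le> R}" by auto
      moreover have "openin (top_of_set (berk_aff v)) {s \<in> berk_aff v. R < s [:0,1:]}"
      proof -
        have "open {s :: 'a poly \<Rightarrow> real. R < s [:0,1:]}"
          by (intro open_Collect_less continuous_on_const continuous_on_product_coordinates)
        then show ?thesis by (auto simp: openin_open)
      qed
      ultimately have "openin (berk_top v) U"
        by (simp add: openin_berk_top compact_berk_disc)
      then have "eventually (\<lambda>i. f i \<in> U) F" by (rule ev) (simp add: U_def None)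
      then show "eventually (\<lambda>i. dist (hev (f i) n P) (hev y n P) < e) F"
      proof (rule eventually_mono)
        fix i assume i: "f i \<in> U"
        have "B * hev (f i) 1 1 < e"
        proof (cases "f i")
          case None
          then show ?thesis using e by (simp add: One_nat_def)
        next
          case (Some s)
          with i have s: "berk_seminorm v s" "R < s [:0,1:]" by (auto simp: U_def berk_aff_def)
          have "B / e < max 1 (s [:0,1:])" using s(2) by (auto simp: R_def)
          then show ?thesis
            unfolding Some hev_1_1_Some[OF s(1)] using e by (simp add: field_simps)
        qed
        moreover have "f i \<in> berk_space v" using i by (auto simp: U_def berk_space_def)
        ultimately show "dist (hev (f i) n P) (hev y n P) < e"
          using B'[of "f i"] None by (simp add: dist_real_def)
      qed
    qed
  next
    case (Some s)
    have s: "berk_seminorm v s" using y Some by simp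
    have tends: "((\<lambda>i. the (f i) Q) \<longlongrightarrow> s Q) F" and "eventually (\<lambda>i. f i \<noteq> None) F" for Q
    proof -
      have op: "openin (berk_top v) (Some ` {t \<in> berk_aff v. \<bar>t Q - s Q\<bar> < e})" for e
      proof -
        have "open {t :: 'a poly \<Rightarrow> real. \<bar>t Q - s Q\<bar> < e}"
          by (intro open_Collect_less continuous_intros continuous_on_product_coordinates)
        then have "openin (top_of_set (berk_aff v)) {t \<in> berk_aff v. \<bar>t Q - s Q\<bar> < e}"
          by (auto simp: openin_open)
        then show ?thesis by (simp add: openin_berk_top inj_vimage_image_eq image_iff)
      qed
      have evQ: "eventually (\<lambda>i. f i \<in> Some ` {t \<in> berk_aff v. \<bar>t Q - s Q\<bar> < e}) F" if "0 < e" for e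
        by (rule ev[OF op]) (use that Some s in \<open>auto simp: berk_aff_def\<close>)
      show "((\<lambda>i. the (f i) Q) \<longlongrightarrow> s Q) F"
        by (rule tendstoI, rule eventually_mono[OF evQ]) (auto simp: dist_real_def)
      show "eventually (\<lambda>i. f i \<noteq> None) F"
        using evQ[of 1] by (auto elim!: eventually_mono)
    qed
    have "((\<lambda>i. the (f i) P / max 1 (the (f i) [:0,1:]) ^ n) \<longlongrightarrow> s P / max 1 (s [:0,1:]) ^ n) F"
      by (intro tendsto_intros tends) (auto simp: max_def)
    moreover have "eventually (\<lambda>i. the (f i) P / max 1 (the (f i) [:0,1:]) ^ n = hev (f i) n P) F"
      using \<open>eventually (\<lambda>i. f i \<noteq> None) F\<close> by eventually_elim (auto simp: hev_Some)
    ultimately show ?thesis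
      unfolding Some hev_Some by (rule Lim_transform_eventually)
  qed
qed

text \<open>Converse of \<open>limitin_berk_top_imp\<close>. A neighbourhood of infinity omits a
  compact set, on which \<open>X\<close> is bounded, so a small value of \<open>Y\<close> forces a
  point into the neighbourhood. At a finite point \<open>Y\<close> is nonzero, and division by its
  powers returns the seminorm.\<close>

lemma limitin_berk_topI:
  assumes y: "y \<in> berk_space v" and evs: "eventually (\<lambda>i. f i \<in> berk_space v) F"
    and tends: "\<And>n P. degree P \<le> n \<Longrightarrow> ((\<lambda>i. hev (f i) n P) \<longlongrightarrow> hev y n P) F"
  shows "limitin (berk_top v) f y F"
  unfolding limitin_def
proof (intro conjI allI impI)
  fix U assume U: "openin (berk_top v) U \<and> y \<in> U"
  have t1: "((\<lambda>i. hev (f i) 1 1) \<longlongrightarrow> hev y 1 1) F" by (rule tends) simp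
  show "eventually (\<lambda>i. f i \<in> U) F"
  proof (cases y)
    case None
    define K where "K = berk_aff v - Some -` U"
    have "compact K" using U None by (auto simp: K_def openin_berk_top)
    then have "compact ((\<lambda>s. s [:0,1:]) ` K)"
      by (intro compact_continuous_image continuous_on_subset[OF continuous_on_product_coordinates]) auto
    then obtain R where R: "\<And>s. s \<in> K \<Longrightarrow> \<bar>s [:0,1:]\<bar> \<le> R"
      by (metis (no_types, lifting) bounded_iff compact_imp_bounded imageI real_norm_def)
    have "eventually (\<lambda>i. hev (f i) 1 1 < 1 / max 1 R) F"
      by (rule order_tendstoD(2)[OF t1]) (simp add: None One_nat_def less_max_iff_disj)
    with evs show ?thesis
    proof eventually_elim
      case (elim i)
      show ?case
      proof (cases "f i")
        case None
        then show ?thesis using U \<open>y = None\<close> by simp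
      next
        case (Some s)
        then have s: "berk_seminorm v s" using elim by simp
        have "max 1 R < max 1 (s [:0,1:])"
          using elim(2) unfolding Some hev_1_1_Some[OF s]
          by (auto simp: field_simps max_def split: if_splits)
        then have "s \<notin> K" using R[of s] by (auto simp: max_def split: if_splits)
        then show ?thesis using s Some by (auto simp: K_def berk_aff_def)
      qed
    qed
  next
    case (Some s)
    then have s: "berk_seminorm v s" using y by simp
    have pos: "0 < hev y 1 1" unfolding Some hev_1_1_Some[OF s] by (simp add: less_max_iff_disj)
    have "hev None 1 1 = 0" by (simp add: One_nat_def)
    then have ne: "eventually (\<lambda>i. f i \<noteq> None) F"
      by (intro eventually_mono[OF order_tendstoD(1)[OF t1 pos]]) (metis less_irrefl)
    have tQ: "((\<lambda>i. the (f i) Q) \<longlongrightarrow> s Q) F" for Q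
    proof -
      have "((\<lambda>i. hev (f i) (degree Q) Q / hev (f i) 1 1 ^ degree Q) \<longlongrightarrow> hev y (degree Q) Q / hev y 1 1 ^ degree Q) F"
        by (intro tendsto_intros tends t1) (use pos in auto)
      moreover have "eventually (\<lambda>i. hev (f i) (degree Q) Q / hev (f i) 1 1 ^ degree Q = the (f i) Q) F"
        using ne evs
      proof eventually_elim
        case (elim i)
        then obtain t where "f i = Some t" "berk_seminorm v t" by auto
        then show ?case using sem_eq_hev[of t Q "degree Q"] by simp
      qed
      ultimately have "((\<lambda>i. the (f i) Q) \<longlongrightarrow> hev y (degree Q) Q / hev y 1 1 ^ degree Q) F"
        by (rule Lim_transform_eventually)
      then show ?thesis
        using sem_eq_hev[OF s, of Q "degree Q"] Some by simp
    qed
    have "limitin (product_topology (\<lambda>_. euclidean) UNIV) (\<lambda>i. the (f i)) s F"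
      using tQ by (simp add: limitin_componentwise)
    then have lim: "((\<lambda>i. the (f i)) \<longlongrightarrow> s) F"
      by (simp add: euclidean_product_topology)
    obtain W where W: "open W" "Some -` U = berk_aff v \<inter> W"
      using U by (auto simp: openin_berk_top openin_open)
    have "eventually (\<lambda>i. the (f i) \<in> W) F"
      by (rule topological_tendstoD[OF lim W(1)]) (use W(2) U Some in blast)
    with ne evs show ?thesis
    proof eventually_elim
      case (elim i)
      then obtain t where t: "f i = Some t" "berk_seminorm v t" by auto
      then have "t \<in> berk_aff v \<inter> W" using elim by (auto simp: berk_aff_def)
      then show ?case using W(2) t by auto
    qed
  qed
qed (use y in simp)

lemma continuous_map_hev:
  assumes "degree P \<le> n"
  shows "continuous_map (berk_top v) euclideanreal (\<lambda>x. hev x n P)"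
  unfolding continuous_map_atin
proof
  fix x assume "x \<in> topspace (berk_top v)"
  then have "limitin (berk_top v) (\<lambda>y. y) x (atin (berk_top v) x)"
    using limitin_continuous_map[OF continuous_map_id, of x "berk_top v" x] by (simp add: id_def)
  then show "limitin euclideanreal (\<lambda>x. hev x n P) (hev x n P) (atin (berk_top v) x)"
    using limitin_berk_top_imp[OF _ assms] by simp
qed

text \<open>The device by which orbits are compared. The forms may change with the index because the
  constant of \<open>hev_close\<close> does not depend on them.\<close>

lemma limitin_berk_top_close:
  assumes ab: "\<And>i. max (v (a i)) (v (b i)) = 1"
    and f: "\<And>i. f i \<in> berk_space v" and g: "\<And>i. g i \<in> berk_space v"
    and f0: "((\<lambda>i. hev (f i) 1 [:b i, a i:]) \<longlongrightarrow> 0) F"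
    and g0: "((\<lambda>i. hev (g i) 1 [:b i, a i:]) \<longlongrightarrow> 0) F"
    and lim: "limitin (berk_top v) f y F"
  shows "limitin (berk_top v) g y F"
proof (rule limitin_berk_topI)
  show "y \<in> berk_space v" using limitin_topspace[OF lim] by simp
  show "eventually (\<lambda>i. g i \<in> berk_space v) F" using g by simp
  fix n and P :: "'a poly" assume deg: "degree P \<le> n"
  obtain B where B: "0 < B" "\<And>a b x y. \<lbrakk>max (v a) (v b) = 1; x \<in> berk_space v; y \<in> berk_space v\<rbrakk>
       \<Longrightarrow> \<bar>hev x n P - hev y n P\<bar> \<le> B * max (hev x 1 [:b,a:]) (hev y 1 [:b,a:])"
    using hev_close[OF deg] by meson
  have "((\<lambda>i. B * max (hev (g i) 1 [:b i, a i:]) (hev (f i) 1 [:b i, a i:])) \<longlongrightarrow> B * max 0 0) F"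
    by (intro tendsto_intros f0 g0)
  then have *: "((\<lambda>i. B * max (hev (g i) 1 [:b i, a i:]) (hev (f i) 1 [:b i, a i:])) \<longlongrightarrow> 0) F"
    by simp
  have "((\<lambda>i. hev (g i) n P - hev (f i) n P) \<longlongrightarrow> 0) F"
    by (rule Lim_null_comparison[OF always_eventually *]) (simp only: real_norm_def B(2)[OF ab g f] simp_thms)
  then have "((\<lambda>i. (hev (g i) n P - hev (f i) n P) + hev (f i) n P) \<longlongrightarrow> 0 + hev y n P) F"
    by (intro tendsto_add limitin_berk_top_imp[OF lim deg])
  then show "((\<lambda>i. hev (g i) n P) \<longlongrightarrow> hev y n P) F" by simp
qed

section \<open>Zeros of linear forms\<close>

lemma normalise_linear_form:
  assumes "a \<noteq> 0 \<or> b \<noteq> 0"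
  obtains t where "t \<noteq> 0" "v t = max (v a) (v b)" "max (v (a / t)) (v (b / t)) = 1"
proof (cases "v b \<le> v a")
  case True
  then have "a \<noteq> 0" using assms by (metis v_0 v_pos_iff not_le)
  then show thesis using True that[of a] by (simp add: v_divide max_def)
next
  case False
  then have "b \<noteq> 0" by (metis v_0 v_nonneg)
  then show thesis using False that[of b] by (simp add: v_divide max_def)
qed

lemma hev_lin_divide:
  assumes "x \<in> berk_space v"
  shows "hev x 1 [:b / t, a / t:] = hev x 1 [:b, a:] / v t"
  using hev_smult[OF assms, of 1 "1/t" "[:b, a:]"] by (simp add: v_divide)

text \<open>After normalisation the bound of \<open>hev_close\<close> is 0 for every
  \<open>P\<close>.\<close>

lemma linear_form_zero_unique:
  assumes ab: "a \<noteq> 0 \<or> b \<noteq> 0" and x: "x \<in> berk_space v" and y: "y \<in> berk_space v"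
    and 0: "hev x 1 [:b, a:] = 0" "hev y 1 [:b, a:] = 0"
  shows "x = y"
proof (rule berk_space_eqI[OF x y])
  obtain t where t: "max (v (a / t)) (v (b / t)) = 1"
    using normalise_linear_form[OF ab] by metis
  fix n and P :: "'a poly" assume deg: "degree P \<le> n"
  obtain B where "0 < B" "\<And>a b x y. \<lbrakk>max (v a) (v b) = 1; x \<in> berk_space v; y \<in> berk_space v\<rbrakk>
       \<Longrightarrow> \<bar>hev x n P - hev y n P\<bar> \<le> B * max (hev x 1 [:b,a:]) (hev y 1 [:b,a:])"
    using hev_close[OF deg] by meson
  from this(2)[OF t x y] 0 show "hev x n P = hev y n P"
    by (simp add: hev_lin_divide x y)
qed

lemma linear_form_zero_exists:
  assumes "a \<noteq> 0 \<or> b \<noteq> 0"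
  obtains x where "x \<in> P1k v" "hev x 1 [:b, a:] = 0"
proof (cases "a = 0")
  case True
  then show thesis using that[of None] by (simp add: P1k_def One_nat_def)
next
  case False
  then show thesis using that[of "berk_pt v (- b / a)"] by (simp add: P1k_def berk_pt_def hev_Some)
qed

text \<open>Contrapositive of \<open>hev_close\<close>, applied to one polynomial that tells the
  points apart; \<open>\<eta>\<close> is thereby uniform in the linear form.\<close>

lemma linear_form_separation:
  assumes x: "x \<in> berk_space v" and y: "y \<in> berk_space v" and "x \<noteq> y"
  obtains \<eta> where "0 < \<eta>" "\<And>a b. max (v a) (v b) = 1 \<Longrightarrow> \<eta> \<le> hev x 1 [:b,a:] \<or> \<eta> \<le> hev y 1 [:b,a:]"
proof -
  obtain n P where deg: "degree P \<le> n" and ne: "hev x n P \<noteq> hev y n P"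
    using berk_space_eqI[OF x y] assms by blast
  obtain B where B: "0 < B" "\<And>a b x y. \<lbrakk>max (v a) (v b) = 1; x \<in> berk_space v; y \<in> berk_space v\<rbrakk>
       \<Longrightarrow> \<bar>hev x n P - hev y n P\<bar> \<le> B * max (hev x 1 [:b,a:]) (hev y 1 [:b,a:])"
    using hev_close[OF deg] by meson
  define \<eta> where "\<eta> = \<bar>hev x n P - hev y n P\<bar> / B"
  have "\<eta> \<le> max (hev x 1 [:b,a:]) (hev y 1 [:b,a:])" if "max (v a) (v b) = 1" for a b
    using B(2)[OF that x y] B(1) by (simp add: \<eta>_def field_simps)
  moreover have "0 < \<eta>" using ne B(1) by (simp add: \<eta>_def)
  ultimately show thesis by (intro that[of \<eta>]) (auto simp: le_max_iff_disj)
qed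

end

section \<open>The action of invertible matrices\<close>

text \<open>Substitution of the forms \<open>A\<close>, \<open>B\<close> for \<open>X\<close>, \<open>Y\<close> in the homogenization of degree \<open>n\<close> of \<open>P\<close>.\<close>

definition hsubst :: "'a::comm_ring_1 poly \<Rightarrow> 'a poly \<Rightarrow> nat \<Rightarrow> 'a poly \<Rightarrow> 'a poly" where
  "hsubst A B n P = (\<Sum>i\<le>n. smult (coeff P i) (A ^ i * B ^ (n - i)))"

lemma smult_sum_right: "smult c (sum f S) = (\<Sum>i\<in>S. smult c (f i))"
  by (induction S rule: infinite_finite_induct) (simp_all add: smult_add_right)

lemma hsubst_add: "hsubst A B n (P + Q) = hsubst A B n P + hsubst A B n Q"
  by (simp add: hsubst_def smult_add_left sum.distrib)

lemma hsubst_smult: "hsubst A B n (smult c P) = smult c (hsubst A B n P)"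
  by (simp add: hsubst_def smult_sum_right)

lemma hsubst_Suc_pCons:
  "hsubst A B (Suc n) (pCons c P) = smult c (B ^ Suc n) + A * hsubst A B n P"
  unfolding hsubst_def sum.atMost_Suc_shift
  by (simp add: sum_distrib_left mult_smult_right mult.assoc)

text \<open>Raising the formal degree by \<open>k\<close> multiplies the homogenization by
  \<open>Y ^ k\<close>, and \<open>B\<close> is substituted for \<open>Y\<close>.\<close>

lemma hsubst_extend:
  assumes "degree P \<le> n"
  shows "hsubst A B (n + k) P = hsubst A B n P * B ^ k"
proof (induction k)
  case (Suc k)
  have "hsubst A B (Suc (n + k)) P = (\<Sum>i\<le>n + k. smult (coeff P i) (A ^ i * B ^ (Suc (n + k) - i)))"
    using assms by (simp add: hsubst_def coeff_eq_0)
  also have "\<dots> = hsubst A B (n + k) P * B"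
    unfolding hsubst_def sum_distrib_right
    by (intro sum.cong refl) (simp add: Suc_diff_le mult_ac)
  finally show ?case using Suc by (simp add: mult_ac)
qed simp

lemma hsubst_mult:
  assumes "degree P \<le> n" "degree Q \<le> m"
  shows "hsubst A B (n + m) (P * Q) = hsubst A B n P * hsubst A B m Q"
  using assms(1)
proof (induction n arbitrary: P)
  case 0
  then obtain c where "P = [:c:]" by (metis degree_eq_zeroE le_zero_eq)
  then show ?case by (simp add: hsubst_smult) (simp add: hsubst_def)
next
  case (Suc n)
  obtain c P' where P: "P = pCons c P'" by (rule pCons_cases)
  have P': "degree P' \<le> n"
    using Suc.prems P by (cases "P' = 0") auto
  have "hsubst A B (Suc n + m) (P * Q) = smult c (hsubst A B (m + Suc n) Q) + hsubst A B (Suc (n + m)) (pCons 0 (P' * Q))"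
    by (simp add: P hsubst_add hsubst_smult add.commute)
  also have "\<dots> = smult c (hsubst A B m Q * B ^ Suc n) + A * (hsubst A B n P' * hsubst A B m Q)"
    unfolding hsubst_extend[OF assms(2)] hsubst_Suc_pCons Suc.IH[OF P'] by simp
  also have "\<dots> = hsubst A B (Suc n) P * hsubst A B m Q"
    unfolding P hsubst_Suc_pCons by (simp add: algebra_simps)
  finally show ?case .
qed

lemma degree_power_lin: "degree ([:b, a:] ^ i) \<le> i"
  using order_trans[OF degree_power_le mult_le_mono1[of "degree [:b, a:]" 1]] by simp

lemma degree_hsubst_le: "degree (hsubst [:b,a:] [:d,c:] n P) \<le> n"
  unfolding hsubst_def
proof (intro degree_sum_le)
  fix i assume "i \<in> {..n}"
  then have "degree ([:b,a:] ^ i * [:d,c:] ^ (n - i)) \<le> n"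
    using order_trans[OF degree_mult_le add_mono[OF degree_power_lin degree_power_lin], of b a i d c "n - i"] by simp
  then show "degree (smult (coeff P i) ([:b,a:] ^ i * [:d,c:] ^ (n - i))) \<le> n"
    using degree_smult_le le_trans by blast
qed simp

lemma mob_num_eq_hsubst: "mob_num (a,b,c,d) P = hsubst [:b,a:] [:d,c:] (degree P) P"
  by (simp add: mob_num_def hsubst_def)

section \<open>Transformation of values under a matrix\<close>

context nonarch_valued
begin

lemma coeff_power_lin: "coeff ([:b, a:] ^ i) i = (a::'a) ^ i"
proof (induction i)
  case (Suc i)
  have "coeff ([:b, a:] ^ i * [:b, a:]) (i + 1) = coeff ([:b, a:] ^ i) i * coeff [:b, a:] 1"
    by (intro coeff_mult_add degree_power_lin) simp
  then show ?case using Suc by (simp add: mult.commute One_nat_def)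
qed simp

lemma coeff_hsubst:
  "coeff (hsubst [:b,a:] [:d,c:] n P) n = (\<Sum>i\<le>n. coeff P i * (a ^ i * c ^ (n - i)))"
  for P :: "'a poly"
proof -
  have "coeff ([:b,a:] ^ i * [:d,c:] ^ (n - i)) n = a ^ i * c ^ (n - i)" if "i \<le> n" for i
    using coeff_mult_add[OF degree_power_lin degree_power_lin, of b a i d c "n - i"] that
    by (simp add: coeff_power_lin)
  then show ?thesis by (simp add: hsubst_def coeff_sum)
qed

text \<open>The factor of automorphy: the size at \<open>x\<close> of the two coordinates pulled
  back by \<open>g\<close>. Dividing by it renormalises the image point.\<close>

definition cocycle :: "'a mat2 \<Rightarrow> ('a poly \<Rightarrow> real) option \<Rightarrow> real" where
  "cocycle g x = (case g of (a,b,c,d) \<Rightarrow> max (hev x 1 [:b,a:]) (hev x 1 [:d,c:]))"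

definition entry_max :: "'a mat2 \<Rightarrow> real" where
  "entry_max g = (case g of (a,b,c,d) \<Rightarrow> max (max (v a) (v b)) (max (v c) (v d)))"

text \<open>The adjugate matrix recovers \<open>mdet g\<close> times each coordinate from the pulled
  back ones, and one coordinate has value 1 at \<open>x\<close>. The purpose is that the cocycle
  does not vanish.\<close>

lemma det_le_cocycle:
  assumes x: "x \<in> berk_space v"
  shows "v (mdet g) \<le> entry_max g * cocycle g x"
proof -
  obtain a b c d where g: "g = (a,b,c,d)" by (cases g)
  define \<nu> where "\<nu> = cocycle g x"
  define M where "M = entry_max g"
  have \<nu>: "hev x 1 [:b,a:] \<le> \<nu>" "hev x 1 [:d,c:] \<le> \<nu>" by (auto simp: \<nu>_def cocycle_def g)
  have M: "v a \<le> M" "v b \<le> M" "v c \<le> M" "v d \<le> M" by (auto simp: M_def entry_max_def g)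
  have M0: "0 \<le> M" using M(1) v_nonneg order_trans by blast
  have le: "v p * hev x 1 [:b,a:] \<le> M * \<nu>" "v p * hev x 1 [:d,c:] \<le> M * \<nu>" if "v p \<le> M" for p
    using that \<nu> M0 by (auto intro!: mult_mono hev_nonneg[OF x])
  have "smult (mdet g) [:0,1:] = smult d [:b,a:] - smult b [:d,c:]"
    by (simp add: g mdet_def algebra_simps)
  then have "v (mdet g) * hev x 1 [:0,1:] \<le> max (v d * hev x 1 [:b,a:]) (v b * hev x 1 [:d,c:])"
    by (metis hev_diff_le[OF x] hev_smult[OF x])
  then have 1: "v (mdet g) * hev x 1 [:0,1:] \<le> M * \<nu>" using le(1)[OF M(4)] le(2)[OF M(2)] by linarith
  have "smult (mdet g) 1 = smult a [:d,c:] - smult c [:b,a:]"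
    by (simp add: g mdet_def algebra_simps)
  then have "v (mdet g) * hev x 1 1 \<le> max (v a * hev x 1 [:d,c:]) (v c * hev x 1 [:b,a:])"
    by (metis hev_diff_le[OF x] hev_smult[OF x])
  then have 2: "v (mdet g) * hev x 1 1 \<le> M * \<nu>" using le(2)[OF M(1)] le(1)[OF M(3)] by linarith
  show ?thesis
    using 1 2 hev_X_1[OF x] by (auto simp: \<nu>_def M_def max_def split: if_splits)
qed

lemma cocycle_nonneg: "x \<in> berk_space v \<Longrightarrow> 0 \<le> cocycle g x"
  by (auto simp: cocycle_def hev_nonneg le_max_iff_disj split: prod.splits)

lemma cocycle_pos:
  assumes "x \<in> berk_space v" "mdet g \<noteq> 0"
  shows "0 < cocycle g x"
proof -
  have "cocycle g x \<noteq> 0" using det_le_cocycle[OF assms(1), of g] assms(2)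
    by (metis mult_zero_right v_pos_iff not_le)
  then show ?thesis using cocycle_nonneg[OF assms(1), of g] by linarith
qed

lemma poly_eq_sum_le:
  assumes "degree (P :: 'a poly) \<le> n"
  shows "poly P z = (\<Sum>i\<le>n. coeff P i * z ^ i)"
  by (subst poly_eq_sum_powers[OF assms]) (simp add: poly_sum)

text \<open>A larger formal degree adds the same power of \<open>c X + d Y\<close> to numerator and
  denominator. This freedom is needed for sums, whose terms have different degrees.\<close>

lemma act_generic_sem:
  fixes a b c d :: 'a
  assumes s: "berk_seminorm v s" and s0: "s [:d,c:] \<noteq> 0"
  defines "t \<equiv> \<lambda>P. s (mob_num (a,b,c,d) P) / s [:d,c:] ^ degree P"
  shows "berk_seminorm v t" "degree P \<le> n \<Longrightarrow> t P = s (hsubst [:b,a:] [:d,c:] n P) / s [:d,c:] ^ n"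
proof -
  have t: "t P = s (hsubst [:b,a:] [:d,c:] n P) / s [:d,c:] ^ n" if n: "degree P \<le> n" for P n
  proof -
    have "hsubst [:b,a:] [:d,c:] n P = mob_num (a,b,c,d) P * [:d,c:] ^ (n - degree P)"
      using hsubst_extend[of P "degree P" "[:b,a:]" "[:d,c:]" "n - degree P"] n
      by (simp add: mob_num_eq_hsubst)
    moreover have "s [:d,c:] ^ n = s [:d,c:] ^ degree P * s [:d,c:] ^ (n - degree P)"
      using n by (simp flip: power_add)
    ultimately show ?thesis
      using s0 by (simp add: t_def sem_mult[OF s] sem_power[OF s])
  qed
  then show "degree P \<le> n \<Longrightarrow> t P = s (hsubst [:b,a:] [:d,c:] n P) / s [:d,c:] ^ n" .
  show "berk_seminorm v t"
    unfolding berk_seminorm_def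
  proof (intro conjI allI)
    fix P Q c'
    show "0 \<le> t P" by (simp add: t_def sem_nonneg[OF s])
    show "t [:c':] = v c'"
      by (subst t[of _ 0]) (auto simp: hsubst_def sem_smult[OF s] sem_1[OF s] sem_const[OF s])
    have "t (P * Q) = s (hsubst [:b,a:] [:d,c:] (degree P + degree Q) (P * Q)) / s [:d,c:] ^ (degree P + degree Q)"
      by (rule t) (rule degree_mult_le)
    then show "t (P * Q) = t P * t Q"
      by (simp add: hsubst_mult sem_mult[OF s] t[of P "degree P"] t[of Q "degree Q"] power_add)
    let ?n = "max (degree P) (degree Q)"
    have "t (P + Q) = s (hsubst [:b,a:] [:d,c:] ?n (P + Q)) / s [:d,c:] ^ ?n"
      by (rule t) (rule degree_add_le_max)
    also have "\<dots> \<le> (s (hsubst [:b,a:] [:d,c:] ?n P) + s (hsubst [:b,a:] [:d,c:] ?n Q)) / s [:d,c:] ^ ?n"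
      unfolding hsubst_add by (intro divide_right_mono sem_triangle[OF s] zero_le_power sem_nonneg[OF s])
    also have "\<dots> = t P + t Q"
      by (simp add: t[of P ?n] t[of Q ?n] add_divide_distrib)
    finally show "t (P + Q) \<le> t P + t Q" .
  qed
qed

lemma act_in_space:
  assumes x: "x \<in> berk_space v"
  shows "berk_act v g x \<in> berk_space v"
proof -
  obtain a b c d where g: "g = (a,b,c,d)" by (cases g)
  show ?thesis
    using x act_generic_sem(1)[of _ d c a b] by (cases x) (auto simp: g berk_act_def)
qed

text \<open>The cases in the definition of the action (infinity with finite or infinite image, a
  pole, a generic point) merge into one formula, which makes continuity and the contraction
  estimates free of cases.\<close>

lemma hev_act:
  assumes x: "x \<in> berk_space v" and det: "mdet (a,b,c,d) \<noteq> 0" and n: "degree P \<le> n"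
  shows "hev (berk_act v (a,b,c,d) x) n P
       = hev x n (hsubst [:b,a:] [:d,c:] n P) / cocycle (a,b,c,d) x ^ n"
proof (cases x)
  case None
  have cc: "cocycle (a,b,c,d) x = max (v a) (v c)"
    by (simp add: cocycle_def None One_nat_def)
  show ?thesis
  proof (cases "c = 0")
    case True
    have "(\<Sum>i\<le>n. coeff P i * (a ^ i * c ^ (n - i))) = (\<Sum>i\<le>n. if i = n then coeff P n * a ^ n else 0)"
      by (intro sum.cong refl) (auto simp: True)
    then have "coeff (hsubst [:b,a:] [:d,c:] n P) n = coeff P n * a ^ n"
      unfolding coeff_hsubst by simp
    moreover have "a \<noteq> 0" using det True by (auto simp: mdet_def)
    ultimately show ?thesis
      unfolding cc using True None by (simp add: berk_act_def v_mult v_power max_absorb1)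
  next
    case False
    have "(\<Sum>i\<le>n. coeff P i * (a ^ i * c ^ (n - i))) = c ^ n * poly P (a / c)"
      unfolding poly_eq_sum_le[OF n] sum_distrib_left
      using False by (intro sum.cong refl) (simp add: power_divide power_diff field_simps)
    moreover have "max (v a) (v c) = v c * max 1 (v (a / c))"
      using False by (simp add: v_divide max_def field_simps)
    ultimately show ?thesis
      unfolding cc using False None
      by (simp add: berk_act_def berk_pt_def hev_Some coeff_hsubst v_mult v_power power_mult_distrib)
  qed
next
  case (Some s)
  then have s: "berk_seminorm v s" using x by simp
  define m where "m = max 1 (s [:0,1:])"
  have m: "0 < m" by (simp add: m_def less_max_iff_disj)
  have hs: "hev x k Q = s Q / m ^ k" for k Q by (simp add: Some hev_Some m_def)
  have "cocycle (a,b,c,d) x = max (s [:b,a:] / m) (s [:d,c:] / m)"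
    by (simp add: cocycle_def hs)
  also have "\<dots> = max (s [:b,a:]) (s [:d,c:]) / m"
    using m by (auto simp: max_def divide_le_cancel)
  finally have cc: "cocycle (a,b,c,d) x = max (s [:b,a:]) (s [:d,c:]) / m" .
  have rhs: "hev x n (hsubst [:b,a:] [:d,c:] n P) / cocycle (a,b,c,d) x ^ n
      = s (hsubst [:b,a:] [:d,c:] n P) / max (s [:b,a:]) (s [:d,c:]) ^ n"
    using m by (simp add: cc hs power_divide)
  show ?thesis
  proof (cases "s [:d,c:] = 0")
    case True
    have pos: "0 < s [:b,a:]"
      using cocycle_pos[OF x det] True m sem_nonneg[OF s, of "[:b,a:]"] by (simp add: cc zero_less_divide_iff max_def split: if_splits)
    \<comment> \<open>At a pole \<open>c X + d Y\<close> vanishes, so only the term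
      \<open>i = n\<close> contributes, and its coefficient is the value of \<open>P\<close> at
      infinity.\<close>
    have "hsubst [:b,a:] [:d,c:] n P = smult (coeff P n) ([:b,a:] ^ n)
        + (\<Sum>i<n. smult (coeff P i) ([:b,a:] ^ i * [:d,c:] ^ (n - i)))" (is "_ = ?U + ?W")
      by (simp add: hsubst_def lessThan_Suc_atMost[symmetric] add.commute)
    moreover have "s ?W = 0"
    proof -
      have "s ?W \<le> (\<Sum>i<n. s (smult (coeff P i) ([:b,a:] ^ i * [:d,c:] ^ (n - i))))"
        by (rule sem_sum_le[OF s])
      also have "\<dots> = 0"
        by (intro sum.neutral) (auto simp: sem_smult[OF s] sem_mult[OF s] sem_power[OF s] True)
      finally show ?thesis using sem_nonneg[OF s, of ?W] by linarith
    qed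
    moreover have "s (?U + ?W) = s ?U" if "s ?W = 0"
      using sem_triangle[OF s, of ?U ?W] sem_triangle[OF s, of "?U + ?W" "- ?W"] that
      by (simp add: sem_minus[OF s])
    ultimately have "s (hsubst [:b,a:] [:d,c:] n P) = v (coeff P n) * s [:b,a:] ^ n"
      by (simp add: sem_smult[OF s] sem_power[OF s])
    then show ?thesis
      unfolding rhs using True pos Some by (simp add: berk_act_def max_def)
  next
    case False
    define t where "t = (\<lambda>P. s (mob_num (a,b,c,d) P) / s [:d,c:] ^ degree P)"
    have t: "t Q = s (hsubst [:b,a:] [:d,c:] k Q) / s [:d,c:] ^ k" if "degree Q \<le> k" for Q k
      using act_generic_sem(2)[OF s False that] by (simp add: t_def)
    have pos: "0 < s [:d,c:]" using False sem_nonneg[OF s, of "[:d,c:]"] by linarith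
    have "t [:0,1:] = s [:b,a:] / s [:d,c:]"
      by (subst t[of _ 1]) (auto simp: hsubst_def atMost_Suc One_nat_def)
    then have "max 1 (t [:0,1:]) = max (s [:b,a:]) (s [:d,c:]) / s [:d,c:]"
      using pos by (simp add: max_def)
    moreover have "berk_act v (a,b,c,d) x = Some t"
      using False by (simp add: berk_act_def Some t_def)
    ultimately show ?thesis
      unfolding rhs using pos by (simp add: hev_Some t[OF n] power_divide)
  qed
qed

lemma hev_act_lin:
  assumes x: "x \<in> berk_space v" and det: "mdet (a,b,c,d) \<noteq> 0"
  shows "hev (berk_act v (a,b,c,d) x) 1 [:q,p:] * cocycle (a,b,c,d) x
       = hev x 1 [:p * b + q * d, p * a + q * c:]"
proof -
  have "hsubst [:b,a:] [:d,c:] 1 [:q,p:] = [:p * b + q * d, p * a + q * c:]"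
    by (simp add: hsubst_def atMost_Suc One_nat_def algebra_simps)
  then show ?thesis
    using hev_act[OF x det, of "[:q,p:]" 1] cocycle_pos[OF x det] by simp
qed

lemma limitin_act:
  assumes lim: "limitin (berk_top v) f y F" and det: "mdet g \<noteq> 0"
  shows "limitin (berk_top v) (\<lambda>i. berk_act v g (f i)) (berk_act v g y) F"
proof -
  obtain a b c d where g: "g = (a,b,c,d)" by (cases g)
  have y: "y \<in> berk_space v" using limitin_topspace[OF lim] by simp
  have ev: "eventually (\<lambda>i. f i \<in> berk_space v) F"
    using lim openin_topspace[of "berk_top v"] unfolding limitin_def by (metis topspace_berk_top)
  show ?thesis
  proof (rule limitin_berk_topI)
    show "berk_act v g y \<in> berk_space v" by (rule act_in_space[OF y])
    show "eventually (\<lambda>i. berk_act v g (f i) \<in> berk_space v) F"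
      using ev by eventually_elim (rule act_in_space)
    fix n and P :: "'a poly" assume n: "degree P \<le> n"
    have lin: "((\<lambda>i. hev (f i) 1 [:q,p:]) \<longlongrightarrow> hev y 1 [:q,p:]) F" for p q
      by (rule limitin_berk_top_imp[OF lim]) simp
    have "((\<lambda>i. hev (f i) n (hsubst [:b,a:] [:d,c:] n P) / cocycle g (f i) ^ n)
        \<longlongrightarrow> hev y n (hsubst [:b,a:] [:d,c:] n P) / cocycle g y ^ n) F"
      unfolding g cocycle_def prod.case
      by (intro tendsto_intros lin limitin_berk_top_imp[OF lim degree_hsubst_le])
         (use cocycle_pos[OF y det] in \<open>auto simp: g cocycle_def\<close>)
    moreover have "eventually (\<lambda>i. hev (f i) n (hsubst [:b,a:] [:d,c:] n P) / cocycle g (f i) ^ n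
        = hev (berk_act v g (f i)) n P) F"
      using ev by eventually_elim (use hev_act[OF _ det[unfolded g] n] in \<open>simp add: g\<close>)
    ultimately show "((\<lambda>i. hev (berk_act v g (f i)) n P) \<longlongrightarrow> hev (berk_act v g y) n P) F"
      unfolding hev_act[OF y det[unfolded g] n, folded g] by (rule Lim_transform_eventually)
  qed
qed

lemma act_identity:
  assumes x: "x \<in> berk_space v"
  shows "berk_act v (mscal 1) x = x"
proof (rule berk_space_eqI[OF act_in_space[OF x] x])
  fix n and P :: "'a poly" assume n: "degree P \<le> n"
  have "hsubst [:0,1:] [:1,0:] n P = P"
    using poly_eq_sum_powers[OF n] by (simp add: hsubst_def flip: one_pCons)
  moreover have "cocycle (1,0,0,1) x = 1"
    using hev_X_1[OF x] by (simp add: cocycle_def flip: one_pCons)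
  ultimately show "hev (berk_act v (mscal 1) x) n P = hev x n P"
    using hev_act[OF x, of 1 0 0 1 P n] n by (simp add: mscal_def mdet_def)
qed

lemma act_scale:
  assumes x: "x \<in> berk_space v" and t: "t \<noteq> 0" and det: "mdet (a,b,c,d) \<noteq> 0"
  shows "berk_act v (t*a, t*b, t*c, t*d) x = berk_act v (a,b,c,d) x"
proof (rule berk_space_eqI[OF act_in_space[OF x] act_in_space[OF x]])
  fix n and P :: "'a poly" assume n: "degree P \<le> n"
  have det': "mdet (t*a, t*b, t*c, t*d) \<noteq> 0"
  proof -
    have "mdet (t*a, t*b, t*c, t*d) = t * t * mdet (a,b,c,d)" by (simp add: mdet_def algebra_simps)
    then show ?thesis using t det by simp
  qed
  have "(smult t A) ^ i * (smult t B) ^ (n - i) = smult (t ^ n) (A ^ i * B ^ (n - i))"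
    if "i \<le> n" for A B :: "'a poly" and i
    using that by (simp add: smult_power flip: power_add)
  then have "hsubst (smult t A) (smult t B) n P = smult (t ^ n) (hsubst A B n P)" for A B
    by (simp add: hsubst_def smult_sum_right mult.commute)
  from this[of "[:b,a:]" "[:d,c:]"]
  have 1: "hsubst [:t*b,t*a:] [:t*d,t*c:] n P = smult (t ^ n) (hsubst [:b,a:] [:d,c:] n P)" by simp
  have "hev x 1 [:t*q,t*p:] = v t * hev x 1 [:q,p:]" for p q
    using hev_smult[OF x, of 1 t "[:q,p:]"] by simp
  then have 2: "cocycle (t*a, t*b, t*c, t*d) x = v t * cocycle (a,b,c,d) x"
    using t by (simp add: cocycle_def max_mult_distrib_left)
  show "hev (berk_act v (t*a, t*b, t*c, t*d) x) n P = hev (berk_act v (a,b,c,d) x) n P"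
    unfolding hev_act[OF x det' n] hev_act[OF x det n] 1 2
    using t by (simp add: hev_smult[OF x] v_power power_mult_distrib)
qed

text \<open>The form \<open>w X - u Y\<close> vanishes at the image \<open>[u : w]\<close> of a coordinate point; pulled back
  by \<open>g\<close> it becomes \<open>\<plusminus>det g\<close> times a coordinate.\<close>

lemma act_contraction:
  assumes x: "x \<in> berk_space v" and det: "mdet (a,b,c,d) \<noteq> 0"
    and row: "(p,q) = (a,b) \<or> (p,q) = (c,d)" and col: "(u,w) = (a,c) \<or> (u,w) = (b,d)"
  shows "hev (berk_act v (a,b,c,d) x) 1 [:-u,w:] * hev x 1 [:q,p:] \<le> v (mdet (a,b,c,d))"
    and "hev (berk_act v (minv (a,b,c,d)) x) 1 [:q,p:] * hev x 1 [:-u,w:] \<le> v (mdet (a,b,c,d))"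
proof -
  define D where "D = a * d - b * c"
  have D: "mdet (a,b,c,d) = D" "D \<noteq> 0" using det by (auto simp: D_def mdet_def)
  have coord: "hev x 1 [:0,e:] \<le> v e" "hev x 1 [:e,0:] \<le> v e" for e
    using hev_lin_le[OF x, of 0 e] hev_lin_le[OF x, of e 0] by auto
  let ?y = "berk_act v (a,b,c,d) x"
  have y: "?y \<in> berk_space v" by (rule act_in_space[OF x])
  have "hev ?y 1 [:-u,w:] * hev x 1 [:q,p:] \<le> hev ?y 1 [:-u,w:] * cocycle (a,b,c,d) x"
    using row by (intro mult_left_mono hev_nonneg[OF y]) (auto simp: cocycle_def)
  also have "\<dots> = hev x 1 [:w * b + (-u) * d, w * a + (-u) * c:]"
    by (rule hev_act_lin[OF x det])
  also have "\<dots> \<le> v D"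
    using col coord[of D] coord[of "- D"] v_diff_commute[of "b * c" "a * d"] by (auto simp: D_def algebra_simps)
  finally show "hev ?y 1 [:-u,w:] * hev x 1 [:q,p:] \<le> v (mdet (a,b,c,d))" by (simp add: D)
  have inv: "minv (a,b,c,d) = (d/D, -b/D, -c/D, a/D)" by (simp add: minv_def D_def Let_def)
  have det': "mdet (d/D, -b/D, -c/D, a/D) \<noteq> 0"
  proof -
    have "mdet (d/D, -b/D, -c/D, a/D) = D / (D * D)" by (simp add: mdet_def D_def field_simps diff_divide_distrib)
    then show ?thesis using D by simp
  qed
  let ?z = "berk_act v (minv (a,b,c,d)) x"
  have z: "?z \<in> berk_space v" by (rule act_in_space[OF x])
  have "hev x 1 [:-u,w:] \<le> v D * cocycle (d/D, -b/D, -c/D, a/D) x"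
  proof -
    have "hev x 1 [:-b/D, d/D:] = hev x 1 [:-b,d:] / v D" by (rule hev_lin_divide[OF x])
    moreover have "hev x 1 [:a/D, -c/D:] = hev x 1 [:-a,c:] / v D"
      using hev_lin_divide[OF x, of a D "-c"] hev_minus[OF x, of 1 "[:-a,c:]"] by simp
    ultimately show ?thesis using col D
      by (auto simp: cocycle_def max_mult_distrib_left)
  qed
  then have "hev ?z 1 [:q,p:] * hev x 1 [:-u,w:] \<le> hev ?z 1 [:q,p:] * (v D * cocycle (d/D, -b/D, -c/D, a/D) x)"
    by (intro mult_left_mono hev_nonneg[OF z])
  also have "\<dots> = v D * hev x 1 [:p * (-b/D) + q * (a/D), p * (d/D) + q * (-c/D):]"
    using hev_act_lin[OF x det', of q p] by (simp add: inv mult_ac)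
  also have "\<dots> \<le> v D * 1"
  proof (intro mult_left_mono v_nonneg)
    have "d * a / D - b * c / D = 1" using D by (simp add: D_def field_simps diff_divide_distrib[symmetric])
    then show "hev x 1 [:p * (-b/D) + q * (a/D), p * (d/D) + q * (-c/D):] \<le> 1"
      using row coord[of 1] by (auto simp: mult_ac)
  qed
  finally show "hev ?z 1 [:q,p:] * hev x 1 [:-u,w:] \<le> v (mdet (a,b,c,d))" by (simp add: D)
qed

lemma pgl_norm_eq: "pgl_norm v g = entry_max g / sqrt (v (mdet g))"
  by (simp add: pgl_norm_def entry_max_def mdet_def split: prod.splits)

text \<open>A substitute for a Cartan decomposition. The row and the column through an entry
  \<open>t\<close> of largest absolute value become normalised forms after division by
  \<open>t\<close>, and \<open>act_contraction\<close> divided by \<open>v t * v t\<close> has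
  right-hand side \<open>v (mdet g) / (v t * v t) = 1 / pgl_norm v g ^ 2\<close>.\<close>

lemma cartan_forms:
  assumes det: "mdet g \<noteq> 0"
  obtains a1 b1 a2 b2 where "max (v a1) (v b1) = 1" "max (v a2) (v b2) = 1"
    "\<And>x. x \<in> berk_space v \<Longrightarrow> hev (berk_act v g x) 1 [:b1,a1:] * hev x 1 [:b2,a2:] \<le> 1 / pgl_norm v g ^ 2"
    "\<And>x. x \<in> berk_space v \<Longrightarrow> hev (berk_act v (minv g) x) 1 [:b2,a2:] * hev x 1 [:b1,a1:] \<le> 1 / pgl_norm v g ^ 2"
proof -
  obtain a b c d where g: "g = (a,b,c,d)" by (cases g)
  have "\<exists>p q u w t. ((p,q) = (a,b) \<or> (p,q) = (c,d)) \<and> ((u,w) = (a,c) \<or> (u,w) = (b,d)) \<and>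
      t \<in> {p,q} \<and> t \<in> {u,w} \<and> v t = entry_max g"
  proof -
    have "entry_max g \<in> {v a, v b, v c, v d}" by (auto simp: entry_max_def g max_def)
    then consider "v a = entry_max g" | "v b = entry_max g" | "v c = entry_max g" | "v d = entry_max g"
      by auto
    then show ?thesis
    proof cases
      case 1
      show ?thesis by (rule exI[of _ a], rule exI[of _ b], rule exI[of _ a], rule exI[of _ c], rule exI[of _ a]) (simp add: 1)
    next
      case 2
      show ?thesis by (rule exI[of _ a], rule exI[of _ b], rule exI[of _ b], rule exI[of _ d], rule exI[of _ b]) (simp add: 2)
    next
      case 3
      show ?thesis by (rule exI[of _ c], rule exI[of _ d], rule exI[of _ a], rule exI[of _ c], rule exI[of _ c]) (simp add: 3)
    next
      case 4
      show ?thesis by (rule exI[of _ c], rule exI[of _ d], rule exI[of _ b], rule exI[of _ d], rule exI[of _ d]) (simp add: 4)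
    qed
  qed
  then obtain p q u w t where row: "(p,q) = (a,b) \<or> (p,q) = (c,d)" and col: "(u,w) = (a,c) \<or> (u,w) = (b,d)"
    and t: "t \<in> {p,q}" "t \<in> {u,w}" "v t = entry_max g" by blast
  have le: "v p \<le> v t" "v q \<le> v t" "v u \<le> v t" "v w \<le> v t"
    using row col unfolding t(3) by (auto simp: entry_max_def g)
  have t0: "t \<noteq> 0"
  proof
    assume "t = 0"
    then have "p = 0" "q = 0" "u = 0" "w = 0" using le by (auto simp flip: v_eq_0_iff intro: antisym)
    then show False using det row col by (auto simp: g mdet_def)
  qed
  have norm: "1 / pgl_norm v g ^ 2 = v (mdet g) / (v t * v t)"
    using t0 by (simp add: pgl_norm_eq t(3)[symmetric] power_divide power2_eq_square)
  show thesis
  proof (rule that[of "w/t" "-u/t" "p/t" "q/t"])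
    have "max (v w) (v u) = v t" "max (v p) (v q) = v t"
      using le t(1,2) by (auto simp: max_def)
    then show "max (v (w/t)) (v (-u/t)) = 1" "max (v (p/t)) (v (q/t)) = 1"
      using t0 max_divide_distrib_right[of "v w" "v u" "v t"] max_divide_distrib_right[of "v p" "v q" "v t"]
      by (simp_all add: v_divide)
    fix x assume x: "x \<in> berk_space v"
    note y = act_in_space[OF x]
    show "hev (berk_act v g x) 1 [:-u/t,w/t:] * hev x 1 [:q/t,p/t:] \<le> 1 / pgl_norm v g ^ 2"
      using act_contraction(1)[OF x det[unfolded g] row col] t0
      unfolding norm hev_lin_divide[OF x] hev_lin_divide[OF y] by (simp add: g divide_right_mono)
    show "hev (berk_act v (minv g) x) 1 [:q/t,p/t:] * hev x 1 [:-u/t,w/t:] \<le> 1 / pgl_norm v g ^ 2"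
      using act_contraction(2)[OF x det[unfolded g] row col] t0
      unfolding norm hev_lin_divide[OF x] hev_lin_divide[OF y] by (simp add: g divide_right_mono)
  qed
qed

section \<open>Metrizability of closures of countable sets\<close>

text \<open>Divided differences in place of Lagrange interpolation.\<close>

lemma ultrametric_interpolation:
  assumes "finite B" "card B = Suc d" "degree P \<le> d"
    and "\<And>b. b \<in> B \<Longrightarrow> v (poly P b) \<le> M"
    and "\<And>b b'. b \<in> B \<Longrightarrow> b' \<in> B \<Longrightarrow> b \<noteq> b' \<Longrightarrow> r \<le> v (b - b')"
    and "\<And>b. b \<in> B \<Longrightarrow> v (c - b) \<le> R" and r: "0 < r" "r \<le> R"
  shows "v (poly P c) \<le> M * (R / r) ^ d"
  using assms(1-6)
proof (induction d arbitrary: P M B)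
  case 0
  then obtain e where "P = [:e:]" by (metis degree_eq_zeroE le_zero_eq)
  moreover obtain b where "b \<in> B" using "0.prems" by fastforce
  ultimately show ?case using "0.prems"(4) by simp
next
  case (Suc d)
  obtain b0 where b0: "b0 \<in> B" using Suc.prems(2) by fastforce
  define Q where "Q = synthetic_div P b0"
  have P: "poly P z = (z - b0) * poly Q z + poly P b0" for z
  proof -
    have "poly P z = poly ([:- b0, 1:] * Q + [:poly P b0:]) z"
      by (simp only: Q_def synthetic_div_correct')
    then show ?thesis by (simp add: algebra_simps)
  qed
  have M0: "0 \<le> M" using Suc.prems(4)[OF b0] v_nonneg order_trans by blast
  have R0: "0 < R" "1 \<le> R / r" using r by auto
  have "v (poly Q c) \<le> M / r * (R / r) ^ d"
  proof (rule Suc.IH[of "B - {b0}"])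
    show "finite (B - {b0})" "card (B - {b0}) = Suc d" using Suc.prems b0 by auto
    show "degree Q \<le> d" using Suc.prems(3) by (simp add: Q_def degree_synthetic_div)
    show "v (poly Q b) \<le> M / r" if b: "b \<in> B - {b0}" for b
    proof -
      have "v (poly P b - poly P b0) \<le> M"
        using v_diff_le[of "poly P b" "poly P b0"] Suc.prems(4) b b0 by (meson DiffD1 max.bounded_iff order_trans)
      moreover have "poly P b - poly P b0 = (b - b0) * poly Q b" using P[of b] by simp
      ultimately have 1: "v (b - b0) * v (poly Q b) \<le> M" by (simp add: v_mult)
      have "r * v (poly Q b) \<le> v (b - b0) * v (poly Q b)"
        using Suc.prems(5)[of b b0] b b0 by (intro mult_right_mono) auto
      with 1 r show ?thesis by (simp add: field_simps)
    qed
    show "r \<le> v (b - b')" if "b \<in> B - {b0}" "b' \<in> B - {b0}" "b \<noteq> b'" for b b'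
      using Suc.prems(5) that by blast
    show "v (c - b) \<le> R" if "b \<in> B - {b0}" for b
      using Suc.prems(6) that by blast
  qed
  then have "v ((c - b0) * poly Q c) \<le> R * (M / r * (R / r) ^ d)"
    unfolding v_mult using Suc.prems(6)[OF b0] R0 by (intro mult_mono) auto
  also have "\<dots> = M * (R / r) ^ Suc d" by simp
  finally have 1: "v ((c - b0) * poly Q c) \<le> M * (R / r) ^ Suc d" .
  have "M * 1 \<le> M * (R / r) ^ Suc d"
    by (intro mult_left_mono M0 one_le_power R0)
  then have "v (poly P b0) \<le> M * (R / r) ^ Suc d" using Suc.prems(4)[OF b0] by simp
  then show ?case
    unfolding P[of c] using 1 v_add_le[of "(c - b0) * poly Q c" "poly P b0"] by linarith
qed

text \<open>The neighbourhood of \<open>s\<close> is chosen among finite points, so even if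
  \<open>F\<close> contains infinity it meets \<open>F\<close> in some
  \<open>berk_pt v z\<close>.\<close>

lemma berk_top_closure_approx:
  assumes s: "Some s \<in> berk_top v closure_of F" and F: "F \<subseteq> P1k v" and fin: "finite A" and e: "0 < e"
  shows "\<exists>z. berk_pt v z \<in> F \<and> (\<forall>P\<in>A. \<bar>v (poly P z) - s P\<bar> < e)"
proof -
  have sem: "berk_seminorm v s"
    using s closure_of_subset_topspace[of "berk_top v" F] by auto
  define W where "W = (\<Inter>P\<in>A. {t :: 'a poly \<Rightarrow> real. \<bar>t P - s P\<bar> < e})"
  have "open W"
    unfolding W_def using fin
    by (intro open_INT ballI open_Collect_less continuous_intros continuous_on_product_coordinates) auto
  define U where "U = Some ` (berk_aff v \<inter> W)"
  have "Some -` U = berk_aff v \<inter> W" "None \<notin> U" by (auto simp: U_def)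
  then have "openin (berk_top v) U"
    using \<open>open W\<close> by (auto simp: openin_berk_top openin_open)
  moreover have "Some s \<in> U" using sem e by (auto simp: U_def W_def berk_aff_def)
  ultimately obtain y where y: "y \<in> F" "y \<in> U"
    using s unfolding in_closure_of by blast
  then obtain t where "y = Some t" "t \<in> W" by (auto simp: U_def)
  moreover from this obtain z where "y = berk_pt v z" using y F by (auto simp: P1k_def)
  ultimately show ?thesis using y by (auto simp: W_def berk_pt_def)
qed

text \<open>Points of \<open>S\<close> that imitate \<open>s\<close> keep mutual distances of nearly
  \<open>\<rho>\<close> or more and stay within about \<open>\<rho>\<close> of one nearly optimal
  \<open>a\<close>. By interpolation \<open>degree P + 1\<close> of them control \<open>P\<close> on
  that disc, with a loss \<open>((\<rho> + \<eta>) / (\<rho> - \<eta>)) ^ d\<close> that disappears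
  as \<open>\<eta>\<close> tends to 0. Points that imitate \<open>t\<close> lie in the same disc
  because \<open>s\<close> and \<open>t\<close> agree on \<open>X - a\<close>.\<close>

lemma approx_determined_le:
  assumes s: "berk_seminorm v s" and t: "berk_seminorm v t"
    and as: "\<And>A e. finite A \<Longrightarrow> 0 < e \<Longrightarrow> \<exists>z\<in>S. \<forall>P\<in>A. \<bar>v (poly P z) - s P\<bar> < e"
    and at: "\<And>A e. finite A \<Longrightarrow> 0 < e \<Longrightarrow> \<exists>z\<in>S. \<forall>P\<in>A. \<bar>v (poly P z) - t P\<bar> < e"
    and eq: "\<And>z. z \<in> S \<Longrightarrow> s [:-z,1:] = t [:-z,1:]"
    and sep: "0 < \<kappa>" "\<And>z. z \<in> S \<Longrightarrow> \<kappa> \<le> s [:-z,1:]"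
  shows "t P \<le> s P"
proof -
  define d where "d = degree P"
  define \<rho> where "\<rho> = (INF z\<in>S. s [:-z,1:])"
  have S: "S \<noteq> {}" using as[of "{}" 1] by auto
  have bdd: "bdd_below ((\<lambda>z. s [:-z,1:]) ` S)" using sep(2) by (rule bdd_belowI2)
  have \<rho>: "0 < \<rho>"
    using cINF_greatest[OF S, of \<kappa> "\<lambda>z. s [:-z,1:]"] sep by (simp add: \<rho>_def)
  have \<rho>_le: "\<rho> \<le> s [:-z,1:]" if "z \<in> S" for z
    unfolding \<rho>_def by (rule cINF_lower[OF bdd that])
  have main: "t P - \<eta> \<le> (s P + \<eta>) * ((\<rho> + \<eta>) / (\<rho> - \<eta>)) ^ d" if \<eta>: "0 < \<eta>" "\<eta> < \<rho>" for \<eta>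
  proof -
    obtain a where a: "a \<in> S" "s [:-a,1:] < \<rho> + \<eta>"
    proof -
      have "Inf ((\<lambda>z. s [:-z,1:]) ` S) < \<rho> + \<eta>" using \<eta> by (simp add: \<rho>_def)
      then show ?thesis using cInf_less_iff[of "(\<lambda>z. s [:-z,1:]) ` S"] S bdd that by auto
    qed
    \<comment> \<open>The second term guarantees that a point imitating \<open>s\<close> on
      \<open>X - a\<close> up to \<open>e\<close> lies within \<open>\<rho> + \<eta>\<close> of
      \<open>a\<close>.\<close>
    define e where "e = min \<eta> (\<rho> + \<eta> - s [:-a,1:])"
    have e: "0 < e" "e \<le> \<eta>" "e \<le> \<rho> + \<eta> - s [:-a,1:]" using a \<eta> by (auto simp: e_def)
    define good where "good B \<longleftrightarrow> finite B \<and> B \<subseteq> S \<and>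
        (\<forall>b\<in>B. v (poly P b) \<le> s P + \<eta> \<and> v (b - a) \<le> \<rho> + \<eta>) \<and>
        (\<forall>b\<in>B. \<forall>b'\<in>B. b \<noteq> b' \<longrightarrow> \<rho> - \<eta> \<le> v (b - b'))" for B
    have "\<exists>B. good B \<and> card B = k" for k
    proof (induction k)
      case 0
      have "good {}" by (simp add: good_def)
      then show ?case by (intro exI[of _ "{}"]) simp
    next
      case (Suc k)
      then obtain B where B: "good B" "card B = k" by auto
      have fin: "finite B" and BS: "B \<subseteq> S" using B by (auto simp: good_def)
      \<comment> \<open>The new point also imitates \<open>s\<close> on \<open>X - b\<close> for all
        earlier \<open>b\<close>. Since \<open>s\<close> is at least \<open>\<rho>\<close> there, it
        stays away from every \<open>b\<close>, and in particular it is new.\<close>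
      have "\<exists>z\<in>S. \<forall>Q\<in>{P, [:-a,1:]} \<union> (\<lambda>b. [:-b,1:]) ` B. \<bar>v (poly Q z) - s Q\<bar> < e"
        by (rule as) (use fin e in auto)
      then obtain z where z: "z \<in> S" "\<bar>v (poly P z) - s P\<bar> < e" "\<bar>v (z - a) - s [:-a,1:]\<bar> < e"
        "\<And>b. b \<in> B \<Longrightarrow> \<bar>v (z - b) - s [:-b,1:]\<bar> < e" by auto
      have zP: "v (poly P z) \<le> s P + \<eta>" using z(2) e by linarith
      have za: "v (z - a) \<le> \<rho> + \<eta>" using z(3) e by linarith
      have zb: "\<rho> - \<eta> < v (z - b)" if "b \<in> B" for b
        using z(4)[OF that] \<rho>_le[of b] BS that e(2) by fastforce
      have "z \<notin> B" using zb[of z] \<eta> by auto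
      moreover have "good (insert z B)"
        using B(1) z(1) zP za zb unfolding good_def
        by (simp add: less_imp_le v_diff_commute[of _ z])
      ultimately show ?case
        using B(2) fin by (intro exI[of _ "insert z B"]) simp
    qed
    then obtain B where B: "good B" "card B = Suc d" by auto
    obtain c where c: "c \<in> S" "\<And>Q. Q \<in> {P, [:-a,1:]} \<Longrightarrow> \<bar>v (poly Q c) - t Q\<bar> < e"
      using at[of "{P, [:-a,1:]}" e] e(1) by blast
    have "v (c - a) \<le> \<rho> + \<eta>" using c(2)[of "[:-a,1:]"] e eq[OF a(1)] by (simp add: abs_less_iff)
    then have cb: "v (c - b) \<le> \<rho> + \<eta>" if "b \<in> B" for b
      using v_diff_le[of "c - a" "b - a"] B(1) that by (auto simp: good_def)
    have "t P - \<eta> \<le> v (poly P c)" using c(2)[of P] e by (simp add: abs_less_iff)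
    also have "\<dots> \<le> (s P + \<eta>) * ((\<rho> + \<eta>) / (\<rho> - \<eta>)) ^ d"
      by (rule ultrametric_interpolation[OF _ B(2)]) (use B(1) cb \<eta> in \<open>auto simp: d_def good_def\<close>)
    finally show ?thesis .
  qed
  have "((\<lambda>\<eta>. t P - \<eta>) \<longlongrightarrow> t P - 0) (at_right 0)"
    by (intro tendsto_intros)
  moreover have "((\<lambda>\<eta>. (s P + \<eta>) * ((\<rho> + \<eta>) / (\<rho> - \<eta>)) ^ d) \<longlongrightarrow> (s P + 0) * ((\<rho> + 0) / (\<rho> - 0)) ^ d) (at_right 0)"
    by (intro tendsto_intros) (use \<rho> in auto)
  moreover have "eventually (\<lambda>\<eta>. t P - \<eta> \<le> (s P + \<eta>) * ((\<rho> + \<eta>) / (\<rho> - \<eta>)) ^ d) (at_right 0)"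
    using eventually_at_right_less[of "0::real"] eventually_at_right[of 0 \<rho>] \<rho> main
    unfolding eventually_at_right_field by (intro exI[of _ \<rho>]) auto
  ultimately have "t P - 0 \<le> (s P + 0) * ((\<rho> + 0) / (\<rho> - 0)) ^ d"
    by (intro tendsto_le[OF trivial_limit_at_right_real])
  then show ?thesis using \<rho> by simp
qed

text \<open>Interpolation in both directions works if the common values on \<open>X - z\<close> are
  bounded below. Otherwise some \<open>X - z\<close> is arbitrarily small at both points, and
  \<open>hev_close\<close> identifies them.\<close>

lemma approx_determined:
  assumes s: "berk_seminorm v s" and t: "berk_seminorm v t"
    and as: "\<And>A e. finite A \<Longrightarrow> 0 < e \<Longrightarrow> \<exists>z\<in>S. \<forall>P\<in>A. \<bar>v (poly P z) - s P\<bar> < e"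
    and at: "\<And>A e. finite A \<Longrightarrow> 0 < e \<Longrightarrow> \<exists>z\<in>S. \<forall>P\<in>A. \<bar>v (poly P z) - t P\<bar> < e"
    and eq: "\<And>z. z \<in> S \<Longrightarrow> s [:-z,1:] = t [:-z,1:]"
  shows "Some s = Some t"
proof (cases "\<exists>\<kappa>>0. \<forall>z\<in>S. \<kappa> \<le> s [:-z,1:]")
  case True
  then obtain \<kappa> where r: "0 < \<kappa>" "\<And>z. z \<in> S \<Longrightarrow> \<kappa> \<le> s [:-z,1:]" by blast
  have "t P \<le> s P" for P
    by (rule approx_determined_le[OF s t as at eq r])
  moreover have "s P \<le> t P" for P
    by (rule approx_determined_le[OF t s at as, where \<kappa> = \<kappa>]) (use eq r in auto)
  ultimately show ?thesis by (simp add: fun_eq_iff antisym)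
next
  case False
  show ?thesis
  proof (rule berk_space_eqI)
    show x: "Some s \<in> berk_space v" and y: "Some t \<in> berk_space v" using s t by auto
    fix n and P :: "'a poly" assume deg: "degree P \<le> n"
    obtain B where B: "0 < B" "\<And>a b x y. \<lbrakk>max (v a) (v b) = 1; x \<in> berk_space v; y \<in> berk_space v\<rbrakk>
       \<Longrightarrow> \<bar>hev x n P - hev y n P\<bar> \<le> B * max (hev x 1 [:b,a:]) (hev y 1 [:b,a:])"
      using hev_close[OF deg] by meson
    have "\<bar>hev (Some s) n P - hev (Some t) n P\<bar> \<le> 0 + e" if e: "0 < e" for e
    proof -
      obtain z where z: "z \<in> S" "s [:-z,1:] < e / B"
        using False e B(1) by (metis divide_pos_pos not_le)
      \<comment> \<open>\<open>w\<close> normalises \<open>X - z\<close>. As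
        \<open>v w \<ge> 1\<close>, the normalised value is at most the value of the
        seminorm.\<close>
      obtain w where w: "v w = max (v 1) (v (- z))" "max (v (1 / w)) (v (- z / w)) = 1"
        using normalise_linear_form[of 1 "- z"] by (metis one_neq_zero)
      have small: "hev (Some r) 1 [:- z / w, 1 / w:] \<le> r [:-z,1:]" if "berk_seminorm v r" for r
      proof -
        have "hev (Some r) 1 [:- z / w, 1 / w:] = r [:-z,1:] / max 1 (r [:0,1:]) / v w"
          using hev_lin_divide[of "Some r" "- z" w 1] that by (simp add: hev_Some)
        also have "\<dots> = r [:-z,1:] / (max 1 (r [:0,1:]) * v w)" by simp
        also have "\<dots> \<le> r [:-z,1:] / 1"
        proof (intro divide_left_mono sem_nonneg[OF that])
          have "1 * 1 \<le> max 1 (r [:0,1:]) * v w" unfolding w by (intro mult_mono) auto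
          then show "1 \<le> max 1 (r [:0,1:]) * v w" "0 < max 1 (r [:0,1:]) * v w * 1" by auto
        qed
        finally show ?thesis by simp
      qed
      have "\<bar>hev (Some s) n P - hev (Some t) n P\<bar> \<le> B * (e / B)"
        using small[OF s] small[OF t] eq[OF z(1)] z(2) B(1)
        by (intro order_trans[OF B(2)[OF w(2) x y]] mult_left_mono) auto
      then show ?thesis using B(1) by simp
    qed
    then have "\<bar>hev (Some s) n P - hev (Some t) n P\<bar> \<le> 0" by (rule field_le_epsilon)
    then show "hev (Some s) n P = hev (Some t) n P" by simp
  qed
qed

lemma berk_pt_eq_iff [simp]: "berk_pt v z = berk_pt v w \<longleftrightarrow> z = w"
proof
  assume "berk_pt v z = berk_pt v w"
  then have "v (poly [:-z,1:] z) = v (poly [:-z,1:] w)" by (metis berk_pt_def option.inject)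
  then show "z = w" by simp
qed simp

text \<open>A continuous injection of a compact space into a countable product of real lines is an
  embedding. The coordinate \<open>1\<close>, the form \<open>Y\<close>, recognises infinity and
  converts \<open>hev\<close> on \<open>X - z\<close> back to seminorm values.\<close>

theorem metrizable_closure_countable:
  assumes count: "countable F" and F: "F \<subseteq> P1k v"
  shows "metrizable_space (subtopology (berk_top v) (berk_top v closure_of F))"
proof -
  define L where "L = berk_top v closure_of F"
  define S where "S = {z. berk_pt v z \<in> F}"
  define I where "I = insert 1 ((\<lambda>z. [:-z,1:]) ` S)"
  define \<phi> where "\<phi> x = (\<lambda>P\<in>I. hev x 1 P)" for x
  have "inj_on (berk_pt v) S" "berk_pt v ` S \<subseteq> F" by (auto simp: S_def inj_on_def)
  then have "countable S" using count by (meson countable_image_inj_on countable_subset)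
  then have cI: "countable I" by (simp add: I_def)
  have degI: "degree P \<le> 1" if "P \<in> I" for P using that by (auto simp: I_def)
  have LX: "L \<subseteq> berk_space v" using closure_of_subset_topspace[of "berk_top v" F] by (simp add: L_def)
  define Y where "Y = product_topology (\<lambda>_::'a poly. euclideanreal) I"
  have metY: "metrizable_space Y"
    unfolding Y_def metrizable_space_product_topology
    using cI by (auto intro: countable_subset metrizable_space_euclidean)
  have cont: "continuous_map (subtopology (berk_top v) L) Y \<phi>"
    unfolding Y_def continuous_map_componentwise
    by (auto simp: \<phi>_def intro!: continuous_map_from_subtopology continuous_map_hev degI)
  have "closedin (berk_top v) L" by (simp add: L_def)
  then have comp: "compact_space (subtopology (berk_top v) L)"
    by (meson closedin_compact_space compact_space_berk_top compact_space_subtopology)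
  have inj: "inj_on \<phi> L"
  proof (rule inj_onI)
    fix x y assume x: "x \<in> L" and y: "y \<in> L" and eq: "\<phi> x = \<phi> y"
    have eqI: "hev x 1 P = hev y 1 P" if "P \<in> I" for P
      using fun_cong[OF eq, of P] that by (simp add: \<phi>_def)
    have 1: "hev x 1 1 = hev y 1 1" by (rule eqI) (simp add: I_def)
    have inf: "hev z 1 1 = 0 \<longleftrightarrow> z = None" if "z \<in> berk_space v" for z
    proof (cases z)
      case None
      then show ?thesis by (simp add: One_nat_def)
    next
      case (Some r)
      then show ?thesis using that hev_1_1_Some[of r] by (simp add: max_def)
    qed
    show "x = y"
    proof (cases "x = None")
      case True
      then show ?thesis using 1 inf x y LX by (metis subsetD)
    next
      case False
      then obtain s where xs: "x = Some s" by auto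
      have "y \<noteq> None" using 1 inf x y LX False by (metis subsetD)
      then obtain t where yt: "y = Some t" by auto
      have s: "berk_seminorm v s" and t: "berk_seminorm v t" using x y LX xs yt by auto
      have "s [:-z,1:] = t [:-z,1:]" if "z \<in> S" for z
        using eqI[of "[:-z,1:]"] 1 that
        by (simp add: xs yt sem_eq_hev[OF s, of _ 1] sem_eq_hev[OF t, of _ 1] I_def)
      moreover have "\<exists>z\<in>S. \<forall>P\<in>A. \<bar>v (poly P z) - r P\<bar> < e" if "Some r \<in> L" "finite A" "0 < e" for r A e
        using berk_top_closure_approx[OF that(1)[unfolded L_def] F that(2,3)] by (auto simp: S_def)
      ultimately show ?thesis
        unfolding xs yt using x y xs yt by (intro approx_determined[OF s t, of S]) auto
    qed
  qed
  have "closed_map (subtopology (berk_top v) L) Y \<phi>"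
    using comp cont metY by (intro continuous_imp_closed_map_gen Hausdorff_imp_kc_space metrizable_imp_Hausdorff_space)
  then have "embedding_map (subtopology (berk_top v) L) Y \<phi>"
    using cont inj LX by (intro injective_closed_imp_embedding_map) (auto intro: inj_on_subset)
  then have "subtopology (berk_top v) L homeomorphic_space subtopology Y (\<phi> ` topspace (subtopology (berk_top v) L))"
    by (rule embedding_map_imp_homeomorphic_space)
  then show ?thesis
    using metY homeomorphic_metrizable_space metrizable_space_subtopology L_def by blast
qed

end

section \<open>Arcs through classical points\<close>

lemma continuous_on_Max_image:
  fixes f :: "'i \<Rightarrow> 'b::topological_space \<Rightarrow> 'c::linorder_topology"
  assumes "finite A" "A \<noteq> {}" "\<And>i. i \<in> A \<Longrightarrow> continuous_on S (f i)"
  shows "continuous_on S (\<lambda>t. Max ((\<lambda>i. f i t) ` A))"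
  using assms
proof (induction A rule: finite_ne_induct)
  case (insert i A)
  have "continuous_on S (\<lambda>t. max (f i t) (Max ((\<lambda>i. f i t) ` A)))"
    using insert by (intro continuous_on_max) auto
  then show ?case using insert by simp
qed simp

context nonarch_valued
begin

lemma continuous_map_into_berk_top:
  assumes "\<And>x. x \<in> topspace X \<Longrightarrow> f x \<in> berk_space v"
    and "\<And>n P. degree P \<le> n \<Longrightarrow> continuous_map X euclideanreal (\<lambda>x. hev (f x) n P)"
  shows "continuous_map X (berk_top v) f"
  unfolding continuous_map_atin
proof
  fix x assume x: "x \<in> topspace X"
  show "limitin (berk_top v) f (f x) (atin X x)"
  proof (rule limitin_berk_topI)
    show "f x \<in> berk_space v" by (rule assms(1)[OF x])
    show "eventually (\<lambda>i. f i \<in> berk_space v) (atin X x)"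
      unfolding eventually_atin using assms(1) by (metis DiffD1 openin_topspace)
    fix n and P :: "'a poly" assume "degree P \<le> n"
    then show "((\<lambda>i. hev (f i) n P) \<longlongrightarrow> hev (f x) n P) (atin X x)"
      using assms(2) x by (auto simp: continuous_map_atin)
  qed
qed

section \<open>Gauss norms and the points given by discs\<close>

lemma v_sum_le:
  assumes "\<And>i. i \<in> A \<Longrightarrow> v (f i) \<le> M" "0 \<le> M"
  shows "v (sum f A) \<le> M"
  using assms(1)
proof (induction A rule: infinite_finite_induct)
  case (insert i A)
  then have "v (f i) \<le> M" "v (sum f A) \<le> M" by auto
  then show ?case using insert(1,2) order_trans[OF v_add_le[of "f i" "sum f A"]] by simp
qed (use assms(2) in auto)

lemma v_sum_less:
  assumes "\<And>i. i \<in> A \<Longrightarrow> v (f i) < M" "0 < M"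
  shows "v (sum f A) < M"
  using assms(1)
proof (induction A rule: infinite_finite_induct)
  case (insert i A)
  then have "v (f i) < M" "v (sum f A) < M" by auto
  then show ?case using insert(1,2) le_less_trans[OF v_add_le[of "f i" "sum f A"]] by simp
qed (use assms(2) in auto)

lemma v_add_eq_left:
  assumes "v y < v x"
  shows "v (x + y) = v x"
  using v_add_le[of x y] v_diff_le[of "x + y" y] assms by auto

text \<open>The Gauss norm of radius \<open>r\<close> about 0. The length \<open>n\<close> is kept
  apart from the degree so that summands can be compared in a common length.\<close>

definition gauss :: "real \<Rightarrow> nat \<Rightarrow> 'a poly \<Rightarrow> real" where
  "gauss r n P = Max ((\<lambda>i. v (coeff P i) * r ^ i) ` {..n})"

context
  fixes r :: real assumes r: "0 \<le> r"
begin

lemma gauss_nonneg: "0 \<le> gauss r n P"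
proof -
  have "v (coeff P 0) * r ^ 0 \<le> gauss r n P"
    unfolding gauss_def by (rule Max_ge) (auto intro: image_eqI[of _ _ 0])
  then have "v (coeff P 0) \<le> gauss r n P" by simp
  then show ?thesis by (rule order_trans[OF v_nonneg])
qed

lemma gauss_ge:
  assumes "degree P \<le> n"
  shows "v (coeff P i) * r ^ i \<le> gauss r n P"
proof (cases "i \<le> n")
  case True
  then show ?thesis unfolding gauss_def by (intro Max_ge) auto
next
  case False
  then show ?thesis using assms gauss_nonneg by (simp add: coeff_eq_0)
qed

lemma gauss_leI:
  assumes "\<And>i. i \<le> n \<Longrightarrow> v (coeff P i) * r ^ i \<le> M"
  shows "gauss r n P \<le> M"
  unfolding gauss_def using assms by (intro Max.boundedI) auto

lemma gauss_degree:
  assumes "degree P \<le> n" "degree P \<le> m"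
  shows "gauss r n P = gauss r m P"
  by (intro antisym gauss_leI gauss_ge assms)

lemma gauss_add_le:
  assumes "degree P \<le> n" "degree Q \<le> n"
  shows "gauss r n (P + Q) \<le> gauss r n P + gauss r n Q"
proof (rule gauss_leI)
  fix i
  have "v (coeff (P + Q) i) * r ^ i \<le> (v (coeff P i) + v (coeff Q i)) * r ^ i"
    using r v_add_le[of "coeff P i" "coeff Q i"] v_nonneg[of "coeff P i"] v_nonneg[of "coeff Q i"]
    by (intro mult_right_mono) (auto simp del: v_nonneg)
  also have "\<dots> \<le> gauss r n P + gauss r n Q"
    unfolding distrib_right by (intro add_mono gauss_ge assms)
  finally show "v (coeff (P + Q) i) * r ^ i \<le> gauss r n P + gauss r n Q" .
qed

lemma gauss_least_index:
  obtains i where "i \<le> n" "v (coeff P i) * r ^ i = gauss r n P"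
    "\<And>j. j < i \<Longrightarrow> v (coeff P j) * r ^ j < gauss r n P"
proof -
  define Q where "Q i \<longleftrightarrow> i \<le> n \<and> v (coeff P i) * r ^ i = gauss r n P" for i
  have "gauss r n P \<in> (\<lambda>i. v (coeff P i) * r ^ i) ` {..n}"
    unfolding gauss_def by (intro Max_in) auto
  then obtain i where "Q i" by (auto simp: Q_def)
  then have Q: "Q (LEAST i. Q i)" by (rule LeastI)
  show thesis
  proof (rule that[of "LEAST i. Q i"])
    show "(LEAST i. Q i) \<le> n" "v (coeff P (LEAST i. Q i)) * r ^ (LEAST i. Q i) = gauss r n P"
      using Q by (auto simp: Q_def)
    fix j assume j: "j < (LEAST i. Q i)"
    then have "\<not> Q j" by (rule not_less_Least)
    moreover have "j \<le> n" using j Q by (auto simp: Q_def)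
    moreover have "v (coeff P j) * r ^ j \<le> gauss r n P"
      unfolding gauss_def using \<open>j \<le> n\<close> by (intro Max_ge) auto
    ultimately show "v (coeff P j) * r ^ j < gauss r n P" by (auto simp: Q_def)
  qed
qed

end

text \<open>Gauss's lemma. If \<open>i\<close> and \<open>j\<close> are the least indices where the
  maxima of \<open>P\<close> and \<open>Q\<close> are attained, the coefficient of the product at
  \<open>i + j\<close> has a single dominant term: every other splitting has an index below
  \<open>i\<close> or below \<open>j\<close>.\<close>

lemma gauss_mult:
  assumes r: "0 < r" and P: "degree P \<le> n" and Q: "degree Q \<le> m"
  shows "gauss r (n + m) (P * Q) = gauss r n P * gauss r m Q"
proof (rule antisym)
  have r0: "0 \<le> r" using r by simp
  note nn = gauss_nonneg[OF r0] and ge = gauss_ge[OF r0]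
  have term_eq: "v (coeff P i * coeff Q (k - i)) * r ^ k = (v (coeff P i) * r ^ i) * (v (coeff Q (k - i)) * r ^ (k - i))"
    if "i \<le> k" for i k
  proof -
    have "r ^ k = r ^ i * r ^ (k - i)" using that by (simp flip: power_add)
    then show ?thesis by (simp add: v_mult)
  qed
  show "gauss r (n + m) (P * Q) \<le> gauss r n P * gauss r m Q"
  proof (rule gauss_leI[OF r0])
    fix k
    have "v (coeff (P * Q) k) \<le> gauss r n P * gauss r m Q / r ^ k"
      unfolding coeff_mult
    proof (rule v_sum_le)
      fix i assume "i \<in> {..k}"
      then have "v (coeff P i * coeff Q (k - i)) * r ^ k \<le> gauss r n P * gauss r m Q"
        using term_eq[of i k] by (auto intro!: mult_mono ge P Q nn mult_nonneg_nonneg simp: r0)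
      then show "v (coeff P i * coeff Q (k - i)) \<le> gauss r n P * gauss r m Q / r ^ k"
        using r by (simp add: pos_le_divide_eq)
    qed (simp add: nn r0)
    then show "v (coeff (P * Q) k) * r ^ k \<le> gauss r n P * gauss r m Q"
      using r by (simp add: pos_le_divide_eq)
  qed
  show "gauss r n P * gauss r m Q \<le> gauss r (n + m) (P * Q)"
  proof (cases "gauss r n P = 0 \<or> gauss r m Q = 0")
    case True
    then show ?thesis using nn[of "n + m" "P * Q"] by auto
  next
    case False
    then have pos: "0 < gauss r n P" "0 < gauss r m Q"
      using nn[of n P] nn[of m Q] by auto
    obtain i where i: "i \<le> n" "v (coeff P i) * r ^ i = gauss r n P"
      "\<And>j. j < i \<Longrightarrow> v (coeff P j) * r ^ j < gauss r n P"
      using gauss_least_index[OF r0, where n = n and P = P] by blast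
    obtain j where j: "j \<le> m" "v (coeff Q j) * r ^ j = gauss r m Q"
      "\<And>k. k < j \<Longrightarrow> v (coeff Q k) * r ^ k < gauss r m Q"
      using gauss_least_index[OF r0, where n = m and P = Q] by blast
    define k where "k = i + j"
    have "v (coeff P i * coeff Q j) * r ^ k = (v (coeff P i) * r ^ i) * (v (coeff Q j) * r ^ j)"
      using term_eq[of i k] by (simp add: k_def)
    then have lead: "v (coeff P i * coeff Q j) = gauss r n P * gauss r m Q / r ^ k"
      using r unfolding i(2) j(2) by (simp add: eq_divide_eq)
    have "v (\<Sum>l\<in>{..k} - {i}. coeff P l * coeff Q (k - l)) < gauss r n P * gauss r m Q / r ^ k"
    proof (rule v_sum_less)
      fix l assume l: "l \<in> {..k} - {i}"
      have "(v (coeff P l) * r ^ l) * (v (coeff Q (k - l)) * r ^ (k - l)) < gauss r n P * gauss r m Q"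
      proof (cases "l < i")
        case True
        have "(v (coeff P l) * r ^ l) * (v (coeff Q (k - l)) * r ^ (k - l)) \<le> (v (coeff P l) * r ^ l) * gauss r m Q"
          using r0 by (intro mult_left_mono ge Q) auto
        also have "\<dots> < gauss r n P * gauss r m Q"
          using i(3)[OF True] pos by (intro mult_strict_right_mono)
        finally show ?thesis .
      next
        case False
        then have "k - l < j" using l by (auto simp: k_def)
        have "(v (coeff P l) * r ^ l) * (v (coeff Q (k - l)) * r ^ (k - l)) \<le> gauss r n P * (v (coeff Q (k - l)) * r ^ (k - l))"
          using r0 by (intro mult_right_mono ge P) auto
        also have "\<dots> < gauss r n P * gauss r m Q"
          using j(3)[OF \<open>k - l < j\<close>] pos by (intro mult_strict_left_mono)
        finally show ?thesis .
      qed
      then show "v (coeff P l * coeff Q (k - l)) < gauss r n P * gauss r m Q / r ^ k"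
        using term_eq[of l k] l r by (simp add: pos_less_divide_eq)
    qed (use pos r in simp)
    moreover have "coeff (P * Q) k = coeff P i * coeff Q j + (\<Sum>l\<in>{..k} - {i}. coeff P l * coeff Q (k - l))"
      unfolding coeff_mult by (subst sum.remove[of _ i]) (auto simp: k_def)
    ultimately have "v (coeff (P * Q) k) = gauss r n P * gauss r m Q / r ^ k"
      using lead v_add_eq_left by metis
    then have "gauss r n P * gauss r m Q = v (coeff (P * Q) k) * r ^ k" using r by simp
    also have "\<dots> \<le> gauss r (n + m) (P * Q)"
      by (rule ge) (rule order_trans[OF degree_mult_le add_mono[OF P Q]])
    finally show ?thesis .
  qed
qed

text \<open>The point given by the closed disc of centre \<open>a\<close> and radius
  \<open>r\<close>, via the expansion of \<open>P\<close> about \<open>a\<close>. For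
  \<open>r = 0\<close> only the constant term survives, since \<open>0 ^ 0 = 1\<close>, which gives
  the classical point.\<close>

definition disc_sem :: "'a \<Rightarrow> real \<Rightarrow> 'a poly \<Rightarrow> real" where
  "disc_sem a r P = gauss r (degree P) (pcompose P [:a,1:])"

lemma degree_shift: "degree (pcompose P [:a,1:]) = degree (P :: 'a poly)"
  by (simp add: degree_pcompose)

lemma disc_sem_eq:
  assumes "0 \<le> r" "degree P \<le> n"
  shows "disc_sem a r P = gauss r n (pcompose P [:a,1:])"
  unfolding disc_sem_def by (rule gauss_degree[OF assms(1)]) (auto simp: degree_shift assms(2))

lemma disc_sem_0: "Some (disc_sem a 0) = berk_pt v a"
proof -
  have "disc_sem a 0 P = v (poly P a)" for P
  proof -
    have "gauss 0 n Q = v (coeff Q 0)" for n Q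
      unfolding gauss_def
    proof (rule Max_eqI)
      show "y \<le> v (coeff Q 0)" if "y \<in> (\<lambda>i. v (coeff Q i) * 0 ^ i) ` {..n}" for y
        using that by (auto simp: power_0_left)
      show "v (coeff Q 0) \<in> (\<lambda>i. v (coeff Q i) * 0 ^ i) ` {..n}"
        by (rule image_eqI[of _ _ 0]) auto
    qed simp
    then show ?thesis by (simp add: disc_sem_def poly_pcompose flip: poly_0_coeff_0)
  qed
  then show ?thesis by (simp add: berk_pt_def fun_eq_iff)
qed

lemma disc_sem_in_space:
  assumes "0 \<le> r"
  shows "Some (disc_sem a r) \<in> berk_space v"
proof (cases "r = 0")
  case True
  then show ?thesis by (simp only: disc_sem_0 berk_pt_in_space)
next
  case False
  then have r: "0 < r" using assms by simp
  have "berk_seminorm v (disc_sem a r)"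
    unfolding berk_seminorm_def
  proof (intro conjI allI)
    fix P Q c
    show "0 \<le> disc_sem a r P" by (simp add: disc_sem_def gauss_nonneg[OF assms])
    show "disc_sem a r [:c:] = v c" by (simp add: disc_sem_def gauss_def)
    show "disc_sem a r (P * Q) = disc_sem a r P * disc_sem a r Q"
    proof -
      have "disc_sem a r (P * Q) = gauss r (degree P + degree Q) (pcompose P [:a,1:] * pcompose Q [:a,1:])"
        using disc_sem_eq[OF assms degree_mult_le] by (simp add: pcompose_mult)
      also have "\<dots> = disc_sem a r P * disc_sem a r Q"
        unfolding disc_sem_def by (rule gauss_mult[OF r]) (simp_all add: degree_shift)
      finally show ?thesis .
    qed
    let ?n = "max (degree P) (degree Q)"
    have "disc_sem a r (P + Q) = gauss r ?n (pcompose P [:a,1:] + pcompose Q [:a,1:])"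
      using disc_sem_eq[OF assms degree_add_le_max] by (simp add: pcompose_add)
    also have "\<dots> \<le> gauss r ?n (pcompose P [:a,1:]) + gauss r ?n (pcompose Q [:a,1:])"
      by (rule gauss_add_le[OF assms]) (simp_all add: degree_shift)
    also have "\<dots> = disc_sem a r P + disc_sem a r Q"
      using disc_sem_eq[OF assms, of P ?n a] disc_sem_eq[OF assms, of Q ?n a] by simp
    finally show "disc_sem a r (P + Q) \<le> disc_sem a r P + disc_sem a r Q" .
  qed
  then show ?thesis by simp
qed

lemma gauss_lin:
  assumes "0 \<le> r"
  shows "gauss r 1 [:b, c:] = max (v b) (v c * r)"
  by (simp add: gauss_def atMost_Suc One_nat_def max.commute)

text \<open>Discs about \<open>a\<close> whose radius grows from 0 to infinity.\<close>

definition ray :: "'a \<Rightarrow> real \<Rightarrow> ('a poly \<Rightarrow> real) option" where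
  "ray a t = (if t = 1 then None else Some (disc_sem a (t / (1 - t))))"

lemma ray_in_space: "t \<in> {0..1} \<Longrightarrow> ray a t \<in> berk_space v"
  by (simp add: ray_def disc_sem_in_space del: Some_in_berk_space)

text \<open>Multiplying numerator and denominator by \<open>(1 - t) ^ n\<close> removes the pole of
  the radius at \<open>t = 1\<close>; the resulting formula is continuous on the whole interval and
  covers infinity.\<close>

lemma hev_ray:
  assumes t: "t \<in> {0..1}" and n: "degree P \<le> n"
  shows "hev (ray a t) n P = Max ((\<lambda>i. v (coeff (pcompose P [:a,1:]) i) * (t ^ i * (1 - t) ^ (n - i))) ` {..n})
       / max (1 - t) (max (v a * (1 - t)) t) ^ n"
proof (cases "t = 1")
  case True
  have top: "coeff (pcompose P [:a,1:]) n = coeff P n"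
  proof (cases "degree P = n")
    case True
    then have "coeff (pcompose P [:a,1:]) n = lead_coeff (pcompose P [:a,1:])" by (simp add: degree_shift)
    then show ?thesis using lead_coeff_comp[of "[:a,1:]" P] True by simp
  next
    case False
    then show ?thesis using n by (simp add: coeff_eq_0 degree_shift)
  qed
  have "Max ((\<lambda>i. v (coeff (pcompose P [:a,1:]) i) * (t ^ i * (1 - t) ^ (n - i))) ` {..n}) = v (coeff P n)"
  proof (rule Max_eqI)
    show "y \<le> v (coeff P n)" if "y \<in> (\<lambda>i. v (coeff (pcompose P [:a,1:]) i) * (t ^ i * (1 - t) ^ (n - i))) ` {..n}" for y
      using that top by (auto simp: True power_0_left)
    show "v (coeff P n) \<in> (\<lambda>i. v (coeff (pcompose P [:a,1:]) i) * (t ^ i * (1 - t) ^ (n - i))) ` {..n}"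
      by (rule image_eqI[of _ _ n]) (auto simp: True top)
  qed simp
  then show ?thesis by (simp add: True ray_def)
next
  case False
  define u where "u = 1 - t"
  have u: "0 < u" using t False by (auto simp: u_def)
  define r where "r = t / u"
  have r: "0 \<le> r" using t u by (simp add: r_def)
  have "(\<lambda>i. v (coeff (pcompose P [:a,1:]) i) * (t ^ i * u ^ (n - i))) ` {..n}
      = (\<lambda>y. y * u ^ n) ` ((\<lambda>i. v (coeff (pcompose P [:a,1:]) i) * r ^ i) ` {..n})"
    unfolding image_image
    by (intro image_cong refl) (use u in \<open>auto simp: r_def power_divide power_diff field_simps\<close>)
  then have "Max ((\<lambda>i. v (coeff (pcompose P [:a,1:]) i) * (t ^ i * u ^ (n - i))) ` {..n})
      = Max ((\<lambda>y. y * u ^ n) ` ((\<lambda>i. v (coeff (pcompose P [:a,1:]) i) * r ^ i) ` {..n}))"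
    by simp
  also have "\<dots> = gauss r n (pcompose P [:a,1:]) * u ^ n"
    unfolding gauss_def
    by (rule mono_Max_commute[symmetric]) (use u in \<open>auto simp: mono_def intro: mult_right_mono\<close>)
  finally have num: "Max ((\<lambda>i. v (coeff (pcompose P [:a,1:]) i) * (t ^ i * u ^ (n - i))) ` {..n})
      = disc_sem a r P * u ^ n"
    by (simp add: disc_sem_eq[OF r n])
  have "disc_sem a r [:0,1:] = max (v a) r"
    using gauss_lin[OF r, of a 1] disc_sem_eq[OF r, of "[:0,1:]" 1 a] by (simp add: pcompose_pCons)
  then have "max u (max (v a * u) t) = max 1 (disc_sem a r [:0,1:]) * u"
    using u by (simp add: r_def max_mult_distrib_right)
  then have "max u (max (v a * u) t) ^ n = max 1 (disc_sem a r [:0,1:]) ^ n * u ^ n"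
    by (simp add: power_mult_distrib)
  then show ?thesis
    unfolding u_def[symmetric] num using u False
    by (simp add: ray_def hev_Some r_def u_def)
qed

lemma pathin_ray: "pathin (berk_top v) (ray a)"
  unfolding pathin_def
proof (rule continuous_map_into_berk_top)
  show "ray a t \<in> berk_space v" if "t \<in> topspace (top_of_set {0..1})" for t
    using that by (simp add: ray_in_space)
  fix n and P :: "'a poly" assume n: "degree P \<le> n"
  have "continuous_on {0..1} (\<lambda>t. Max ((\<lambda>i. v (coeff (pcompose P [:a,1:]) i) * (t ^ i * (1 - t) ^ (n - i))) ` {..n})
       / max (1 - t) (max (v a * (1 - t)) t) ^ n)"
    by (intro continuous_on_divide continuous_on_Max_image continuous_intros)
       (auto simp: max_def)
  then have "continuous_on {0..1} (\<lambda>t. hev (ray a t) n P)"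
    by (rule continuous_on_eq) (simp add: hev_ray[OF _ n])
  then show "continuous_map (top_of_set {0..1}) euclideanreal (\<lambda>t. hev (ray a t) n P)"
    by simp
qed

lemma inj_on_ray: "inj_on (ray a) {0..1}"
proof (rule inj_onI)
  fix t t' :: real assume t: "t \<in> {0..1}" and t': "t' \<in> {0..1}" and eq: "ray a t = ray a t'"
  have rad: "disc_sem a r [:-a,1:] = r" if "0 \<le> r" for r
    using gauss_lin[OF that, of 0 1] disc_sem_eq[OF that, of "[:-a,1:]" 1 a] that
    by (simp add: pcompose_pCons)
  show "t = t'"
  proof (cases "t = 1 \<or> t' = 1")
    case True
    then show ?thesis using eq by (auto simp: ray_def split: if_splits)
  next
    case False
    then have "disc_sem a (t / (1 - t)) = disc_sem a (t' / (1 - t'))" using eq by (simp add: ray_def)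
    then have "t / (1 - t) = t' / (1 - t')"
      using rad t t' by (metis atLeastAtMost_iff diff_ge_0_iff_ge divide_nonneg_nonneg)
    then show ?thesis using False by (simp add: field_simps)
  qed
qed

text \<open>Segments consist of injective paths, so the segment from a point to itself is empty.
  Every classical point must therefore be exhibited as an end of a genuine arc, and
  \<open>ray\<close> is one.\<close>

lemma P1k_subset_conv: "P1k v \<subseteq> berk_conv_P1k v"
proof -
  have seg: "berk_pt v a \<in> berk_segment v (berk_pt v a) None" "None \<in> berk_segment v (berk_pt v a) None" for a
  proof -
    have ends: "ray a 0 = berk_pt v a" "ray a 1 = None"
      by (simp_all add: ray_def disc_sem_0)
    then have "ray a ` {0..1} \<subseteq> berk_segment v (berk_pt v a) None"
      unfolding berk_segment_def using pathin_ray inj_on_ray by blast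
    then show "berk_pt v a \<in> berk_segment v (berk_pt v a) None" "None \<in> berk_segment v (berk_pt v a) None"
      using ends by (metis atLeastAtMost_iff image_subset_iff order_refl zero_le_one)+
  qed
  have "berk_segment v (berk_pt v a) None \<subseteq> berk_conv_P1k v" for a
    unfolding berk_conv_P1k_def by (intro Union_upper CollectI exI conjI refl) (auto simp: P1k_def)
  then show ?thesis using seg by (auto simp: P1k_def)
qed

lemma closure_P1k_subset:
  assumes "F \<subseteq> P1k v"
  shows "berk_top v closure_of F \<subseteq> berk_H v \<union> P1k v"
  using closure_of_mono[OF order_trans[OF assms P1k_subset_conv], of "berk_top v"]
  by (auto simp: berk_H_def)

end

section \<open>Hyperbolic elements\<close>

definition mtr :: "'a::field mat2 \<Rightarrow> 'a" where
  "mtr g = (case g of (a,b,c,d) \<Rightarrow> a + d)"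

definition mscale :: "'a::field \<Rightarrow> 'a mat2 \<Rightarrow> 'a mat2" where
  "mscale t g = (case g of (a,b,c,d) \<Rightarrow> (t*a, t*b, t*c, t*d))"

text \<open>A pair \<open>(p, q)\<close> stands for the linear form \<open>p X + q Y\<close>; matrices act on such row vectors
  from the right.\<close>

definition rowact :: "'a::field \<times> 'a \<Rightarrow> 'a mat2 \<Rightarrow> 'a \<times> 'a" where
  "rowact l g = (case l of (p,q) \<Rightarrow> case g of (a,b,c,d) \<Rightarrow> (p*a + q*c, p*b + q*d))"

definition lin :: "'a::field \<times> 'a \<Rightarrow> 'a poly" where
  "lin l = [:snd l, fst l:]"

text \<open>Such a row is a linear form that \<open>g\<close> pulls back to a multiple of itself, so
  its zero is a fixed point.\<close>

definition left_eigen :: "'a::field mat2 \<Rightarrow> 'a \<times> 'a \<Rightarrow> 'a \<Rightarrow> bool" where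
  "left_eigen g l e \<longleftrightarrow> l \<noteq> (0,0) \<and> rowact l g = (e * fst l, e * snd l)"

primrec mpow :: "'a::field mat2 \<Rightarrow> nat \<Rightarrow> 'a mat2" where
  "mpow g 0 = mscal 1"
| "mpow g (Suc n) = mmult (mpow g n) g"

lemma rowact_mmult: "rowact l (mmult g h) = rowact (rowact l g) h"
  by (cases l; cases g; cases h) (simp add: rowact_def mmult_def algebra_simps)

lemma rowact_scale_left: "rowact (e * fst l, e * snd l) g = (e * fst (rowact l g), e * snd (rowact l g))"
  by (cases l; cases g) (simp add: rowact_def algebra_simps)

lemma mdet_mmult: "mdet (mmult g h) = mdet g * mdet h"
  by (cases g; cases h) (simp add: mdet_def mmult_def algebra_simps)

lemma mdet_mscal: "mdet (mscal t) = t * t"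
  by (simp add: mdet_def mscal_def)

lemma mdet_mscale: "mdet (mscale t g) = t * t * mdet g"
  by (cases g) (simp add: mdet_def mscale_def algebra_simps)

lemma mdet_minv:
  assumes "mdet g \<noteq> 0"
  shows "mdet (minv g) = 1 / mdet g"
proof -
  obtain a b c d where g: "g = (a,b,c,d)" by (cases g)
  define D where "D = a * d - b * c"
  have "minv g = (d/D, -b/D, -c/D, a/D)" by (simp add: g minv_def D_def Let_def)
  then have "mdet (minv g) = (a * d - b * c) / (D * D)"
    by (simp add: mdet_def diff_divide_distrib mult.commute)
  then show ?thesis using assms by (simp add: g mdet_def D_def[symmetric])
qed

lemma rowact_minv:
  assumes "mdet g \<noteq> 0"
  shows "rowact (rowact l (minv g)) g = l" "rowact (rowact l g) (minv g) = l"
proof -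
  obtain a b c d where g: "g = (a,b,c,d)" by (cases g)
  obtain p q where l: "l = (p,q)" by (cases l)
  define D where "D = a * d - b * c"
  have D: "D \<noteq> 0" using assms by (simp add: g mdet_def D_def)
  have inv: "minv (a,b,c,d) = (d/D, -b/D, -c/D, a/D)" by (simp add: minv_def D_def Let_def)
  have 1: "(p * (d/D) + q * (-c/D)) * a + (p * (-b/D) + q * (a/D)) * c = p * (D / D)"
    "(p * (d/D) + q * (-c/D)) * b + (p * (-b/D) + q * (a/D)) * d = q * (D / D)"
    "(p * a + q * c) * (d/D) + (p * b + q * d) * (-c/D) = p * (D / D)"
    "(p * a + q * c) * (-b/D) + (p * b + q * d) * (a/D) = q * (D / D)"
    using D by (simp_all add: D_def[symmetric] field_simps) (simp_all add: D_def algebra_simps)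
  show "rowact (rowact l (minv g)) g = l" "rowact (rowact l g) (minv g) = l"
    using 1 D by (simp_all add: inv l rowact_def g)
qed

lemma mtr_conj:
  assumes "mdet f \<noteq> 0"
  shows "mtr (mmult (mmult f g) (minv f)) = mtr g"
proof -
  obtain a b c d where f: "f = (a,b,c,d)" by (cases f)
  obtain p q r s where g: "g = (p,q,r,s)" by (cases g)
  define D where "D = a * d - b * c"
  have D: "D \<noteq> 0" using assms by (simp add: f mdet_def D_def)
  have inv: "minv f = (d/D, -b/D, -c/D, a/D)" by (simp add: f minv_def D_def Let_def)
  have "mtr (mmult (mmult f g) (minv f))
      = ((a * p + b * r) * d - (a * q + b * s) * c - (c * p + d * r) * b + (c * q + d * s) * a) / D"
    using D by (simp add: inv mtr_def mmult_def f[symmetric] g) (simp add: f mmult_def field_simps)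
  also have "(a * p + b * r) * d - (a * q + b * s) * c - (c * p + d * r) * b + (c * q + d * s) * a = (p + s) * D"
    by (simp add: D_def algebra_simps)
  finally show ?thesis using D by (simp add: g mtr_def)
qed

text \<open>With \<open>e' = mtr g - e\<close> the other root, Cayley-Hamilton gives
  \<open>(g - e') (g - e) = 0\<close>, so nonzero rows of \<open>g - e'\<close> are left
  eigenvectors for \<open>e\<close>. The cases use the second row, the first row, and a scalar
  matrix, where both rows vanish.\<close>

lemma left_eigen_exists:
  assumes "e * e - mtr g * e + mdet g = 0"
  shows "\<exists>l. left_eigen g l e"
proof -
  obtain a b c d where g: "g = (a,b,c,d)" by (cases g)
  have ch: "e * e - (a + d) * e + (a * d - b * c) = 0" using assms by (simp add: g mtr_def mdet_def)
  consider "c \<noteq> 0 \<or> e \<noteq> a" | "c = 0" "e = a" "a \<noteq> d \<or> b \<noteq> 0" | "c = 0" "e = a" "a = d" "b = 0" by blast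
  then show ?thesis
  proof cases
    case 1
    have "c * b + (e - a) * d = e * (e - a)" using ch by (simp add: algebra_simps)
    then have "left_eigen g (c, e - a) e"
      using 1 by (auto simp: left_eigen_def rowact_def g algebra_simps)
    then show ?thesis ..
  next
    case 2
    then have "left_eigen g (a - d, b) e"
      by (auto simp: left_eigen_def rowact_def g algebra_simps)
    then show ?thesis ..
  next
    case 3
    then have "left_eigen g (1, 0) e" by (auto simp: left_eigen_def rowact_def g)
    then show ?thesis ..
  qed
qed

lemma left_eigen_mpow:
  assumes "left_eigen g l e"
  shows "rowact l (mpow g n) = (e ^ n * fst l, e ^ n * snd l)"
proof (induction n)
  case 0
  then show ?case by (cases l) (simp add: rowact_def mscal_def)
next
  case (Suc n)
  have "rowact l (mpow g (Suc n)) = (e ^ n * fst (rowact l g), e ^ n * snd (rowact l g))"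
    by (simp only: mpow.simps rowact_mmult Suc rowact_scale_left)
  then show ?case
    using assms by (simp add: left_eigen_def mult_ac)
qed

lemma left_eigen_independent:
  assumes "left_eigen g (p,q) e" "left_eigen g (p',q') e'" "e \<noteq> e'"
  shows "mdet (p,q,p',q') \<noteq> 0"
proof
  assume "mdet (p,q,p',q') = 0"
  then have det: "p * q' = q * p'" by (simp add: mdet_def)
  obtain a b c d where g: "g = (a,b,c,d)" by (cases g)
  have E: "p * a + q * c = e * p" "p * b + q * d = e * q" "p' * a + q' * c = e' * p'" "p' * b + q' * d = e' * q'"
    and nz: "p \<noteq> 0 \<or> q \<noteq> 0" "p' \<noteq> 0 \<or> q' \<noteq> 0"
    using assms by (auto simp: left_eigen_def rowact_def g)
  have "(e - e') * (p * p') = (e * p) * p' - p * (e' * p')" by (simp add: algebra_simps)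
  also have "\<dots> = c * (q * p' - p * q')" unfolding E[symmetric] by (simp add: algebra_simps)
  finally have 1: "p * p' = 0" using det assms(3) by simp
  have "(e - e') * (q * q') = (e * q) * q' - q * (e' * q')" by (simp add: algebra_simps)
  also have "\<dots> = b * (p * q' - q * p')" unfolding E[symmetric] by (simp add: algebra_simps)
  finally have 2: "q * q' = 0" using det assms(3) by simp
  show False using 1 2 det nz by auto
qed

section \<open>Eigenforms, fixed points and contraction\<close>

context nonarch_valued
begin

lemma hev_act_row:
  assumes "x \<in> berk_space v" "mdet g \<noteq> 0"
  shows "hev (berk_act v g x) 1 (lin l) * cocycle g x = hev x 1 (lin (rowact l g))"
proof -
  obtain a b c d where g: "g = (a,b,c,d)" by (cases g)
  show ?thesis
    using hev_act_lin[OF assms(1), of a b c d "snd l" "fst l"] assms(2)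
    by (cases l) (simp add: g lin_def rowact_def)
qed

lemma hev_lin_scale:
  "x \<in> berk_space v \<Longrightarrow> hev x 1 (lin (e * p, e * q)) = v e * hev x 1 (lin (p, q))"
  using hev_smult[of x 1 e "[:q, p:]"] by (simp add: lin_def)

lemma lin_zero_unique:
  assumes "l \<noteq> (0,0)" "x \<in> berk_space v" "y \<in> berk_space v" "hev x 1 (lin l) = 0" "hev y 1 (lin l) = 0"
  shows "x = y"
  using linear_form_zero_unique[of "fst l" "snd l" x y] assms by (cases l) (auto simp: lin_def)

lemma left_eigen_act:
  assumes "x \<in> berk_space v" "mdet g \<noteq> 0" "left_eigen g l e"
  shows "hev (berk_act v g x) 1 (lin l) * cocycle g x = v e * hev x 1 (lin l)"
  using hev_act_row[OF assms(1,2), of l] assms hev_lin_scale[OF assms(1), of e "fst l" "snd l"]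
  by (simp add: left_eigen_def)

lemma left_eigen_zero_fixed:
  assumes x: "x \<in> berk_space v" and g: "mdet g \<noteq> 0" "left_eigen g l e" and 0: "hev x 1 (lin l) = 0"
  shows "berk_act v g x = x"
proof (rule lin_zero_unique[OF _ act_in_space[OF x] x _ 0])
  show "l \<noteq> (0,0)" using g by (simp add: left_eigen_def)
  show "hev (berk_act v g x) 1 (lin l) = 0"
    using left_eigen_act[OF x g] 0 cocycle_pos[OF x g(1)] by simp
qed

lemma hyperbolic_iff:
  assumes "mdet g \<noteq> 0"
  shows "hyperbolic v g \<longleftrightarrow> v (mdet g) < v (mtr g) ^ 2"
proof -
  have pos: "0 < sqrt (v (mdet g))" using assms by simp
  have "hyperbolic v g \<longleftrightarrow> sqrt (v (mdet g)) < v (mtr g)"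
    using pos by (cases g) (simp add: hyperbolic_def pgl_abs_tr_def mdet_def mtr_def pos_less_divide_eq)
  also have "\<dots> \<longleftrightarrow> v (mdet g) < v (mtr g) ^ 2"
    using real_sqrt_less_iff[of "v (mdet g)" "v (mtr g) ^ 2"] by simp
  finally show ?thesis .
qed

text \<open>An instance of Hensel's lemma: iterating \<open>u \<mapsto> \<delta> + u * u\<close>
  from 0 contracts differences by \<open>q = v \<delta>\<close> on the disc of radius
  \<open>q\<close>. No square root of a discriminant is taken, so residue characteristic 2 is no
  exception.\<close>

lemma small_quadratic_root:
  assumes complete: "complete_abs v" and \<delta>: "v \<delta> < 1"
  shows "\<exists>u. u * u - u + \<delta> = 0 \<and> v u < 1"
proof -
  define q where "q = v \<delta>"
  have q: "0 \<le> q" "q < 1" using \<delta> by (auto simp: q_def)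
  define f where "f = rec_nat 0 (\<lambda>_ u. \<delta> + u * u)"
  have f0: "f 0 = 0" and fS: "f (Suc n) = \<delta> + f n * f n" for n by (simp_all add: f_def)
  have fq: "v (f n) \<le> q" for n
  proof (induction n)
    case (Suc n)
    have "v (f n) * v (f n) \<le> q * 1" using Suc q by (intro mult_mono) auto
    then show ?case
      using v_add_le[of \<delta> "f n * f n"] by (simp add: fS v_mult q_def)
  qed (use q f0 in simp)
  have step: "v (f (Suc n) - f n) \<le> q ^ n" for n
  proof (induction n)
    case 0
    then show ?case using fq[of "Suc 0"] q f0 by simp
  next
    case (Suc n)
    have "f (Suc (Suc n)) - f (Suc n) = (f (Suc n) - f n) * (f (Suc n) + f n)"
      using fS[of "Suc n"] fS[of n] by (simp add: algebra_simps)
    then have "v (f (Suc (Suc n)) - f (Suc n)) = v (f (Suc n) - f n) * v (f (Suc n) + f n)"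
      by (simp add: v_mult)
    also have "\<dots> \<le> q ^ n * q"
      using Suc fq[of n] fq[of "Suc n"] v_add_le[of "f (Suc n)" "f n"] q
      by (intro mult_mono) auto
    finally show ?case by (simp add: mult.commute)
  qed
  have cauchy: "v (f (n + k) - f n) \<le> q ^ n" for n k
  proof (induction k)
    case (Suc k)
    have "v (f (Suc (n + k)) - f (n + k)) \<le> q ^ (n + k)" by (rule step)
    also have "\<dots> \<le> q ^ n" using q by (intro power_decreasing) auto
    finally show ?case
      using Suc v_add_le[of "f (Suc (n + k)) - f (n + k)" "f (n + k) - f n"] by simp
  qed (use q in simp)
  have "\<exists>N. \<forall>m\<ge>N. \<forall>n\<ge>N. v (f m - f n) < e" if e: "0 < e" for e
  proof -
    obtain N where N: "q ^ N < e" using real_arch_pow_inv[of e q] e q by auto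
    have "v (f m - f n) < e" if mn: "N \<le> m" "N \<le> n" for m n
    proof -
      have "v (f m - f N) \<le> q ^ N" "v (f n - f N) \<le> q ^ N"
        using cauchy[of N "m - N"] cauchy[of N "n - N"] mn by auto
      then show ?thesis using v_diff_le[of "f m - f N" "f n - f N"] N by simp
    qed
    then show ?thesis by blast
  qed
  then obtain l where l: "(\<lambda>n. v (f n - l)) \<longlonglongrightarrow> 0"
    using complete unfolding complete_abs_def by blast
  have l1: "v l < 1"
  proof -
    obtain n where "v (f n - l) < 1"
      using order_tendstoD(2)[OF l, of 1] by (auto simp: eventually_sequentially)
    then show ?thesis using v_diff_le[of "f n" "f n - l"] fq[of n] q by simp
  qed
  have "v (\<delta> + l * l - l) \<le> v (f n - l) + v (f (Suc n) - l)" for n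
  proof -
    have eq: "\<delta> + l * l - l = (f (Suc n) - l) - (f n - l) * (f n + l)"
      by (simp add: fS algebra_simps)
    have "v (f n + l) \<le> 1" using v_add_le[of "f n" l] fq[of n] l1 q by simp
    then have "v ((f n - l) * (f n + l)) \<le> v (f n - l)" by (simp add: v_mult mult_left_le)
    then show ?thesis
      unfolding eq using v_diff_le[of "f (Suc n) - l" "(f n - l) * (f n + l)"]
        v_nonneg[of "f n - l"] v_nonneg[of "f (Suc n) - l"] by linarith
  qed
  moreover have "(\<lambda>n. v (f n - l) + v (f (Suc n) - l)) \<longlonglongrightarrow> 0 + 0"
    by (intro tendsto_add l LIMSEQ_Suc[OF l])
  ultimately have "v (\<delta> + l * l - l) \<le> 0 + 0"
    by (intro LIMSEQ_le_const[of "\<lambda>n. v (f n - l) + v (f (Suc n) - l)"]) auto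
  then have "\<delta> + l * l - l = 0" using v_nonneg[of "\<delta> + l * l - l"] by (metis add_0 v_eq_0_iff antisym)
  then show ?thesis using l1 by (intro exI[of _ l]) (simp add: algebra_simps)
qed

text \<open>The eigenform \<open>l2\<close> of the smaller eigenvalue vanishes at the attracting fixed point, \<open>l1\<close> at the
  repelling one.\<close>

definition hyp_pair :: "'a mat2 \<Rightarrow> 'a \<times> 'a \<Rightarrow> 'a \<Rightarrow> 'a \<times> 'a \<Rightarrow> 'a \<Rightarrow> bool" where
  "hyp_pair g l1 e1 l2 e2 \<longleftrightarrow> left_eigen g l1 e1 \<and> left_eigen g l2 e2 \<and> v e2 < v e1 \<and> e2 \<noteq> 0 \<and>
     mdet g = e1 * e2"

lemma hyp_pair_nonzero:
  assumes "hyp_pair g l1 e1 l2 e2"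
  shows "e1 \<noteq> 0" "e2 \<noteq> 0" "mdet g \<noteq> 0"
proof -
  have "v e2 < v e1" using assms by (simp add: hyp_pair_def)
  then have "0 < v e1" by (rule le_less_trans[OF v_nonneg])
  then show "e1 \<noteq> 0" by simp
  then show "e2 \<noteq> 0" "mdet g \<noteq> 0" using assms by (auto simp: hyp_pair_def)
qed

text \<open>An eigenvalue written as \<open>T * u\<close> turns the characteristic equation into
  \<open>u * u - u + D / (T * T) = 0\<close>, and hyperbolicity says that
  \<open>v (D / (T * T)) < 1\<close>. The small root \<open>u\<close> yields the smaller eigenvalue;
  \<open>1 - u\<close>, of absolute value 1, yields the larger.\<close>

lemma hyperbolic_hyp_pair:
  assumes "complete_abs v" and det: "mdet g \<noteq> 0" and "hyperbolic v g"
  obtains l1 e1 l2 e2 where "hyp_pair g l1 e1 l2 e2"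
proof -
  define T where "T = mtr g"
  define D where "D = mdet g"
  have TD: "v D < v T ^ 2" using assms by (simp add: hyperbolic_iff T_def D_def)
  then have T0: "T \<noteq> 0" by (metis v_0 v_nonneg not_le zero_power2)
  have "v (D / (T * T)) < 1" using TD T0 by (simp add: v_divide v_mult power2_eq_square)
  then obtain u where u: "u * u - u + D / (T * T) = 0" "v u < 1"
    using small_quadratic_root[OF assms(1)] by blast
  have Du: "D = T * T * (u * (1 - u))"
  proof -
    have "D / (T * T) = u * (1 - u)" using u(1) by (simp add: algebra_simps)
    then show ?thesis using T0 by (simp add: divide_eq_eq mult.commute)
  qed
  have roots: "(T * u) * (T * u) - mtr g * (T * u) + mdet g = 0"
    "(T * (1 - u)) * (T * (1 - u)) - mtr g * (T * (1 - u)) + mdet g = 0"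
    unfolding T_def[symmetric] D_def[symmetric] Du by (simp_all add: algebra_simps)
  obtain l1 where l1: "left_eigen g l1 (T * (1 - u))" using left_eigen_exists[OF roots(2)] by blast
  obtain l2 where l2: "left_eigen g l2 (T * u)" using left_eigen_exists[OF roots(1)] by blast
  have "v (1 - u) = 1" using v_add_eq_left[of "- u" 1] u(2) by simp
  then have "v (T * u) < v (T * (1 - u))" using u(2) T0 by (simp add: v_mult)
  moreover have "u \<noteq> 0" using Du det by (auto simp: D_def)
  moreover have "mdet g = T * (1 - u) * (T * u)" using Du by (simp add: D_def mult_ac)
  ultimately have "hyp_pair g l1 (T * (1 - u)) l2 (T * u)"
    unfolding hyp_pair_def using l1 l2 T0 by simp
  then show thesis by (rule that)
qed

lemma hyp_pair_minv:
  assumes "hyp_pair g l1 e1 l2 e2"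
  shows "hyp_pair (minv g) l2 (1 / e2) l1 (1 / e1)"
proof -
  have det: "mdet g \<noteq> 0" using assms by (rule hyp_pair_nonzero)
  have e: "e1 \<noteq> 0" "e2 \<noteq> 0" "v e2 < v e1" "mdet g = e1 * e2" using assms hyp_pair_nonzero[OF assms] by (auto simp: hyp_pair_def)
  have "left_eigen (minv g) l (1 / e)" if "left_eigen g l e" "e \<noteq> 0" for l e
  proof -
    have "rowact l (minv g) = rowact (1 / e * fst (rowact l g), 1 / e * snd (rowact l g)) (minv g)"
      using that by (simp add: left_eigen_def)
    also have "\<dots> = (1 / e * fst l, 1 / e * snd l)"
      unfolding rowact_scale_left rowact_minv(2)[OF det] ..
    finally show ?thesis using that by (simp add: left_eigen_def)
  qed
  moreover have "v (1 / e1) < v (1 / e2)"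
    using e by (simp add: v_divide frac_less2)
  ultimately show ?thesis
    using assms e by (auto simp: hyp_pair_def mdet_minv[OF det])
qed

text \<open>A linear form over \<open>k\<close> has a classical zero, and its zero on the Berkovich
  line is unique.\<close>

lemma lin_zero_in_P1k:
  assumes "l \<noteq> (0,0)" "x \<in> berk_space v" "hev x 1 (lin l) = 0"
  shows "x \<in> P1k v"
proof -
  have "fst l \<noteq> 0 \<or> snd l \<noteq> 0" using assms(1) by (cases l) auto
  then obtain z where z: "z \<in> P1k v" "hev z 1 (lin l) = 0"
    unfolding lin_def by (rule linear_form_zero_exists)
  then have "x = z" using assms P1k_subset_space by (intro lin_zero_unique[OF assms(1)]) auto
  then show ?thesis using z by simp
qed

lemma hyp_pair_nz: "hyp_pair g l1 e1 l2 e2 \<Longrightarrow> l1 \<noteq> (0,0) \<and> l2 \<noteq> (0,0)"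
  by (auto simp: hyp_pair_def left_eigen_def)

text \<open>Eigenforms for different eigenvalues are the rows of an invertible matrix, whose cocycle
  is positive.\<close>

lemma hyp_pair_disjoint:
  assumes "hyp_pair g l1 e1 l2 e2" "x \<in> berk_space v"
  shows "hev x 1 (lin l1) \<noteq> 0 \<or> hev x 1 (lin l2) \<noteq> 0"
proof -
  have "mdet (fst l1, snd l1, fst l2, snd l2) \<noteq> 0"
    using assms left_eigen_independent[of g "fst l1" "snd l1" e1 "fst l2" "snd l2" e2]
    by (auto simp: hyp_pair_def)
  from cocycle_pos[OF assms(2) this] show ?thesis by (cases l1; cases l2) (auto simp: cocycle_def lin_def)
qed

text \<open>If neither eigenform vanished at a fixed point, the cocycle there would equal both
  \<open>v e1\<close> and \<open>v e2\<close>.\<close>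

lemma hyp_pair_fixed:
  assumes h: "hyp_pair g l1 e1 l2 e2" and x: "x \<in> berk_space v" and fix_x: "berk_act v g x = x"
  shows "hev x 1 (lin l1) = 0 \<or> hev x 1 (lin l2) = 0"
proof (rule ccontr)
  assume ne: "\<not> ?thesis"
  have "hev x 1 (lin l1) * cocycle g x = v e1 * hev x 1 (lin l1)"
    "hev x 1 (lin l2) * cocycle g x = v e2 * hev x 1 (lin l2)"
    using left_eigen_act[OF x hyp_pair_nonzero(3)[OF h]] h fix_x by (metis hyp_pair_def)+
  then have "cocycle g x = v e1" "cocycle g x = v e2" using ne by auto
  then show False using h by (simp add: hyp_pair_def)
qed

text \<open>The ratio of the values of \<open>l2\<close> and \<open>l1\<close> does not involve the
  cocycle and is multiplied by \<open>v e2 / v e1\<close> by each factor \<open>g\<close>. For the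
  norm, the pullback of \<open>l1\<close> has size proportional to \<open>v e1 ^ n\<close>, which
  exceeds the square root of the determinant by a growing factor.\<close>

lemma hyp_pair_attracts:
  assumes h: "hyp_pair g l1 e1 l2 e2" and f: "mdet f \<noteq> 0" and x: "x \<in> berk_space v"
    and ne: "hev (berk_act v f x) 1 (lin l1) \<noteq> 0"
  shows "(\<lambda>n. hev (berk_act v (mmult (mpow g n) f) x) 1 (lin l2)) \<longlonglongrightarrow> 0"
    and "filterlim (\<lambda>n. pgl_norm v (mmult (mpow g n) f)) at_top sequentially"
proof -
  define k where "k n = mmult (mpow g n) f" for n
  define y where "y n = berk_act v (k n) x" for n
  have e: "e1 \<noteq> 0" "e2 \<noteq> 0" "v e2 < v e1" "mdet g = e1 * e2" using h hyp_pair_nonzero[OF h] by (auto simp: hyp_pair_def)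
  have eig: "left_eigen g l1 e1" "left_eigen g l2 e2" using h by (auto simp: hyp_pair_def)
  have det_pow: "mdet (mpow g n) = (e1 * e2) ^ n" for n
    by (induction n) (simp_all add: mdet_mscal mdet_mmult e)
  have det_k: "mdet (k n) = (e1 * e2) ^ n * mdet f" for n by (simp add: k_def mdet_mmult det_pow)
  have det_k0: "mdet (k n) \<noteq> 0" for n using e f by (simp add: det_k)
  have row: "rowact l (k n) = (e ^ n * fst (rowact l f), e ^ n * snd (rowact l f))" if "left_eigen g l e" for l e n
    by (simp add: k_def rowact_mmult left_eigen_mpow[OF that] rowact_scale_left)
  define A1 where "A1 = hev x 1 (lin (rowact l1 f))"
  define A2 where "A2 = hev x 1 (lin (rowact l2 f))"
  have A1: "0 < A1"
  proof -
    have "A1 = hev (berk_act v f x) 1 (lin l1) * cocycle f x" unfolding A1_def by (rule hev_act_row[OF x f, symmetric])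
    then show ?thesis using ne hev_nonneg[OF act_in_space[OF x], of f 1 "lin l1"] cocycle_pos[OF x f]
      by (metis less_le mult_pos_pos)
  qed
  have y1: "hev (y n) 1 (lin l1) * cocycle (k n) x = v e1 ^ n * A1" for n
    unfolding y_def hev_act_row[OF x det_k0] row[OF eig(1)] hev_lin_scale[OF x] by (simp add: A1_def v_power)
  have y2: "hev (y n) 1 (lin l2) * cocycle (k n) x = v e2 ^ n * A2" for n
    unfolding y_def hev_act_row[OF x det_k0] row[OF eig(2)] hev_lin_scale[OF x] by (simp add: A2_def v_power)
  define M where "M = max (v (fst l1)) (v (snd l1))"
  have y_le: "hev (y n) 1 (lin l1) \<le> M" for n
    unfolding M_def lin_def y_def by (rule hev_lin_le[OF act_in_space[OF x]])
  define q where "q = v e2 / v e1"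
  have q: "0 < q" "q < 1" using e by (auto simp: q_def)
  have bound: "hev (y n) 1 (lin l2) \<le> q ^ n * (A2 / A1 * M)" for n
  proof -
    define C where "C = cocycle (k n) x"
    have C: "0 < C" unfolding C_def by (rule cocycle_pos[OF x det_k0])
    have "hev (y n) 1 (lin l2) * (v e1 ^ n * A1) = hev (y n) 1 (lin l2) * C * hev (y n) 1 (lin l1)"
      using y1[of n] by (simp add: C_def mult_ac)
    also have "\<dots> = v e2 ^ n * A2 * hev (y n) 1 (lin l1)" using y2[of n] by (simp add: C_def)
    finally have "hev (y n) 1 (lin l2) = q ^ n * (A2 / A1 * hev (y n) 1 (lin l1))"
      using A1 e by (simp add: q_def power_divide field_simps)
    also have "\<dots> \<le> q ^ n * (A2 / A1 * M)"
      using q A1 y_le[of n] by (intro mult_left_mono) (auto simp: A2_def hev_nonneg[OF x])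
    finally show ?thesis .
  qed
  have "(\<lambda>n. q ^ n * (A2 / A1 * M)) \<longlonglongrightarrow> 0 * (A2 / A1 * M)"
    using q by (intro tendsto_mult LIMSEQ_power_zero tendsto_const) auto
  then have lim0: "(\<lambda>n. q ^ n * (A2 / A1 * M)) \<longlonglongrightarrow> 0" by simp
  have "(\<lambda>n. hev (y n) 1 (lin l2)) \<longlonglongrightarrow> 0"
  proof (rule tendsto_sandwich[OF _ _ tendsto_const lim0])
    show "eventually (\<lambda>n. 0 \<le> hev (y n) 1 (lin l2)) sequentially"
      by (simp add: y_def hev_nonneg[OF act_in_space[OF x]])
    show "eventually (\<lambda>n. hev (y n) 1 (lin l2) \<le> q ^ n * (A2 / A1 * M)) sequentially"
      by (intro always_eventually allI bound)
  qed
  then show "(\<lambda>n. hev (berk_act v (mmult (mpow g n) f) x) 1 (lin l2)) \<longlonglongrightarrow> 0"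
    by (simp add: y_def k_def)
  define N where "N = max (v (fst (rowact l1 f))) (v (snd (rowact l1 f)))"
  have N: "0 < N" using A1 hev_lin_le[OF x, of "snd (rowact l1 f)" "fst (rowact l1 f)"]
    by (simp add: A1_def N_def lin_def)
  have M: "0 < M" using eig(1) by (cases l1) (auto simp: M_def left_eigen_def less_max_iff_disj)
  \<comment> \<open>The row \<open>l1\<close> times a matrix is bounded by the largest entry; read
    backwards, this bounds the largest entry from below.\<close>
  have entry: "v e1 ^ n * N \<le> M * entry_max (k n)" for n
  proof -
    obtain a b c d where kn: "k n = (a,b,c,d)" by (cases "k n")
    have E: "v a \<le> entry_max (k n)" "v b \<le> entry_max (k n)" "v c \<le> entry_max (k n)" "v d \<le> entry_max (k n)"
      by (auto simp: kn entry_max_def)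
    have *: "v (fst l1 * s + snd l1 * t) \<le> M * entry_max (k n)" if "v s \<le> entry_max (k n)" "v t \<le> entry_max (k n)" for s t
    proof -
      have "v (fst l1 * s) \<le> M * entry_max (k n)" "v (snd l1 * t) \<le> M * entry_max (k n)"
        unfolding v_mult using that M by (auto intro!: mult_mono simp: M_def)
      then show ?thesis using v_add_le[of "fst l1 * s" "snd l1 * t"] by linarith
    qed
    have "(e1 ^ n * fst (rowact l1 f), e1 ^ n * snd (rowact l1 f)) = (fst l1 * a + snd l1 * c, fst l1 * b + snd l1 * d)"
      using row[OF eig(1), of n] by (cases l1) (simp add: kn rowact_def)
    then have "v (e1 ^ n * fst (rowact l1 f)) \<le> M * entry_max (k n)" "v (e1 ^ n * snd (rowact l1 f)) \<le> M * entry_max (k n)"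
      using *[OF E(1,3)] *[OF E(2,4)] by simp_all
    then show ?thesis by (simp add: N_def v_mult v_power max_def)
  qed
  \<comment> \<open>\<open>Q ^ n\<close> is \<open>v e1 ^ n\<close> divided by the square root of
    \<open>v ((e1 * e2) ^ n)\<close>; \<open>B\<close> collects the contributions of
    \<open>f\<close> and \<open>l1\<close>.\<close>
  define Q where "Q = sqrt (v e1 / v e2)"
  define B where "B = N / M / sqrt (v (mdet f))"
  have Q: "1 < Q" using e by (simp add: Q_def)
  have B: "0 < B" using N M f by (simp add: B_def)
  have "B * Q ^ n \<le> pgl_norm v (k n)" for n
  proof -
    have "Q * sqrt (v (e1 * e2)) = v e1"
      using e by (simp add: Q_def v_mult flip: real_sqrt_mult)
    then have "Q ^ n * sqrt (v (e1 * e2)) ^ n = v e1 ^ n" by (metis power_mult_distrib)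
    then have Qn: "Q ^ n * sqrt (v ((e1 * e2) ^ n)) = v e1 ^ n" by (simp add: v_power real_sqrt_power)
    have s: "0 < sqrt (v (mdet (k n)))" using det_k0 by simp
    have sq: "sqrt (v (mdet (k n))) = sqrt (v ((e1 * e2) ^ n)) * sqrt (v (mdet f))"
      by (simp add: det_k v_mult real_sqrt_mult)
    have "B * Q ^ n * sqrt (v (mdet (k n))) = v e1 ^ n * N / M"
      unfolding sq B_def using f by (simp add: Qn[symmetric])
    also have "\<dots> \<le> entry_max (k n)" using entry[of n] M by (simp add: divide_le_eq mult.commute)
    finally show ?thesis unfolding pgl_norm_eq using s by (simp add: pos_le_divide_eq)
  qed
  moreover have "filterlim (\<lambda>n. Q ^ n) at_top sequentially"
    using filterlim_at_infinity_imp_norm_at_top[OF filterlim_realpow_sequentially_gt1[of Q]] Q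
    by (simp add: norm_power)
  then have "filterlim (\<lambda>n. B * Q ^ n) at_top sequentially"
    by (rule filterlim_tendsto_pos_mult_at_top[OF tendsto_const B])
  ultimately show "filterlim (\<lambda>n. pgl_norm v (mmult (mpow g n) f)) at_top sequentially"
    unfolding k_def by (auto intro: filterlim_at_top_mono)
qed

end

section \<open>The limit set\<close>

primrec word_level :: "'a::field mat2 set \<Rightarrow> nat \<Rightarrow> 'a mat2 set" where
  "word_level S 0 = insert (mscal 1) S"
| "word_level S (Suc n) = word_level S n \<union>
     (\<lambda>(g, h). mmult g h) ` (word_level S n \<times> word_level S n) \<union> minv ` word_level S n"

lemma countable_word_level: "countable S \<Longrightarrow> countable (word_level S n)"
  by (induction n) auto

lemma word_level_mono: "m \<le> n \<Longrightarrow> word_level S m \<subseteq> word_level S n"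
  by (induction n) (auto simp: le_Suc_eq)

lemma mmult_mscale: "mmult (mscale s g) (mscale t h) = mscale (s * t) (mmult g h)"
  by (cases g; cases h) (simp add: mmult_def mscale_def algebra_simps)

lemma minv_mscale: "t \<noteq> 0 \<Longrightarrow> minv (mscale t g) = mscale (1 / t) (minv g)"
proof -
  assume t: "t \<noteq> 0"
  obtain a b c d where g: "g = (a,b,c,d)" by (cases g)
  define D where "D = a * d - b * c"
  have "t * a * (t * d) - t * b * (t * c) = t * (t * D)" by (simp add: D_def algebra_simps)
  then show ?thesis using t by (simp add: g minv_def mscale_def Let_def flip: D_def)
qed

text \<open>All scalar matrices lie in \<open>pgl_gen S\<close>, which can make it uncountable.
  Scalars pass through products and inverses, so words in the generators suffice up to a
  scalar.\<close>

lemma pgl_gen_projectively_countable: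
  assumes "g \<in> pgl_gen S"
  shows "\<exists>h\<in>(\<Union>n. word_level S n). \<exists>t. t \<noteq> 0 \<and> g = mscale t h"
  using assms
proof induction
  case (gen g)
  have "g \<in> word_level S 0" "g = mscale 1 g"
    using gen by (cases g; simp add: mscale_def)+
  then show ?case using one_neq_zero by blast
next
  case (scal t)
  have "mscal 1 \<in> word_level S 0" "mscal t = mscale t (mscal 1)"
    by (simp_all add: mscale_def mscal_def)
  then show ?case using scal by blast
next
  case (mult g g')
  then obtain m n h h' t t' where h: "h \<in> word_level S m" "t \<noteq> 0" "g = mscale t h"
    and h': "h' \<in> word_level S n" "t' \<noteq> 0" "g' = mscale t' h'" by blast
  have "h \<in> word_level S (max m n)" "h' \<in> word_level S (max m n)"
    using h h' word_level_mono[of m "max m n" S] word_level_mono[of n "max m n" S] by auto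
  then have "mmult h h' \<in> word_level S (Suc (max m n))" by force
  moreover have "mmult g g' = mscale (t * t') (mmult h h')" "t * t' \<noteq> 0"
    using h h' by (simp_all add: mmult_mscale)
  ultimately show ?case by blast
next
  case (inv g)
  then obtain n h t where h: "h \<in> word_level S n" "t \<noteq> 0" "g = mscale t h" by blast
  have "minv h \<in> word_level S (Suc n)" using h by simp
  moreover have "minv g = mscale (1 / t) (minv h)" "1 / t \<noteq> 0" using h by (simp_all add: minv_mscale)
  ultimately show ?case by blast
qed

text \<open>\<open>X\<close> need not be first countable; the sequence is found inside the
  metrizable closure and converges in \<open>X\<close> as well.\<close>

lemma metrizable_closure_sequence:
  assumes met: "metrizable_space (subtopology X (X closure_of F))" and F: "F \<subseteq> topspace X"
    and y: "y \<in> X closure_of F"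
  obtains \<sigma> :: "nat \<Rightarrow> 'b" where "\<And>n. \<sigma> n \<in> F" "limitin X \<sigma> y sequentially"
proof -
  define Y where "Y = subtopology X (X closure_of F)"
  obtain M d where "Metric_space M d" and Y: "Y = Metric_space.mtopology M d"
    using met by (auto simp: metrizable_space_def Y_def)
  interpret Metric_space M d by fact
  have FL: "F \<subseteq> X closure_of F" using F by (rule closure_of_subset)
  have "Y closure_of F = X closure_of F"
    unfolding Y_def by (simp add: closure_of_subtopology_subset FL closure_of_subtopology Int_absorb1)
  then have "y \<in> mtopology closure_of F" using y Y by simp
  then obtain \<sigma> where \<sigma>: "range \<sigma> \<subseteq> F \<inter> M" "limitin mtopology \<sigma> y sequentially"
    unfolding closure_of_sequentially by blast
  have "limitin X \<sigma> y sequentially"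
    using \<sigma>(2) unfolding Y[symmetric] Y_def by (simp add: limitin_subtopology)
  then show thesis using \<sigma>(1) by (intro that[of \<sigma>]) auto
qed

section \<open>Hyperbolic fixed points of a non-elementary group\<close>

locale nonelementary_group = nonarch_valued v for v :: "'a::field \<Rightarrow> real" +
  fixes G :: "'a mat2 set"
  assumes complete: "complete_abs v" and subgroup: "pgl_subgroup G"
    and fin_gen: "pgl_fin_gen G" and non_elem: "non_elementary v G"
begin

lemma G_det: "g \<in> G \<Longrightarrow> mdet g \<noteq> 0"
  and G_scal: "t \<noteq> 0 \<Longrightarrow> mscal t \<in> G"
  and G_mult: "g \<in> G \<Longrightarrow> h \<in> G \<Longrightarrow> mmult g h \<in> G"
  and G_inv: "g \<in> G \<Longrightarrow> minv g \<in> G"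
  using subgroup by (simp_all add: pgl_subgroup_def)

lemma G_mpow: "g \<in> G \<Longrightarrow> mpow g n \<in> G"
  by (induction n) (auto intro: G_mult G_scal)

abbreviation fixpts where "fixpts \<equiv> hyp_fixed_points v G"

lemma fixpts_iff: "x \<in> fixpts \<longleftrightarrow> x \<in> berk_space v \<and> (\<exists>g\<in>G. hyperbolic v g \<and> berk_act v g x = x)"
  by (auto simp: hyp_fixed_points_def)

text \<open>Inversion exchanges the two eigenforms, so every hyperbolic fixed point is attracting
  for some element.\<close>

lemma fixpts_hyp_pair:
  assumes "x \<in> fixpts"
  obtains g l1 e1 l2 e2 where "g \<in> G" "hyp_pair g l1 e1 l2 e2" "hev x 1 (lin l2) = 0"
proof -
  obtain g where g: "x \<in> berk_space v" "g \<in> G" "hyperbolic v g" "berk_act v g x = x"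
    using assms by (auto simp: fixpts_iff)
  obtain l1 e1 l2 e2 where h: "hyp_pair g l1 e1 l2 e2"
    using hyperbolic_hyp_pair[OF complete G_det[OF g(2)] g(3)] .
  from hyp_pair_fixed[OF h g(1,4)] show thesis
  proof
    assume "hev x 1 (lin l1) = 0"
    then show thesis using that[OF G_inv[OF g(2)] hyp_pair_minv[OF h]] by blast
  next
    assume "hev x 1 (lin l2) = 0"
    then show thesis using that[OF g(2) h] by blast
  qed
qed

lemma fixpts_subset_P1k: "fixpts \<subseteq> P1k v"
proof
  fix x assume x: "x \<in> fixpts"
  then obtain g l1 e1 l2 e2 where "hyp_pair g l1 e1 l2 e2" "hev x 1 (lin l2) = 0"
    using fixpts_hyp_pair by metis
  then show "x \<in> P1k v"
    using lin_zero_in_P1k hyp_pair_nz x by (metis fixpts_iff)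
qed

lemma fixpts_subset_space: "fixpts \<subseteq> berk_space v"
  by (auto simp: fixpts_iff)

lemma countable_fixpts: "countable fixpts"
proof -
  obtain S where S: "finite S" "G = pgl_gen S" using fin_gen by (auto simp: pgl_fin_gen_def)
  \<comment> \<open>The words are built from all of \<open>S\<close>, possibly with singular
    matrices, whence the condition on the determinant.\<close>
  define C where "C = {h \<in> (\<Union>n. word_level S n). mdet h \<noteq> 0 \<and> hyperbolic v h}"
  have "countable (\<Union>n. word_level S n)"
    using countable_finite[OF S(1)] by (intro countable_UN countable_word_level) auto
  moreover have "C \<subseteq> (\<Union>n. word_level S n)" by (auto simp: C_def)
  ultimately have countable_C: "countable C" by (rule countable_subset[rotated])
  have countable_fix: "countable {x \<in> berk_space v. berk_act v h x = x}" if "h \<in> C" for h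
  proof -
    obtain l1 e1 l2 e2 where h: "hyp_pair h l1 e1 l2 e2"
      using hyperbolic_hyp_pair[OF complete] \<open>h \<in> C\<close> unfolding C_def by blast
    have at_most_one: "countable {x \<in> berk_space v. hev x 1 (lin l) = 0}" if "l \<noteq> (0,0)" for l
    proof (cases "\<exists>z\<in>berk_space v. hev z 1 (lin l) = 0")
      case True
      then obtain z where "z \<in> berk_space v" "hev z 1 (lin l) = 0" by blast
      then have "{x \<in> berk_space v. hev x 1 (lin l) = 0} \<subseteq> {z}" using lin_zero_unique[OF that] by blast
      then show ?thesis by (rule countable_subset) simp
    next
      case False
      then have none: "{x \<in> berk_space v. hev x 1 (lin l) = 0} = {}" by blast
      show ?thesis unfolding none by simp
    qed
    have "{x \<in> berk_space v. berk_act v h x = x}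
        \<subseteq> {x \<in> berk_space v. hev x 1 (lin l1) = 0} \<union> {x \<in> berk_space v. hev x 1 (lin l2) = 0}"
      using hyp_pair_fixed[OF h] by blast
    then show ?thesis
      by (rule countable_subset) (use at_most_one hyp_pair_nz[OF h] in simp)
  qed
  have "fixpts \<subseteq> (\<Union>h\<in>C. {x \<in> berk_space v. berk_act v h x = x})"
  proof
    fix x assume "x \<in> fixpts"
    then obtain g where g: "x \<in> berk_space v" "g \<in> G" "hyperbolic v g" "berk_act v g x = x"
      by (auto simp: fixpts_iff)
    obtain h t where h: "h \<in> (\<Union>n. word_level S n)" "t \<noteq> 0" "g = mscale t h"
      using pgl_gen_projectively_countable g(2) S(2) by blast
    have det: "mdet h \<noteq> 0" using G_det[OF g(2)] h by (auto simp: mdet_mscale)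
    have tr: "mtr g = t * mtr h" by (cases h) (simp add: h(3) mscale_def mtr_def algebra_simps)
    have "v t * v t * v (mdet h) < v t * v t * v (mtr h) ^ 2"
      using g(3) unfolding hyperbolic_iff[OF G_det[OF g(2)]] tr
      by (simp add: h(3) mdet_mscale v_mult power2_eq_square mult_ac)
    moreover have "0 < v t * v t" using h(2) by simp
    ultimately have "hyperbolic v h" unfolding hyperbolic_iff[OF det] by (simp only: mult_less_cancel_left_pos)
    moreover have "berk_act v h x = x"
      using act_scale[OF g(1) h(2)] det g(4) by (cases h) (auto simp: h(3) mscale_def)
    moreover have "h \<in> C" using h(1) det \<open>hyperbolic v h\<close> unfolding C_def by blast
    ultimately show "x \<in> (\<Union>h\<in>C. {x \<in> berk_space v. berk_act v h x = x})"
      using g(1) by blast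
  qed
  then show ?thesis by (rule countable_subset[OF _ countable_UN[OF countable_C countable_fix]])
qed

lemma two_fixpts:
  obtains x y where "x \<in> fixpts" "y \<in> fixpts" "x \<noteq> y"
proof -
  obtain g where g: "g \<in> G" "hyperbolic v g" using non_elem by (auto simp: non_elementary_def)
  obtain l1 e1 l2 e2 where h: "hyp_pair g l1 e1 l2 e2"
    using hyperbolic_hyp_pair[OF complete G_det[OF g(1)] g(2)] .
  have "\<exists>x\<in>fixpts. hev x 1 (lin l) = 0" if l: "left_eigen g l e" for l e
  proof -
    have "fst l \<noteq> 0 \<or> snd l \<noteq> 0" using l by (cases l) (auto simp: left_eigen_def)
    then obtain z where z: "z \<in> P1k v" "hev z 1 (lin l) = 0"
      unfolding lin_def by (rule linear_form_zero_exists)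
    then have "z \<in> berk_space v" using P1k_subset_space by auto
    then have "z \<in> fixpts" using left_eigen_zero_fixed[OF _ G_det[OF g(1)] l z(2)] g by (auto simp: fixpts_iff)
    then show ?thesis using z by blast
  qed
  then obtain x y where "x \<in> fixpts" "hev x 1 (lin l1) = 0" "y \<in> fixpts" "hev y 1 (lin l2) = 0"
    using h by (metis hyp_pair_def)
  then show thesis using that[of x y] hyp_pair_disjoint[OF h, of x] by (auto simp: fixpts_iff)
qed

text \<open>The image is fixed by the conjugate of \<open>g\<close> by \<open>f\<close>, which has
  the trace and the determinant of \<open>g\<close>. Its eigenform is that of \<open>g\<close> moved
  by the inverse of \<open>f\<close>.\<close>

lemma fixpts_invariant:
  assumes x: "x \<in> fixpts" and f: "f \<in> G"
  shows "berk_act v f x \<in> fixpts"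
proof -
  obtain g where g: "x \<in> berk_space v" "g \<in> G" "hyperbolic v g" "berk_act v g x = x"
    using x by (auto simp: fixpts_iff)
  obtain l1 e1 l2 e2 where h: "hyp_pair g l1 e1 l2 e2"
    using hyperbolic_hyp_pair[OF complete G_det[OF g(2)] g(3)] .
  obtain l e where l: "left_eigen g l e" "hev x 1 (lin l) = 0"
    using hyp_pair_fixed[OF h g(1,4)] h unfolding hyp_pair_def by metis
  define k where "k = mmult (mmult f g) (minv f)"
  define l' where "l' = rowact l (minv f)"
  note det_f = G_det[OF f]
  have kG: "k \<in> G" using f g by (simp add: k_def G_mult G_inv)
  have "mdet k = mdet g" using det_f by (simp add: k_def mdet_mmult mdet_minv)
  moreover have "mtr k = mtr g" unfolding k_def by (rule mtr_conj[OF det_f])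
  ultimately have hk: "hyperbolic v k"
    using g(3) hyperbolic_iff[OF G_det[OF kG]] hyperbolic_iff[OF G_det[OF g(2)]] by simp
  have l'f: "rowact l' f = l" by (simp add: l'_def rowact_minv[OF det_f])
  have "rowact l' k = (e * fst l', e * snd l')"
    using l(1) unfolding k_def rowact_mmult l'f by (simp add: left_eigen_def rowact_scale_left l'_def)
  moreover have "l' \<noteq> (0,0)"
    using l(1) l'f by (cases f) (auto simp: left_eigen_def rowact_def)
  ultimately have l': "left_eigen k l' e" by (simp add: left_eigen_def)
  have y: "berk_act v f x \<in> berk_space v" by (rule act_in_space[OF g(1)])
  have "hev (berk_act v f x) 1 (lin l') * cocycle f x = 0"
    unfolding hev_act_row[OF g(1) det_f] l'f by (rule l(2))
  then have "hev (berk_act v f x) 1 (lin l') = 0" using cocycle_pos[OF g(1) det_f] by simp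
  then show ?thesis
    using left_eigen_zero_fixed[OF y G_det[OF kG] l'] kG hk y by (auto simp: fixpts_iff)
qed

text \<open>The form depends on \<open>x\<close> alone, while \<open>y\<close> is any point of the
  Berkovich line.\<close>

lemma fixpts_attract:
  assumes "x \<in> fixpts"
  obtains a b where "max (v a) (v b) = 1" "hev x 1 [:b,a:] = 0"
    "\<And>y \<epsilon> N. y \<in> berk_space v \<Longrightarrow> 0 < \<epsilon> \<Longrightarrow>
       \<exists>h\<in>G. hev (berk_act v h y) 1 [:b,a:] < \<epsilon> \<and> N < pgl_norm v h"
proof -
  obtain g l1 e1 l2 e2 where g: "g \<in> G" and h: "hyp_pair g l1 e1 l2 e2" and 0: "hev x 1 (lin l2) = 0"
    using fixpts_hyp_pair[OF assms] .
  have x: "x \<in> berk_space v" using assms fixpts_subset_space by auto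
  have "fst l2 \<noteq> 0 \<or> snd l2 \<noteq> 0" using hyp_pair_nz[OF h] by (cases l2) auto
  then obtain t where t: "t \<noteq> 0" "max (v (fst l2 / t)) (v (snd l2 / t)) = 1"
    using normalise_linear_form by metis
  have attr: "\<exists>h\<in>G. hev (berk_act v h y) 1 [:snd l2 / t, fst l2 / t:] < \<epsilon> \<and> N < pgl_norm v h"
    if y: "y \<in> berk_space v" and \<epsilon>: "0 < \<epsilon>" for y \<epsilon> N
  proof -
    \<comment> \<open>Some translate of \<open>y\<close> leaves the repelling fixed point. Otherwise
      \<open>y\<close> itself would be that classical point and its orbit a single point, against
      non-elementarity.\<close>
    have "\<exists>f\<in>G. hev (berk_act v f y) 1 (lin l1) \<noteq> 0"
    proof (rule ccontr)
      assume contra: "\<not> ?thesis"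
      then have zero: "hev (berk_act v f y) 1 (lin l1) = 0" if "f \<in> G" for f using that by blast
      have zero_y: "hev y 1 (lin l1) = 0"
        using zero[OF G_scal[OF one_neq_zero]] by (simp only: act_identity[OF y])
      have l1: "l1 \<noteq> (0,0)" using hyp_pair_nz[OF h] by simp
      have eq: "berk_act v f y = y" if "f \<in> G" for f
        by (rule lin_zero_unique[OF l1 act_in_space[OF y] y zero[OF that] zero_y])
      have "y \<in> P1k v" by (rule lin_zero_in_P1k[OF l1 y zero_y])
      then have "infinite {berk_act v f y | f. f \<in> G}" using non_elem by (simp add: non_elementary_def)
      moreover have "{berk_act v f y | f. f \<in> G} \<subseteq> {y}" using eq by blast
      ultimately show False using finite_subset by blast
    qed
    then obtain f where f: "f \<in> G" "hev (berk_act v f y) 1 (lin l1) \<noteq> 0" by blast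
    note lims = hyp_pair_attracts[OF h G_det[OF f(1)] y f(2)]
    have "eventually (\<lambda>n. hev (berk_act v (mmult (mpow g n) f) y) 1 (lin l2) < \<epsilon> * v t) sequentially"
      by (rule order_tendstoD(2)[OF lims(1)]) (use \<epsilon> t in simp)
    moreover have "eventually (\<lambda>n. N < pgl_norm v (mmult (mpow g n) f)) sequentially"
      using lims(2) by (simp add: filterlim_at_top_dense)
    ultimately have "eventually (\<lambda>n. hev (berk_act v (mmult (mpow g n) f) y) 1 (lin l2) < \<epsilon> * v t \<and>
        N < pgl_norm v (mmult (mpow g n) f)) sequentially" by (rule eventually_conj)
    then obtain n where n: "hev (berk_act v (mmult (mpow g n) f) y) 1 (lin l2) < \<epsilon> * v t"
        "N < pgl_norm v (mmult (mpow g n) f)"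
      by (auto simp: eventually_sequentially)
    have "hev (berk_act v (mmult (mpow g n) f) y) 1 [:snd l2 / t, fst l2 / t:] < \<epsilon>"
      unfolding hev_lin_divide[OF act_in_space[OF y]] using n(1) t by (simp add: lin_def divide_less_eq)
    then show ?thesis using n(2) G_mult[OF G_mpow[OF g] f(1)] by blast
  qed
  show thesis
  proof (rule that[OF t(2) _ attr])
    show "hev x 1 [:snd l2 / t, fst l2 / t:] = 0"
      using 0 by (simp add: hev_lin_divide[OF x] lin_def)
  qed
qed

section \<open>Closure of the hyperbolic fixed points\<close>

definition limset where "limset = berk_top v closure_of fixpts"

lemma closedin_limset: "closedin (berk_top v) limset"
  by (simp add: limset_def)

lemma fixpts_subset_limset: "fixpts \<subseteq> limset"
  unfolding limset_def by (rule closure_of_subset) (simp add: fixpts_subset_space)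

lemma limset_subset_space: "limset \<subseteq> berk_space v"
  using closedin_subset[OF closedin_limset] by simp

lemma metrizable_limset: "metrizable_space (subtopology (berk_top v) limset)"
  unfolding limset_def by (rule metrizable_closure_countable[OF countable_fixpts fixpts_subset_P1k])

lemma limset_sequence:
  assumes "y \<in> limset"
  obtains \<sigma> :: "nat \<Rightarrow> _" where "\<And>n. \<sigma> n \<in> fixpts" "limitin (berk_top v) \<sigma> y sequentially"
proof -
  have "fixpts \<subseteq> topspace (berk_top v)" using fixpts_subset_space by simp
  from metrizable_closure_sequence[OF metrizable_limset[unfolded limset_def] this assms[unfolded limset_def]]
  show thesis using that by blast
qed

lemma limset_invariant:
  assumes y: "y \<in> limset" and g: "g \<in> G"
  shows "berk_act v g y \<in> limset"
proof -
  obtain \<sigma> where \<sigma>: "\<And>n::nat. \<sigma> n \<in> fixpts" "limitin (berk_top v) \<sigma> y sequentially"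
    using limset_sequence[OF y] by blast
  show ?thesis
  proof (rule limitin_closedin[OF limitin_act[OF \<sigma>(2) G_det[OF g]] closedin_limset])
    show "eventually (\<lambda>n. berk_act v g (\<sigma> n) \<in> limset) sequentially"
      by (intro always_eventually allI subsetD[OF fixpts_subset_limset] fixpts_invariant[OF \<sigma>(1) g])
  qed simp
qed

text \<open>A diagonal choice: fixed points \<open>\<sigma> n\<close> tend to \<open>y\<close>, and
  \<open>h n\<close> brings \<open>x\<close> close to \<open>\<sigma> n\<close>, measured by a form
  vanishing at \<open>\<sigma> n\<close>. The forms vary with \<open>n\<close>, as
  \<open>limitin_berk_top_close\<close> permits.\<close>

lemma limset_reached:
  assumes x: "x \<in> berk_space v" and y: "y \<in> limset"
  obtains g :: "nat \<Rightarrow> 'a mat2" where "\<And>n. g n \<in> G"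
    "filterlim (\<lambda>n. pgl_norm v (g n)) at_top sequentially"
    "limitin (berk_top v) (\<lambda>n. berk_act v (g n) x) y sequentially"
proof -
  obtain \<sigma> where \<sigma>: "\<And>n::nat. \<sigma> n \<in> fixpts" "limitin (berk_top v) \<sigma> y sequentially"
    using limset_sequence[OF y] by blast
  have "\<exists>a b h. max (v a) (v b) = 1 \<and> hev (\<sigma> n) 1 [:b,a:] = 0 \<and> h \<in> G \<and>
      hev (berk_act v h x) 1 [:b,a:] < 1 / real (Suc n) \<and> real n < pgl_norm v h" for n
  proof -
    obtain a b where ab: "max (v a) (v b) = 1" "hev (\<sigma> n) 1 [:b,a:] = 0"
      "\<And>y \<epsilon> N. y \<in> berk_space v \<Longrightarrow> 0 < \<epsilon> \<Longrightarrow>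
         \<exists>h\<in>G. hev (berk_act v h y) 1 [:b,a:] < \<epsilon> \<and> N < pgl_norm v h"
      using fixpts_attract[OF \<sigma>(1)] by metis
    have "\<exists>h\<in>G. hev (berk_act v h x) 1 [:b,a:] < 1 / real (Suc n) \<and> real n < pgl_norm v h"
      by (rule ab(3)[OF x]) simp
    with ab(1,2) show ?thesis by meson
  qed
  then obtain a b h where h: "\<And>n. max (v (a n)) (v (b n)) = 1" "\<And>n. hev (\<sigma> n) 1 [:b n, a n:] = 0"
      "\<And>n. h n \<in> G" "\<And>n. hev (berk_act v (h n) x) 1 [:b n, a n:] < 1 / real (Suc n)"
      "\<And>n. real n < pgl_norm v (h n)"
    by metis
  show thesis
  proof (rule that[of h])
    show "h n \<in> G" for n by (rule h(3))
    show "filterlim (\<lambda>n. pgl_norm v (h n)) at_top sequentially"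
      by (rule filterlim_at_top_mono[OF filterlim_real_sequentially]) (simp add: h(5) less_imp_le)
    show "limitin (berk_top v) (\<lambda>n. berk_act v (h n) x) y sequentially"
    proof (rule limitin_berk_top_close[OF h(1) _ act_in_space[OF x] _ _ \<sigma>(2)])
      show "\<sigma> n \<in> berk_space v" for n using \<sigma>(1) fixpts_subset_space by blast
      show "(\<lambda>n. hev (\<sigma> n) 1 [:b n, a n:]) \<longlonglongrightarrow> 0" by (simp add: h(2))
      show "(\<lambda>n. hev (berk_act v (h n) x) 1 [:b n, a n:]) \<longlonglongrightarrow> 0"
      proof (rule tendsto_sandwich[OF _ _ tendsto_const LIMSEQ_Suc[OF lim_1_over_n]])
        show "eventually (\<lambda>n. 0 \<le> hev (berk_act v (h n) x) 1 [:b n, a n:]) sequentially"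
          by (simp add: hev_nonneg[OF act_in_space[OF x]])
        show "eventually (\<lambda>n. hev (berk_act v (h n) x) 1 [:b n, a n:] \<le> 1 / of_nat (Suc n)) sequentially"
          by (intro always_eventually allI less_imp_le h(4))
      qed
    qed
  qed
qed

text \<open>The orbit of any single point of \<open>M\<close> already approaches every point of
  \<open>limset\<close>.\<close>

lemma limset_minimal:
  assumes M: "M \<noteq> {}" "closedin (berk_top v) M" "invariant_set v G M"
  shows "limset \<subseteq> M"
proof
  fix y assume y: "y \<in> limset"
  obtain x where x: "x \<in> M" using M by blast
  then have "x \<in> berk_space v" using closedin_subset[OF M(2)] by auto
  then obtain g where g: "\<And>n::nat. g n \<in> G" "limitin (berk_top v) (\<lambda>n. berk_act v (g n) x) y sequentially"
    using limset_reached y by metis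
  show "y \<in> M"
    by (rule limitin_closedin[OF g(2) M(2)]) (use g(1) x M(3) in \<open>auto simp: invariant_set_def\<close>)
qed

text \<open>If \<open>x\<close> stays away from the repelling forms along a subsequence, then the images of \<open>x\<close> and of
  suitable limit points have the same limit.  Otherwise \<open>x\<close> itself is the limit of images of
  limit points under the inverses.\<close>

lemma limit_in_limset:
  assumes x: "x \<in> berk_space v" and g: "\<And>n::nat. g n \<in> G"
    and norm: "filterlim (\<lambda>n. pgl_norm v (g n)) at_top sequentially"
    and lim: "limitin (berk_top v) (\<lambda>n. berk_act v (g n) x) y sequentially"
  shows "y \<in> limset"
proof -
  define \<epsilon> where "\<epsilon> n = 1 / pgl_norm v (g n) ^ 2" for n
  have \<epsilon>: "\<epsilon> \<longlonglongrightarrow> 0"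
  proof -
    have "(\<lambda>n. inverse (pgl_norm v (g n)) ^ 2) \<longlonglongrightarrow> 0 ^ 2"
      by (intro tendsto_power filterlim_compose[OF tendsto_inverse_0_at_top norm])
         (rule filterlim_ident)
    moreover have "inverse (pgl_norm v (g n)) ^ 2 = \<epsilon> n" for n
      by (simp add: \<epsilon>_def inverse_eq_divide power_divide)
    ultimately show ?thesis by (simp only: zero_power2)
  qed
  have "\<exists>a1 b1 a2 b2. max (v a1) (v b1) = 1 \<and> max (v a2) (v b2) = 1 \<and> (\<forall>x\<in>berk_space v.
      hev (berk_act v (g n) x) 1 [:b1,a1:] * hev x 1 [:b2,a2:] \<le> \<epsilon> n \<and>
      hev (berk_act v (minv (g n)) x) 1 [:b2,a2:] * hev x 1 [:b1,a1:] \<le> \<epsilon> n)" for n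
    unfolding \<epsilon>_def by (rule cartan_forms[OF G_det[OF g[of n]]]) metis
  then obtain a1 b1 a2 b2 where n1: "\<And>n. max (v (a1 n)) (v (b1 n)) = 1" and n2: "\<And>n. max (v (a2 n)) (v (b2 n)) = 1"
    and fwd: "\<And>n x. x \<in> berk_space v \<Longrightarrow> hev (berk_act v (g n) x) 1 [:b1 n, a1 n:] * hev x 1 [:b2 n, a2 n:] \<le> \<epsilon> n"
    and bwd: "\<And>n x. x \<in> berk_space v \<Longrightarrow> hev (berk_act v (minv (g n)) x) 1 [:b2 n, a2 n:] * hev x 1 [:b1 n, a1 n:] \<le> \<epsilon> n"
    by metis
  \<comment> \<open>No normalised form is below \<open>\<eta>\<close> at both points. Whatever the
    forms are for a given \<open>n\<close>, one of the two points stays away from them, so no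
    convergence of the forms is needed.\<close>
  obtain p1 p2 where p: "p1 \<in> fixpts" "p2 \<in> fixpts" "p1 \<noteq> p2" by (rule two_fixpts)
  then have pX: "p1 \<in> berk_space v" "p2 \<in> berk_space v" using fixpts_subset_space by auto
  obtain \<eta> where \<eta>: "0 < \<eta>"
    "\<And>a b. max (v a) (v b) = 1 \<Longrightarrow> \<eta> \<le> hev p1 1 [:b,a:] \<or> \<eta> \<le> hev p2 1 [:b,a:]"
    using linear_form_separation[OF pX p(3)] by metis
  have away: "\<exists>q\<in>limset. \<eta> \<le> hev q 1 [:b,a:]" if "max (v a) (v b) = 1" for a b
    using \<eta>(2)[OF that] p fixpts_subset_limset by blast
  have small: "s \<le> \<epsilon> n / c" if "s * r \<le> \<epsilon> n" "c \<le> r" "0 < c" "0 \<le> s" for s r c n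
    using that mult_left_mono[of c r s] by (simp add: pos_le_divide_eq)
  have to0: "((\<lambda>n. \<epsilon> n / c) \<longlongrightarrow> 0) F" if "F \<le> sequentially" for F c
    using tendsto_divide[OF tendsto_mono[OF that \<epsilon>] tendsto_const[of c]]
    by (cases "c = 0") auto
  show ?thesis
  proof (cases "(\<lambda>n. hev x 1 [:b2 n, a2 n:]) \<longlonglongrightarrow> 0")
    case True
    have "\<exists>q. q \<in> limset \<and> \<eta> \<le> hev q 1 [:b1 n, a1 n:]" for n using away[OF n1] by blast
    then obtain q where q: "\<And>n. q n \<in> limset" "\<And>n. \<eta> \<le> hev (q n) 1 [:b1 n, a1 n:]" by metis
    define z where "z n = berk_act v (minv (g n)) (q n)" for n
    have qX: "q n \<in> berk_space v" for n using q(1) limset_subset_space by blast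
    have zX: "z n \<in> berk_space v" for n unfolding z_def by (rule act_in_space[OF qX])
    have zb: "hev (z n) 1 [:b2 n, a2 n:] \<le> \<epsilon> n / \<eta>" for n
      unfolding z_def by (rule small[OF bwd[OF qX] q(2) \<eta>(1) hev_nonneg[OF act_in_space[OF qX]]])
    have "(\<lambda>n. hev (z n) 1 [:b2 n, a2 n:]) \<longlonglongrightarrow> 0"
      by (rule tendsto_sandwich[OF _ _ tendsto_const to0[OF order_refl, of \<eta>]])
         (intro always_eventually allI hev_nonneg[OF zX] zb)+
    then have "limitin (berk_top v) z x sequentially"
      using x by (intro limitin_berk_top_close[OF n2 x zX True]) simp_all
    moreover have "eventually (\<lambda>n. z n \<in> limset) sequentially"
      unfolding z_def by (intro always_eventually allI limset_invariant q G_inv g)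
    ultimately have "x \<in> limset"
      by (rule limitin_closedin[OF _ closedin_limset]) simp
    then have "eventually (\<lambda>n. berk_act v (g n) x \<in> limset) sequentially"
      by (intro always_eventually allI limset_invariant g)
    then show ?thesis
      by (rule limitin_closedin[OF lim closedin_limset]) simp
  next
    case False
    then obtain c where c: "0 < c" "\<not> eventually (\<lambda>n. hev x 1 [:b2 n, a2 n:] < c) sequentially"
      using hev_nonneg[OF x] by (auto simp: tendsto_iff)
    define A where "A = {n. c \<le> hev x 1 [:b2 n, a2 n:]}"
    \<comment> \<open>A filter in place of a subsequence; it is proper because \<open>A\<close>
      contains arbitrarily large indices.\<close>
    define F where "F = inf sequentially (principal A)"
    have F: "F \<noteq> bot" "F \<le> sequentially"
      using c(2) by (auto simp: F_def A_def trivial_limit_def eventually_inf_principal not_le)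
    have evF: "eventually (\<lambda>n. n \<in> A) F" by (simp add: F_def eventually_inf_principal)
    have "\<exists>q. q \<in> limset \<and> \<eta> \<le> hev q 1 [:b2 n, a2 n:]" for n using away[OF n2] by blast
    then obtain q where q: "\<And>n. q n \<in> limset" "\<And>n. \<eta> \<le> hev (q n) 1 [:b2 n, a2 n:]" by metis
    define z where "z n = berk_act v (g n) (q n)" for n
    have qX: "q n \<in> berk_space v" for n using q(1) limset_subset_space by blast
    have zX: "z n \<in> berk_space v" for n unfolding z_def by (rule act_in_space[OF qX])
    have zb: "hev (z n) 1 [:b1 n, a1 n:] \<le> \<epsilon> n / \<eta>" for n
      unfolding z_def by (rule small[OF fwd[OF qX] q(2) \<eta>(1) hev_nonneg[OF act_in_space[OF qX]]])
    have "((\<lambda>n. hev (z n) 1 [:b1 n, a1 n:]) \<longlongrightarrow> 0) F"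
      by (rule tendsto_sandwich[OF _ _ tendsto_const to0[OF F(2), of \<eta>]])
         (intro always_eventually allI hev_nonneg[OF zX] zb)+
    moreover have "((\<lambda>n. hev (berk_act v (g n) x) 1 [:b1 n, a1 n:]) \<longlongrightarrow> 0) F"
    proof (rule tendsto_sandwich[OF _ _ tendsto_const to0[OF F(2), of c]])
      show "eventually (\<lambda>n. 0 \<le> hev (berk_act v (g n) x) 1 [:b1 n, a1 n:]) F"
        by (intro always_eventually allI hev_nonneg[OF act_in_space[OF x]])
      show "eventually (\<lambda>n. hev (berk_act v (g n) x) 1 [:b1 n, a1 n:] \<le> \<epsilon> n / c) F"
        using evF
      proof (rule eventually_mono)
        fix n assume "n \<in> A"
        then show "hev (berk_act v (g n) x) 1 [:b1 n, a1 n:] \<le> \<epsilon> n / c"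
          by (intro small[OF fwd[OF x] _ c(1) hev_nonneg[OF act_in_space[OF x]]]) (simp add: A_def)
      qed
    qed
    moreover have "limitin (berk_top v) (\<lambda>n. berk_act v (g n) x) y F"
      using lim F(2) by (auto simp: limitin_def le_filter_def)
    ultimately have "limitin (berk_top v) z y F"
      by (intro limitin_berk_top_close[OF n1 act_in_space[OF x] zX])
    moreover have "eventually (\<lambda>n. z n \<in> limset) F"
      unfolding z_def by (intro always_eventually allI limset_invariant q g)
    ultimately show ?thesis
      by (rule limitin_closedin[OF _ closedin_limset _ F(1)])
  qed
qed

end

theorem theorem2p20:
  fixes v :: "'a::field \<Rightarrow> real" and G :: "'a mat2 set"
  assumes "nonarch_abs v" and "nontrivial_abs v" and "complete_abs v"
    and "pgl_subgroup G" and "pgl_fin_gen G" and "non_elementary v G"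
  shows "\<exists>L. L = berk_top v closure_of hyp_fixed_points v G
     \<and> L \<noteq> {} \<and> closedin (berk_top v) L \<and> invariant_set v G L
     \<and> (\<forall>M. M \<noteq> {} \<and> closedin (berk_top v) M \<and> invariant_set v G M \<longrightarrow> L \<subseteq> M)
     \<and> (\<forall>x\<in>berk_space v. L = {y. \<exists>g::nat \<Rightarrow> 'a mat2. (\<forall>n. g n \<in> G)
            \<and> filterlim (\<lambda>n. pgl_norm v (g n)) at_top sequentially
            \<and> limitin (berk_top v) (\<lambda>n. berk_act v (g n) x) y sequentially})
     \<and> compactin (berk_top v) L \<and> metrizable_space (subtopology (berk_top v) L)
     \<and> L \<subseteq> berk_H v \<union> P1k v"
proof -
  interpret nonelementary_group v G
    using assms by unfold_locales auto
  show ?thesis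
  proof (intro exI[of _ limset] conjI allI impI ballI)
    show "limset = berk_top v closure_of hyp_fixed_points v G" by (rule limset_def)
    show "limset \<noteq> {}" using two_fixpts fixpts_subset_limset by blast
    show "closedin (berk_top v) limset" by (rule closedin_limset)
    show "invariant_set v G limset" unfolding invariant_set_def using limset_invariant by blast
    show "limset \<subseteq> M" if "M \<noteq> {} \<and> closedin (berk_top v) M \<and> invariant_set v G M" for M
      using that limset_minimal by blast
    show "limset = {y. \<exists>g::nat \<Rightarrow> 'a mat2. (\<forall>n. g n \<in> G)
            \<and> filterlim (\<lambda>n. pgl_norm v (g n)) at_top sequentially
            \<and> limitin (berk_top v) (\<lambda>n. berk_act v (g n) x) y sequentially}" if x: "x \<in> berk_space v" for x
    proof (intro subset_antisym subsetI CollectI)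
      fix y assume "y \<in> limset"
      then obtain g where "\<And>n::nat. g n \<in> G" "filterlim (\<lambda>n. pgl_norm v (g n)) at_top sequentially"
        "limitin (berk_top v) (\<lambda>n. berk_act v (g n) x) y sequentially"
        using limset_reached[OF x, of y] by metis
      then show "\<exists>g::nat \<Rightarrow> 'a mat2. (\<forall>n. g n \<in> G)
            \<and> filterlim (\<lambda>n. pgl_norm v (g n)) at_top sequentially
            \<and> limitin (berk_top v) (\<lambda>n. berk_act v (g n) x) y sequentially"
        by (intro exI[of _ g]) simp
    qed (auto intro: limit_in_limset[OF x])
    show "compactin (berk_top v) limset"
      using closedin_limset compact_space_berk_top by (rule closedin_compact_space[rotated])
    show "metrizable_space (subtopology (berk_top v) limset)" by (rule metrizable_limset)
    show "limset \<subseteq> berk_H v \<union> P1k v"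
      unfolding limset_def by (rule closure_P1k_subset[OF fixpts_subset_P1k])
  qed
qed

end
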